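(* Given $h>0$, $\Delta t=\kappa h$ for a sufficiently small $\kappa>0$, and a small tolerance $\epsilon>0$, there is a number of iterations $\bar s\in\mathbb{N}_+$, $\bar s\le C|\log\epsilon|$, such that the iterates $(d_h^{m,s},w_h^{m,s})$ of the fixed point iteration started from $(d_h^m,w_h^m)$ satisfy the stopping criterion at $s=\bar s$, $$\left\|w_h^{m,\bar s+1}-w_h^{m,\bar s}\right\|_{L^2(\Omega)}+\left\|\nabla_hd_h^{m,\bar s+1}-\nabla_hd_h^{m,\bar s}\right\|_{L^2(\Omega)}<\epsilon,$$ and the error satisfies $$\left\|w_h^{m+1}-w_h^{m,s}\right\|_{L^2(\Omega)}+\left\|\nabla_hd_h^{m+1}-\nabla_hd_h^{m,s}\right\|_{L^2(\Omega)}<\epsilon\qquad\text{for all } s\ge\bar s.$$ Here $C$ is a constant independent of $\epsilon$ and $h$.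
   Context: Domain: $\Omega\subset\mathbb{R}^n$, $n\in\{2,3\}$, is either the unit box $[0,1]^n$ with homogeneous Neumann boundary conditions or the torus $\mathbb{T}^n$. All unknowns take values in $\mathbb{R}^3$. Grid: $N$ is the number of degrees of freedom, $M=N^{1/n}$ is assumed to be an integer, $h=1/M$. The grid points are $x_{\underline i}=h\,\underline i$ for multiindices $\underline i\in\mathcal I_N=\{0,\dots,M\}^n$; the boundary conditions of the problem (periodic or homogeneous Neumann) are imposed on grid functions. With $e_j$ the $j$-th unit multiindex, $D_j^+f_{\underline i}=(f_{\underline i+e_j}-f_{\underline i})/h$, $D_j^-f_{\underline i}=D_j^+f_{\underline i-e_j}$, $\nabla_h=(D_1^-,\dots,D_n^-)^T$, $\Delta_h=\sum_{j=1}^nD_j^+D_j^-$. A grid function $f_{\underline i}$ is identified with the piecewise constant function $f_h(x)=f_{\underline i}$ for $x\in E_{\underline i}=\prod_{j=1}^n[(i_j-\tfrac12)h,(i_j+\tfrac12)h)$. Scheme: given $d^0\in H^1(\Omega)$, $|d^0|=1$, and $d^0_t\in L^2(\Omega)$, the initial values $d^0_{\underline i}$, $w^0_{\underline i}$ are the averages over $E_{\underline i}$ of $d^0$ and $d^0_t\times d^0$, and $(d^m_h,w^m_h)$, $m\ge1$, is determined sequentially by, with $f^{m+1/2}=\tfrac12(f^m+f^{m+1})$, $$\frac{d^{m+1}_{\underline i}-d^m_{\underline i}}{\Delta t}=d^{m+1/2}_{\underline i}\times w^{m+1/2}_{\underline i},\qquad\frac{w^{m+1}_{\underline i}-w^m_{\underline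 i}}{\Delta t}=\Delta_hd^{m+1/2}_{\underline i}\times d^{m+1/2}_{\underline i}.$$ Throughout, $|d^m_{\underline i}|=|d^0_{\underline i}|=1$ for all $\underline i$ and $m$. Fixed point iteration: given $(d_h^m,w_h^m)$ satisfying the scheme, set $(d_h^{m,0},w_h^{m,0})=(d_h^m,w_h^m)$ and iteratively solve for $(d_h^{m,s+1},w_h^{m,s+1})$, $s\ge0$, from $$\frac{d_h^{m,s+1}-d_h^m}{\Delta t}=\tfrac12\big(d_h^m+d_h^{m,s+1}\big)\times\tfrac12\big(w_h^m+w_h^{m,s}\big),$$ $$\frac{w_h^{m,s+1}-w_h^m}{\Delta t}=\tfrac12\big(\Delta_hd_h^m+\Delta_hd_h^{m,s+1}\big)\times\tfrac12\big(d_h^m+d_h^{m,s+1}\big).$$ $(d_h^{m+1},w_h^{m+1})$ denotes the exact solution of the next step of the scheme. *)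

theory Defs
  imports "HOL-Analysis.Analysis"
begin

section \<open>Domain and function spaces\<close>

datatype domain = Neumann_Box | Torus

text \<open>
  Functions on the torus are represented by functions on the whole space that have period 1 in
  every coordinate; integrals over the torus are integrals over the unit cell.  So the same set
  \<open>Omega\<close> serves both domains.
\<close>

definition Omega :: "(real^'n) set" where
  "Omega = cbox 0 1"

definition on_domain :: "domain \<Rightarrow> (real^'n \<Rightarrow> 'b) \<Rightarrow> bool" where
  "on_domain \<Omega> u \<longleftrightarrow> (\<Omega> = Torus \<longrightarrow> (\<forall>x j. u (x + axis j 1) = u x))"

definition L2_space :: "domain \<Rightarrow> (real^'n \<Rightarrow> real^3) set" where
  "L2_space \<Omega> = {u. on_domain \<Omega> u \<and> u \<in> borel_measurable (lebesgue_on Omega) \<and>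
     integrable (lebesgue_on Omega) (\<lambda>x. (norm (u x))\<^sup>2)}"

definition L2norm :: "(real^'n \<Rightarrow> 'b::real_normed_vector) \<Rightarrow> real" where
  "L2norm f = sqrt (\<integral>x. (norm (f x))\<^sup>2 \<partial>lebesgue_on Omega)"

definition dir_deriv :: "'n \<Rightarrow> (real^'n \<Rightarrow> real) \<Rightarrow> real^'n \<Rightarrow> real" where
  "dir_deriv j f x = frechet_derivative f (at x) (axis j 1)"

primrec Ck :: "nat \<Rightarrow> (real^'n \<Rightarrow> real) \<Rightarrow> bool" where
  "Ck 0 f \<longleftrightarrow> continuous_on UNIV f"
| "Ck (Suc k) f \<longleftrightarrow> f differentiable_on UNIV \<and> (\<forall>j. Ck k (dir_deriv j f))"

definition test_functions :: "(real^'n) set \<Rightarrow> (real^'n \<Rightarrow> real) set" where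
  "test_functions U = {\<phi>. (\<forall>k. Ck k \<phi>) \<and>
     compact (closure {x. \<phi> x \<noteq> 0}) \<and> closure {x. \<phi> x \<noteq> 0} \<subseteq> U}"

definition weak_deriv ::
  "(real^'n) set \<Rightarrow> 'n \<Rightarrow> (real^'n \<Rightarrow> real^3) \<Rightarrow> (real^'n \<Rightarrow> real^3) \<Rightarrow> bool" where
  "weak_deriv U j u g \<longleftrightarrow> (\<forall>\<phi>\<in>test_functions U.
     (\<integral>x. dir_deriv j \<phi> x *\<^sub>R u x \<partial>lebesgue_on U) = - (\<integral>x. \<phi> x *\<^sub>R g x \<partial>lebesgue_on U))"

text \<open>
  Weak derivatives on the torus are taken locally: the periodic functions are tested on the
  whole space, so that no jump across the faces of the unit cell is possible.
\<close>

definition H1_space :: "domain \<Rightarrow> (real^'n \<Rightarrow> real^3) set" where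
  "H1_space \<Omega> = {u \<in> L2_space \<Omega>. \<forall>j. \<exists>g \<in> L2_space \<Omega>.
     weak_deriv (case \<Omega> of Neumann_Box \<Rightarrow> box 0 1 | Torus \<Rightarrow> UNIV) j u g}"

section \<open>Grid functions\<close>

text \<open>
  A grid function lives on all integer multiindices; only the values at \<open>grid M\<close> and at the
  neighbouring ghost indices matter.  The boundary conditions fix the ghost values: periodic
  continuation with period \<open>M\<close>, or vanishing one-sided differences \<open>D\<^sub>j\<^sup>- f\<close> at \<open>i\<^sub>j = 0\<close> and
  \<open>D\<^sub>j\<^sup>+ f\<close> at \<open>i\<^sub>j = M\<close> for homogeneous Neumann conditions.
\<close>

definition grid :: "nat \<Rightarrow> (int^'n) set" where
  "grid M = {i. \<forall>k. 0 \<le> i $ k \<and> i $ k \<le> int M}"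

definition bc :: "domain \<Rightarrow> nat \<Rightarrow> (int^'n \<Rightarrow> 'b) \<Rightarrow> bool" where
  "bc \<Omega> M f \<longleftrightarrow> (case \<Omega> of
      Torus \<Rightarrow> \<forall>i j. f (i + axis j (int M)) = f i
    | Neumann_Box \<Rightarrow> \<forall>i\<in>grid M. \<forall>j.
        (i $ j = 0 \<longrightarrow> f (i - axis j 1) = f i) \<and>
        (i $ j = int M \<longrightarrow> f (i + axis j 1) = f i))"

definition Dplus :: "real \<Rightarrow> 'n \<Rightarrow> (int^'n \<Rightarrow> 'b::real_vector) \<Rightarrow> int^'n \<Rightarrow> 'b" where
  "Dplus h j f i = (f (i + axis j 1) - f i) /\<^sub>R h"

definition Dminus :: "real \<Rightarrow> 'n \<Rightarrow> (int^'n \<Rightarrow> 'b::real_vector) \<Rightarrow> int^'n \<Rightarrow> 'b" where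
  "Dminus h j f i = Dplus h j f (i - axis j 1)"

definition nabla_h :: "real \<Rightarrow> (int^'n \<Rightarrow> real^3) \<Rightarrow> int^'n \<Rightarrow> real^3^'n" where
  "nabla_h h f i = (\<chi> j. Dminus h j f i)"

definition laplace_h :: "real \<Rightarrow> (int^'n \<Rightarrow> real^3) \<Rightarrow> int^'n \<Rightarrow> real^3" where
  "laplace_h h f i = (\<Sum>j\<in>UNIV. Dplus h j (Dminus h j f) i)"

definition cell :: "real \<Rightarrow> int^'n \<Rightarrow> (real^'n) set" where
  "cell h i = {x. \<forall>k. (real_of_int (i $ k) - 1/2) * h \<le> x $ k \<and>
                       x $ k < (real_of_int (i $ k) + 1/2) * h}"

text \<open>The piecewise constant function with value \<open>f i\<close> on \<open>cell h i\<close>.\<close>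

definition pc :: "real \<Rightarrow> (int^'n \<Rightarrow> 'b) \<Rightarrow> real^'n \<Rightarrow> 'b" where
  "pc h f x = f (\<chi> k. \<lfloor>x $ k / h + 1/2\<rfloor>)"

lemma pc_cell:
  assumes "h > 0" "x \<in> cell h i"
  shows "pc h f x = f i"
proof -
  have "\<lfloor>x $ k / h + 1/2\<rfloor> = i $ k" for k
    using assms by (intro floor_unique) (auto simp: cell_def field_simps)
  then show ?thesis
    by (simp add: pc_def)
qed

text \<open>On the box the cells of boundary grid points are cut off at the boundary.\<close>

definition cell_average :: "domain \<Rightarrow> real \<Rightarrow> (real^'n \<Rightarrow> real^3) \<Rightarrow> int^'n \<Rightarrow> real^3" where
  "cell_average \<Omega> h u i =
     (let E = (case \<Omega> of Neumann_Box \<Rightarrow> cell h i \<inter> Omega | Torus \<Rightarrow> cell h i)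
      in (\<integral>x. u x \<partial>lebesgue_on E) /\<^sub>R measure lebesgue E)"

section \<open>The scheme and the fixed point iteration\<close>

definition mid :: "('i \<Rightarrow> real^3) \<Rightarrow> ('i \<Rightarrow> real^3) \<Rightarrow> 'i \<Rightarrow> real^3" where
  "mid f g i = (1/2) *\<^sub>R (f i + g i)"

text \<open>
  No unit length is required of the initial grid values: the averages of a unit field have length
  at most 1, and asking for length exactly 1 would leave only constant fields.  The scheme
  preserves the length at every grid point.
\<close>

definition scheme_solution ::
  "domain \<Rightarrow> nat \<Rightarrow> real \<Rightarrow> real \<Rightarrow> (real^'n \<Rightarrow> real^3) \<Rightarrow> (real^'n \<Rightarrow> real^3) \<Rightarrow>
   (nat \<Rightarrow> int^'n \<Rightarrow> real^3) \<Rightarrow> (nat \<Rightarrow> int^'n \<Rightarrow> real^3) \<Rightarrow> bool" where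
  "scheme_solution \<Omega> M h dt d0 dt0 d w \<longleftrightarrow>
     (\<forall>m. bc \<Omega> M (d m) \<and> bc \<Omega> M (w m)) \<and>
     (\<forall>i\<in>grid M. d 0 i = cell_average \<Omega> h d0 i \<and>
                 w 0 i = cell_average \<Omega> h (\<lambda>x. cross3 (dt0 x) (d0 x)) i) \<and>
     (\<forall>m. \<forall>i\<in>grid M.
        (d (Suc m) i - d m i) /\<^sub>R dt =
          cross3 (mid (d m) (d (Suc m)) i) (mid (w m) (w (Suc m)) i) \<and>
        (w (Suc m) i - w m i) /\<^sub>R dt =
          cross3 (laplace_h h (mid (d m) (d (Suc m))) i) (mid (d m) (d (Suc m)) i))"

definition fixed_point_iterates ::
  "domain \<Rightarrow> nat \<Rightarrow> real \<Rightarrow> real \<Rightarrow> (int^'n \<Rightarrow> real^3) \<Rightarrow> (int^'n \<Rightarrow> real^3) \<Rightarrow>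
   (nat \<Rightarrow> int^'n \<Rightarrow> real^3) \<Rightarrow> (nat \<Rightarrow> int^'n \<Rightarrow> real^3) \<Rightarrow> bool" where
  "fixed_point_iterates \<Omega> M h dt dm wm ds ws \<longleftrightarrow>
     (\<forall>s. bc \<Omega> M (ds s) \<and> bc \<Omega> M (ws s)) \<and>
     ds 0 = dm \<and> ws 0 = wm \<and>
     (\<forall>s. \<forall>i\<in>grid M.
        (ds (Suc s) i - dm i) /\<^sub>R dt = cross3 (mid dm (ds (Suc s)) i) (mid wm (ws s) i) \<and>
        (ws (Suc s) i - wm i) /\<^sub>R dt =
          cross3 (mid (laplace_h h dm) (laplace_h h (ds (Suc s))) i) (mid dm (ds (Suc s)) i))"

text \<open>The quantity measured both in the stopping criterion and in the error bound.\<close>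

definition pair_dist ::
  "real \<Rightarrow> (int^'n \<Rightarrow> real^3) \<Rightarrow> (int^'n \<Rightarrow> real^3) \<Rightarrow>
   (int^'n \<Rightarrow> real^3) \<Rightarrow> (int^'n \<Rightarrow> real^3) \<Rightarrow> real" where
  "pair_dist h d w d' w' =
     L2norm (\<lambda>x. pc h w x - pc h w' x) +
     L2norm (\<lambda>x. pc h (nabla_h h d) x - pc h (nabla_h h d') x)"

end

theory Submission
  imports Defs
begin

text \<open>
  The iteration contracts by a factor \<open>1/4\<close> in the discrete \<open>L\<^sup>2\<close> norm of the angular momentum \<open>w\<close>.
  Consider two linearised steps from the same state \<open>(d, w)\<close>, with momenta \<open>v\<^sub>1\<close> and \<open>v\<^sub>2\<close> in the
  director equation.  In the difference of the director equations the term that contains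
  \<open>d\<^sub>1 - d\<^sub>2\<close> is orthogonal to it, and directors have length at most \<open>1\<close>, so pointwise
  \<open>\<bar>d\<^sub>1 - d\<^sub>2\<bar> \<le> (\<Delta>t / 2) \<bar>v\<^sub>1 - v\<^sub>2\<bar>\<close>.  A discrete Laplacian costs \<open>h\<^sup>-\<^sup>2\<close>, and the momentum equation
  supplies another factor \<open>\<Delta>t\<close>; since \<open>\<Delta>t = \<kappa> h\<close>, the new momenta differ by \<open>O(\<kappa>\<^sup>2)\<close> times the
  difference of \<open>v\<^sub>1\<close> and \<open>v\<^sub>2\<close>, and the discrete gradients of the new directors by \<open>O(\<kappa>)\<close> times it
  (\<open>step_contraction\<close>).  The exact step is the linearised step with \<open>v = w'\<close>, hence both the
  error and the increments decay like \<open>4\<^sup>-\<^sup>s\<close> (\<open>iteration_error\<close>).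

  The number of iterations is uniform in \<open>h\<close> only if the starting error \<open>\<bar>w\<^sup>m\<^sup>+\<^sup>1 - w\<^sup>m\<bar>\<close> is.  The
  scheme conserves the discrete energy (\<open>energy_step\<close>), which follows from summation by parts;
  so it is enough to bound the energy of the initial values.  Its momentum part is controlled by
  the Cauchy-Schwarz inequality on each cell.  For its gradient part, the difference of the
  averages of \<open>d\<^sup>0\<close> over two neighbouring cells is the integral of \<open>d\<^sup>0\<close> against a function which
  has mean zero along the grid direction, and therefore is the derivative of a bounded function
  supported in the two cells; the definition of the weak derivative then bounds the difference
  by the integral of the weak derivative over the two cells (\<open>weak_deriv_average_diff\<close>,
  \<open>initial_energy_bound\<close>).  That function is not smooth; it is a limit of products of
  one-dimensional bumps, each of which can be differentiated explicitly, so that no convolution is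
  involved.

  Both boundary conditions are treated at once by replacing a ghost index by the index whose
  value it copies (locale \<open>shift_grid\<close>).
\<close>

section \<open>Cross products and Euclidean norms over finite sets\<close>

lemma norm_cross3_le: "norm (cross3 a b) \<le> norm a * norm b"
proof -
  have "(norm (cross3 a b))\<^sup>2 \<le> (norm a * norm b)\<^sup>2"
    using norm_cross_dot[of a b] by (smt (verit) zero_le_power2)
  then show ?thesis
    by (rule power2_le_imp_le) simp
qed

lemma L2_set_sum_le:
  assumes "finite J"
  shows "L2_set (\<lambda>i. \<Sum>j\<in>J. f j i) A \<le> (\<Sum>j\<in>J. L2_set (f j) A)"
  using assms
proof (induction J rule: finite_induct)
  case empty
  then show ?case by (simp add: L2_set_def)
next
  case (insert j J)
  then show ?case
    using L2_set_triangle_ineq[of "f j" "\<lambda>i. \<Sum>j\<in>J. f j i" A] by simp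
qed

lemma L2_set_norm_add_le:
  fixes f g :: "'i \<Rightarrow> 'b::real_normed_vector"
  shows "L2_set (\<lambda>i. norm (f i + g i)) A \<le> L2_set (\<lambda>i. norm (f i)) A + L2_set (\<lambda>i. norm (g i)) A"
  by (rule order_trans[OF L2_set_mono L2_set_triangle_ineq]) (auto simp: norm_triangle_ineq)

lemma L2_set_scale: "0 \<le> c \<Longrightarrow> L2_set (\<lambda>i. c * f i) A = c * L2_set f A"
  by (simp add: L2_set_right_distrib)

section \<open>Finite grids with neighbour maps\<close>

text \<open>
  Ghost values make a grid function periodic or reflect it at the boundary; in both cases the
  value at a neighbouring index equals the value at some index of a finite set \<open>G\<close>.  Replacing
  the neighbour \<open>i \<plusminus> e\<^sub>j\<close> by that index turns both boundary conditions into the same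
  combinatorial structure: the two neighbour maps in direction \<open>j\<close> are inverse to each other
  wherever they move a point, and a fixed point of a neighbour map is a boundary point at which
  the one-sided difference vanishes.
\<close>

locale shift_grid =
  fixes G :: "'i set" and sp sm :: "'n::finite \<Rightarrow> 'i \<Rightarrow> 'i" and h :: real
  assumes finite_G [simp]: "finite G"
    and sp_in [simp]: "i \<in> G \<Longrightarrow> sp j i \<in> G"
    and sm_in [simp]: "i \<in> G \<Longrightarrow> sm j i \<in> G"
    and sm_sp: "i \<in> G \<Longrightarrow> sp j i \<noteq> i \<Longrightarrow> sm j (sp j i) = i"
    and sp_sm: "i \<in> G \<Longrightarrow> sm j i \<noteq> i \<Longrightarrow> sp j (sm j i) = i"
    and h_pos: "0 < h"
begin

definition lap :: "('i \<Rightarrow> real^3) \<Rightarrow> 'i \<Rightarrow> real^3" where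
  "lap f i = (\<Sum>j\<in>UNIV. f (sp j i) - 2 *\<^sub>R f i + f (sm j i)) /\<^sub>R h\<^sup>2"

definition bdiff :: "'n \<Rightarrow> ('i \<Rightarrow> real^3) \<Rightarrow> 'i \<Rightarrow> real^3" where
  "bdiff j f i = (f i - f (sm j i)) /\<^sub>R h"

definition grid_norm :: "('i \<Rightarrow> real^3) \<Rightarrow> real" where
  "grid_norm f = L2_set (\<lambda>i. norm (f i)) G"

definition energy :: "('i \<Rightarrow> real^3) \<Rightarrow> ('i \<Rightarrow> real^3) \<Rightarrow> real" where
  "energy d w = (\<Sum>i\<in>G. (norm (w i))\<^sup>2) + (\<Sum>j\<in>UNIV. \<Sum>i\<in>G. (norm (bdiff j d i))\<^sup>2)"

text \<open>
  The common form of one step of the scheme and of one fixed point iteration: the linearised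
  step from \<open>(d, w)\<close> to \<open>(d', w')\<close> in which the new angular momentum inside the first
  equation is prescribed as \<open>v\<close>.  The scheme is the case \<open>v = w'\<close>.
\<close>

definition step ::
  "real \<Rightarrow> ('i \<Rightarrow> real^3) \<Rightarrow> ('i \<Rightarrow> real^3) \<Rightarrow> ('i \<Rightarrow> real^3) \<Rightarrow> ('i \<Rightarrow> real^3) \<Rightarrow> ('i \<Rightarrow> real^3) \<Rightarrow> bool"
  where "step dt d w v d' w' \<longleftrightarrow> (\<forall>i\<in>G.
     d' i - d i = dt *\<^sub>R cross3 (mid d d' i) (mid w v i) \<and>
     w' i - w i = dt *\<^sub>R cross3 (lap (mid d d') i) (mid d d' i))"

lemma mid_diff_left: "mid f g i - mid f g' i = (1/2) *\<^sub>R (g i - g' i)"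
  by (simp add: mid_def algebra_simps)

lemma lap_diff: "lap (\<lambda>i. f i - g i) i = lap f i - lap g i"
  unfolding lap_def real_vector.scale_right_diff_distrib[symmetric] sum_subtractf[symmetric]
  by (intro arg_cong2[where f="(*\<^sub>R)"] refl sum.cong) (simp add: algebra_simps)

lemma lap_scale: "lap (\<lambda>i. c *\<^sub>R f i) i = c *\<^sub>R lap f i"
  unfolding lap_def scaleR_sum_right
  by (intro sum.cong refl) (simp add: algebra_simps)

lemma bdiff_diff: "bdiff j (\<lambda>i. f i - g i) i = bdiff j f i - bdiff j g i"
  by (simp add: bdiff_def algebra_simps)

text \<open>
  Away from the fixed points the neighbour maps are mutually inverse bijections, so shifting the
  summation index is allowed for terms that vanish at the fixed points.
\<close>

lemma sum_shift:
  fixes F :: "'i \<Rightarrow> 'b::comm_monoid_add"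
  assumes "\<And>i. i \<in> G \<Longrightarrow> sm j i = i \<Longrightarrow> F i = 0"
  shows "(\<Sum>i\<in>G. F i) = (\<Sum>i\<in>{i\<in>G. sp j i \<noteq> i}. F (sp j i))"
proof -
  have "(\<Sum>i\<in>G. F i) = (\<Sum>i\<in>{i\<in>G. sm j i \<noteq> i}. F i)"
    using assms by (intro sum.mono_neutral_right) auto
  also have "\<dots> = (\<Sum>i\<in>{i\<in>G. sp j i \<noteq> i}. F (sp j i))"
  proof (rule sum.reindex_bij_witness[where i="sp j" and j="sm j"])
    show "sm j i \<in> {i \<in> G. sp j i \<noteq> i}" if "i \<in> {i \<in> G. sm j i \<noteq> i}" for i
      using that sp_sm[of i j] by auto
    show "sp j i \<in> {i \<in> G. sm j i \<noteq> i}" if "i \<in> {i \<in> G. sp j i \<noteq> i}" for i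
      using that sm_sp[of i j] by auto
  qed (auto simp: sm_sp sp_sm)
  finally show ?thesis .
qed

lemma summation_by_parts:
  "(\<Sum>i\<in>G. lap f i \<bullet> g i) = - (\<Sum>j\<in>UNIV. \<Sum>i\<in>G. bdiff j f i \<bullet> bdiff j g i)"
proof -
  have one: "(\<Sum>i\<in>G. (f (sp j i) - 2 *\<^sub>R f i + f (sm j i)) \<bullet> g i)
        = - (\<Sum>i\<in>G. (f i - f (sm j i)) \<bullet> (g i - g (sm j i)))" for j
  proof -
    have "(\<Sum>i\<in>G. (f i - f (sm j i)) \<bullet> g (sm j i))
        = (\<Sum>i\<in>{i\<in>G. sp j i \<noteq> i}. (f (sp j i) - f (sm j (sp j i))) \<bullet> g (sm j (sp j i)))"
      by (rule sum_shift) simp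
    also have "\<dots> = (\<Sum>i\<in>{i\<in>G. sp j i \<noteq> i}. (f (sp j i) - f i) \<bullet> g i)"
      by (intro sum.cong refl) (auto simp: sm_sp)
    also have "\<dots> = (\<Sum>i\<in>G. (f (sp j i) - f i) \<bullet> g i)"
      by (rule sum.mono_neutral_left) auto
    finally have *: "(\<Sum>i\<in>G. (f i - f (sm j i)) \<bullet> g (sm j i))
      = (\<Sum>i\<in>G. (f (sp j i) - f i) \<bullet> g i)" .
    have "(\<Sum>i\<in>G. (f (sp j i) - 2 *\<^sub>R f i + f (sm j i)) \<bullet> g i)
        = (\<Sum>i\<in>G. (f (sp j i) - f i) \<bullet> g i) - (\<Sum>i\<in>G. (f i - f (sm j i)) \<bullet> g i)"
    proof -
      have "f (sp j i) - 2 *\<^sub>R f i + f (sm j i) = (f (sp j i) - f i) - (f i - f (sm j i))" for i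
        by (simp add: scaleR_2)
      then show ?thesis
        by (simp only: inner_diff_left[of "f (sp j i) - f i" "f i - f (sm j i)" "g i" for i] sum_subtractf)
    qed
    also have "\<dots> = - (\<Sum>i\<in>G. (f i - f (sm j i)) \<bullet> (g i - g (sm j i)))"
      unfolding *[symmetric] sum_subtractf[symmetric] sum_negf[symmetric]
      by (intro sum.cong refl) (simp add: inner_diff_right)
    finally show ?thesis .
  qed
  have "(\<Sum>i\<in>G. lap f i \<bullet> g i)
      = (\<Sum>j\<in>UNIV. \<Sum>i\<in>G. (f (sp j i) - 2 *\<^sub>R f i + f (sm j i)) \<bullet> g i) / h\<^sup>2"
    unfolding lap_def inner_scaleR_left inner_sum_left sum_distrib_left[symmetric]
    by (subst sum.swap) (simp add: divide_inverse mult.commute)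
  also have "\<dots> = - (\<Sum>j\<in>UNIV. \<Sum>i\<in>G. bdiff j f i \<bullet> bdiff j g i)"
    unfolding one bdiff_def
    by (simp add: sum_negf sum_divide_distrib power2_eq_square divide_inverse sum_distrib_left sum_distrib_right mult.assoc
      mult.left_commute mult.commute)
  finally show ?thesis .
qed

lemma sum_sp_le:
  fixes F :: "'i \<Rightarrow> real"
  assumes F: "\<And>i. i \<in> G \<Longrightarrow> 0 \<le> F i"
  shows "(\<Sum>i\<in>G. F (sp j i)) \<le> 2 * (\<Sum>i\<in>G. F i)"
proof -
  have "(\<Sum>i\<in>G. F (sp j i)) = (\<Sum>i\<in>{i\<in>G. sp j i = i}. F i) + (\<Sum>i\<in>{i\<in>G. sp j i \<noteq> i}. F (sp j i))"
  proof -
    have "(\<Sum>i\<in>G. F (sp j i)) = (\<Sum>i\<in>{i\<in>G. sp j i = i}. F (sp j i)) + (\<Sum>i\<in>{i\<in>G. sp j i \<noteq> i}. F (sp j i))"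
      by (subst sum.union_disjoint[symmetric]) (auto intro!: sum.cong)
    then show ?thesis by simp
  qed
  also have "(\<Sum>i\<in>{i\<in>G. sp j i = i}. F i) \<le> sum F G"
    by (rule sum_mono2) (auto simp: F)
  also have "(\<Sum>i\<in>{i\<in>G. sp j i \<noteq> i}. F (sp j i)) = sum F (sp j ` {i\<in>G. sp j i \<noteq> i})"
  proof (subst sum.reindex)
    show "inj_on (sp j) {i\<in>G. sp j i \<noteq> i}"
      by (rule inj_on_inverseI[where g="sm j"]) (simp add: sm_sp)
  qed simp
  also have "\<dots> \<le> sum F G"
    by (rule sum_mono2) (auto simp: F)
  finally show ?thesis by simp
qed

lemma reverse: "shift_grid G sm sp h"
  using h_pos by unfold_locales (auto simp: sm_sp sp_sm)

lemmas sum_sm_le = shift_grid.sum_sp_le[OF reverse]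

text \<open>
  A neighbour map takes a value at most twice, once at a fixed point and once away from the
  fixed points; hence the factor \<open>sqrt 2 \<le> 2\<close>.
\<close>

lemma L2_set_shift_le:
  fixes F :: "'i \<Rightarrow> real"
  shows "L2_set (\<lambda>i. F (sp j i)) G \<le> 2 * L2_set F G" "L2_set (\<lambda>i. F (sm j i)) G \<le> 2 * L2_set F G"
proof -
  have *: "sqrt (2 * x) \<le> 2 * sqrt x" if "0 \<le> x" for x :: real
    using that by (auto intro!: real_le_lsqrt simp: power_mult_distrib)
  have nn: "0 \<le> (\<Sum>i\<in>G. (F i)\<^sup>2)" by (simp add: sum_nonneg)
  show "L2_set (\<lambda>i. F (sp j i)) G \<le> 2 * L2_set F G"
    unfolding L2_set_def
    by (rule order_trans[OF real_sqrt_le_mono[OF sum_sp_le] *[OF nn]]) simp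
  show "L2_set (\<lambda>i. F (sm j i)) G \<le> 2 * L2_set F G"
    unfolding L2_set_def
    by (rule order_trans[OF real_sqrt_le_mono[OF sum_sm_le] *[OF nn]]) simp
qed

lemma norm_lap_le:
  "norm (lap f i) \<le> (\<Sum>j\<in>UNIV. norm (f (sp j i)) + 2 * norm (f i) + norm (f (sm j i))) / h\<^sup>2"
proof -
  have "norm (\<Sum>j\<in>UNIV. f (sp j i) - 2 *\<^sub>R f i + f (sm j i))
     \<le> (\<Sum>j\<in>UNIV. norm (f (sp j i)) + 2 * norm (f i) + norm (f (sm j i)))"
    by (rule sum_norm_le) (rule order_trans[OF norm_triangle_ineq add_right_mono],
       rule order_trans[OF norm_triangle_ineq4], simp)
  then show ?thesis
    using h_pos by (simp add: lap_def divide_inverse mult.commute)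
qed

section \<open>One step of the scheme and of the iteration\<close>

text \<open>
  Testing the first equation with \<open>d + d'\<close> annihilates its right-hand side, because the cross
  product is orthogonal to its first factor.
\<close>

lemma step_norm:
  assumes "step dt d w v d' w'" "i \<in> G"
  shows "norm (d' i) = norm (d i)"
proof -
  have "(d' i - d i) \<bullet> (2 *\<^sub>R mid d d' i) = 0"
    using assms by (simp add: step_def dot_cross_self)
  then have "(d' i - d i) \<bullet> (d i + d' i) = 0"
    by (simp add: mid_def)
  then show ?thesis
    by (simp add: norm_eq_sqrt_inner inner_add_right inner_diff_left inner_diff_right inner_commute)
qed

text \<open>
  Testing the second equation with \<open>w + w'\<close> and the first with minus the discrete Laplacian of
  \<open>d + d'\<close> produces the same triple product with opposite signs.
\<close>

lemma energy_step:
  assumes st: "step dt d w w' d' w'"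
  shows "energy d' w' = energy d w"
proof -
  let ?m = "mid d d'" and ?n = "mid w w'"
  have w: "(norm (w' i))\<^sup>2 - (norm (w i))\<^sup>2 = 2 * dt * (cross3 (lap ?m i) (?m i) \<bullet> ?n i)"
    if "i \<in> G" for i
  proof -
    have "(norm (w' i))\<^sup>2 - (norm (w i))\<^sup>2 = 2 * ((w' i - w i) \<bullet> ?n i)"
      by (simp add: mid_def power2_norm_eq_inner algebra_simps inner_commute)
    then show ?thesis using st that by (simp add: step_def)
  qed
  have d: "lap ?m i \<bullet> (d' i - d i) = dt * (cross3 (lap ?m i) (?m i) \<bullet> ?n i)" if "i \<in> G" for i
  proof -
    have "lap ?m i \<bullet> cross3 (?m i) (?n i) = cross3 (lap ?m i) (?m i) \<bullet> ?n i"
      by (simp add: cross3_simps)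
    then show ?thesis using st that by (simp add: step_def)
  qed
  have g: "(norm (bdiff j d' i))\<^sup>2 - (norm (bdiff j d i))\<^sup>2
        = 2 * (bdiff j ?m i \<bullet> bdiff j (\<lambda>i. d' i - d i) i)" for i j
  proof -
    have "bdiff j ?m i = (1/2) *\<^sub>R (bdiff j d i + bdiff j d' i)"
      by (simp add: mid_def bdiff_def algebra_simps)
    then show ?thesis
      by (simp add: bdiff_diff power2_norm_eq_inner algebra_simps inner_commute)
  qed
  have "energy d' w' - energy d w
      = (\<Sum>i\<in>G. (norm (w' i))\<^sup>2 - (norm (w i))\<^sup>2)
        + (\<Sum>j\<in>UNIV. \<Sum>i\<in>G. (norm (bdiff j d' i))\<^sup>2 - (norm (bdiff j d i))\<^sup>2)"
    by (simp add: energy_def sum_subtractf)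
  also have "(\<Sum>j\<in>UNIV. \<Sum>i\<in>G. (norm (bdiff j d' i))\<^sup>2 - (norm (bdiff j d i))\<^sup>2)
      = - 2 * (\<Sum>i\<in>G. lap ?m i \<bullet> (d' i - d i))"
    unfolding g summation_by_parts by (simp add: sum_distrib_left sum_negf)
  also have "(\<Sum>i\<in>G. (norm (w' i))\<^sup>2 - (norm (w i))\<^sup>2) = 2 * (\<Sum>i\<in>G. lap ?m i \<bullet> (d' i - d i))"
    by (simp add: w d sum_distrib_left mult.assoc cong: sum.cong)
  finally show ?thesis by simp
qed

lemma grid_norm_diff_commute: "grid_norm (\<lambda>i. f i - g i) = grid_norm (\<lambda>i. g i - f i)"
  by (simp add: grid_norm_def norm_minus_commute)

lemma grid_norm_diff_triangle: "grid_norm (\<lambda>i. f i - g i) \<le> grid_norm (\<lambda>i. f i - k i) + grid_norm (\<lambda>i. k i - g i)"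
  unfolding grid_norm_def
  using L2_set_norm_add_le[of "\<lambda>i. f i - k i" "\<lambda>i. k i - g i" G] by simp

lemma grid_norm_momentum_le_energy: "grid_norm w \<le> sqrt (energy d w)"
  by (auto simp: grid_norm_def L2_set_def energy_def intro!: real_sqrt_le_mono sum_nonneg)

text \<open>
  In the difference of two steps from the same state, the part of the right-hand side that
  contains the difference of the new directors is orthogonal to that difference.  The directors
  are therefore controlled pointwise by \<open>v\<^sub>1 - v\<^sub>2\<close>, uniformly in the size of the momenta.
\<close>

lemma step_director_diff:
  assumes s1: "step dt d w v1 d1 w1" and s2: "step dt d w v2 d2 w2"
    and d: "\<And>i. i \<in> G \<Longrightarrow> norm (d i) \<le> 1" and "0 \<le> dt" and i: "i \<in> G"
  shows "norm (d1 i - d2 i) \<le> dt / 2 * norm (v1 i - v2 i)"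
proof -
  let ?\<delta> = "d1 i - d2 i"
  have m: "norm (mid d d2 i) \<le> 1"
    using norm_triangle_ineq[of "d i" "d2 i"] step_norm[OF s2 i] d[OF i] by (simp add: mid_def)
  have "?\<delta> = dt *\<^sub>R (cross3 (mid d d1 i) (mid w v1 i) - cross3 (mid d d2 i) (mid w v2 i))"
    using s1 s2 i by (simp add: step_def algebra_simps)
  also have "cross3 (mid d d1 i) (mid w v1 i) - cross3 (mid d d2 i) (mid w v2 i)
     = cross3 (mid d d1 i - mid d d2 i) (mid w v1 i) + cross3 (mid d d2 i) (mid w v1 i - mid w v2 i)"
    by (simp add: Cross3.left_diff_distrib Cross3.right_diff_distrib)
  finally have eq: "?\<delta> = dt *\<^sub>R ((1/2) *\<^sub>R cross3 ?\<delta> (mid w v1 i)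
      + (1/2) *\<^sub>R cross3 (mid d d2 i) (v1 i - v2 i))"
    by (simp add: mid_diff_left cross_mult_left cross_mult_right)
  have "(norm ?\<delta>)\<^sup>2 = ?\<delta> \<bullet> ?\<delta>"
    by (simp add: power2_norm_eq_inner)
  also have "\<dots> = dt / 2 * (?\<delta> \<bullet> cross3 (mid d d2 i) (v1 i - v2 i))"
    by (subst (2) eq) (simp add: inner_add_right dot_cross_self)
  also have "\<dots> \<le> dt / 2 * (norm ?\<delta> * (1 * norm (v1 i - v2 i)))"
    using \<open>0 \<le> dt\<close> m norm_cross3_le[of "mid d d2 i" "v1 i - v2 i"]
    by (intro mult_left_mono order_trans[OF norm_cauchy_schwarz] order_trans[OF norm_cross3_le]
        mult_right_mono) auto
  finally have "norm ?\<delta> * norm ?\<delta> \<le> norm ?\<delta> * (dt / 2 * norm (v1 i - v2 i))"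
    by (simp add: power2_eq_square algebra_simps)
  then have "0 < norm ?\<delta> \<Longrightarrow> norm ?\<delta> \<le> dt / 2 * norm (v1 i - v2 i)"
    by (rule mult_left_le_imp_le)
  moreover have "0 \<le> dt / 2 * norm (v1 i - v2 i)"
    using \<open>0 \<le> dt\<close> by simp
  ultimately show ?thesis
    by linarith
qed

text \<open>
  Each discrete derivative costs a factor \<open>1 / h\<close>.  One of them is paid by the factor \<open>dt\<close>
  of the previous lemma, the second one by the factor \<open>dt\<close> of the momentum equation, so that the
  Lipschitz constants depend only on the ratio \<open>dt / h\<close>.
\<close>

lemma step_contraction:
  assumes s1: "step dt d w v1 d1 w1" and s2: "step dt d w v2 d2 w2"
    and d: "\<And>i. i \<in> G \<Longrightarrow> norm (d i) \<le> 1" and dt: "dt = \<kappa> * h" and \<kappa>: "0 \<le> \<kappa>"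
  shows "grid_norm (\<lambda>i. w1 i - w2 i) \<le> 5/2 * CARD('n) * \<kappa>\<^sup>2 * grid_norm (\<lambda>i. v1 i - v2 i)" (is ?mom)
    and "grid_norm (bdiff j (\<lambda>i. d1 i - d2 i)) \<le> 3/2 * \<kappa> * grid_norm (\<lambda>i. v1 i - v2 i)" (is ?dir)
proof -
  have dt0: "0 \<le> dt" using dt \<kappa> h_pos by simp
  define W where "W i = norm (v1 i - v2 i)" for i
  define D where "D i = d1 i - d2 i" for i
  let ?n = "real CARD('n)"
  have D: "norm (D i) \<le> dt / 2 * W i" if "i \<in> G" for i
    unfolding D_def W_def by (rule step_director_diff[OF s1 s2 d dt0 that])
  have m1: "norm (mid d d1 i) \<le> 1" if "i \<in> G" for i
    using norm_triangle_ineq[of "d i" "d1 i"] step_norm[OF s1 that] d[OF that] by (simp add: mid_def)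
  have m2: "norm (mid d d2 i) \<le> 1" if "i \<in> G" for i
    using norm_triangle_ineq[of "d i" "d2 i"] step_norm[OF s2 that] d[OF that] by (simp add: mid_def)
  have lap2: "norm (lap (mid d d2) i) \<le> 4 * ?n / h\<^sup>2" if i: "i \<in> G" for i
  proof -
    have "(\<Sum>j\<in>UNIV. norm (mid d d2 (sp j i)) + 2 * norm (mid d d2 i) + norm (mid d d2 (sm j i)))
       \<le> (\<Sum>j\<in>(UNIV::'n set). 4)"
    proof (rule sum_mono)
      fix j
      show "norm (mid d d2 (sp j i)) + 2 * norm (mid d d2 i) + norm (mid d d2 (sm j i)) \<le> 4"
        using m2[OF i] m2[OF sp_in[OF i, of j]] m2[OF sm_in[OF i, of j]] by linarith
    qed
    then show ?thesis
      by (intro order_trans[OF norm_lap_le] divide_right_mono) auto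
  qed
  define S where "S i = (\<Sum>j\<in>UNIV. W (sp j i) + 2 * W i + W (sm j i))" for i
  have lapD: "norm (lap D i) \<le> dt / (2 * h\<^sup>2) * S i" if i: "i \<in> G" for i
  proof -
    have "(\<Sum>j\<in>UNIV. norm (D (sp j i)) + 2 * norm (D i) + norm (D (sm j i)))
       \<le> (\<Sum>j\<in>UNIV. dt / 2 * (W (sp j i) + 2 * W i + W (sm j i)))"
    proof (rule sum_mono)
      fix j
      show "norm (D (sp j i)) + 2 * norm (D i) + norm (D (sm j i))
          \<le> dt / 2 * (W (sp j i) + 2 * W i + W (sm j i))"
        using D[OF i] D[OF sp_in[OF i, of j]] D[OF sm_in[OF i, of j]]
        by (simp add: distrib_left)
    qed
    also have "\<dots> = dt / 2 * S i"
      by (simp add: S_def sum_distrib_left)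
    finally have "norm (lap D i) \<le> dt / 2 * S i / h\<^sup>2"
      by (intro order_trans[OF norm_lap_le] divide_right_mono) auto
    then show ?thesis by simp
  qed
  \<comment> \<open>The Laplacian falls once on the difference of the directors and once on the second director.\<close>
  have pointwise: "norm (w1 i - w2 i) \<le> \<kappa>\<^sup>2 / 4 * S i + ?n * \<kappa>\<^sup>2 * W i" if i: "i \<in> G" for i
  proof -
    have "w1 i - w2 i = dt *\<^sub>R (cross3 (lap (mid d d1) i) (mid d d1 i) - cross3 (lap (mid d d2) i) (mid d d2 i))"
      using s1 s2 i by (simp add: step_def algebra_simps)
    also have "cross3 (lap (mid d d1) i) (mid d d1 i) - cross3 (lap (mid d d2) i) (mid d d2 i)
       = cross3 (lap (\<lambda>i. mid d d1 i - mid d d2 i) i) (mid d d1 i)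
          + cross3 (lap (mid d d2) i) (mid d d1 i - mid d d2 i)"
      by (simp add: lap_diff Cross3.left_diff_distrib Cross3.right_diff_distrib)
    also have "\<dots> = (1/2) *\<^sub>R cross3 (lap D i) (mid d d1 i) + (1/2) *\<^sub>R cross3 (lap (mid d d2) i) (D i)"
      by (simp add: mid_diff_left cross_mult_left cross_mult_right D_def[abs_def] lap_scale)
    finally have "norm (w1 i - w2 i)
      = dt * norm ((1/2) *\<^sub>R cross3 (lap D i) (mid d d1 i) + (1/2) *\<^sub>R cross3 (lap (mid d d2) i) (D i))"
      using dt0 by simp
    also have "\<dots> \<le> dt * (1/2 * (dt / (2 * h\<^sup>2) * S i * 1) + 1/2 * (4 * ?n / h\<^sup>2 * (dt / 2 * W i)))"
    proof (intro mult_left_mono[OF _ dt0] order_trans[OF norm_triangle_ineq] add_mono)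
      have S0: "0 \<le> S i" by (auto simp: S_def W_def intro!: sum_nonneg add_nonneg_nonneg)
      show "norm ((1/2) *\<^sub>R cross3 (lap D i) (mid d d1 i)) \<le> 1/2 * (dt / (2 * h\<^sup>2) * S i * 1)"
        using norm_cross3_le[of "lap D i" "mid d d1 i"]
          mult_mono[OF lapD[OF i] m1[OF i]] dt0 S0 by simp
      show "norm ((1/2) *\<^sub>R cross3 (lap (mid d d2) i) (D i)) \<le> 1/2 * (4 * ?n / h\<^sup>2 * (dt / 2 * W i))"
        using norm_cross3_le[of "lap (mid d d2) i" "D i"]
          mult_mono[OF lap2[OF i] D[OF i]] by (simp add: mult_ac)
    qed
    also have "\<dots> = \<kappa>\<^sup>2 / 4 * S i + ?n * \<kappa>\<^sup>2 * W i"
      using h_pos by (simp add: dt field_simps power2_eq_square)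
    finally show ?thesis .
  qed
  have L: "L2_set W G = grid_norm (\<lambda>i. v1 i - v2 i)"
    by (simp add: grid_norm_def W_def[abs_def])
  have LS: "L2_set S G \<le> 6 * ?n * L2_set W G"
  proof -
    have "L2_set (\<lambda>i. W (sp j i) + 2 * W i + W (sm j i)) G \<le> 6 * L2_set W G" for j
      using L2_set_triangle_ineq[of "\<lambda>i. W (sp j i) + 2 * W i" "\<lambda>i. W (sm j i)" G]
        L2_set_triangle_ineq[of "\<lambda>i. W (sp j i)" "\<lambda>i. 2 * W i" G]
        L2_set_shift_le[where F=W and j=j] by (simp add: L2_set_scale)
    then have "(\<Sum>j\<in>(UNIV::'n set). L2_set (\<lambda>i. W (sp j i) + 2 * W i + W (sm j i)) G)
        \<le> (\<Sum>j\<in>(UNIV::'n set). 6 * L2_set W G)"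
      by (intro sum_mono)
    then show ?thesis
      unfolding S_def by (intro order_trans[OF L2_set_sum_le]) auto
  qed
  have "grid_norm (\<lambda>i. w1 i - w2 i) \<le> L2_set (\<lambda>i. \<kappa>\<^sup>2 / 4 * S i + ?n * \<kappa>\<^sup>2 * W i) G"
    unfolding grid_norm_def by (rule L2_set_mono) (erule pointwise, rule norm_ge_zero)
  also have "\<dots> \<le> \<kappa>\<^sup>2 / 4 * L2_set S G + ?n * \<kappa>\<^sup>2 * L2_set W G"
    by (rule order_trans[OF L2_set_triangle_ineq]) (simp only: L2_set_scale zero_le_divide_iff
      zero_le_power2 of_nat_0_le_iff mult_nonneg_nonneg zero_le_numeral simp_thms order.refl)
  also have "\<dots> \<le> \<kappa>\<^sup>2 / 4 * (6 * ?n * L2_set W G) + ?n * \<kappa>\<^sup>2 * L2_set W G"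
    using LS by (intro add_right_mono mult_left_mono) auto
  finally show ?mom
    by (simp add: L algebra_simps)
  have "norm (bdiff j D i) \<le> \<kappa> / 2 * (W i + W (sm j i))" if i: "i \<in> G" for i
  proof -
    have "norm (D i - D (sm j i)) \<le> dt / 2 * W i + dt / 2 * W (sm j i)"
      using D[OF i] D[OF sm_in[OF i, of j]] norm_triangle_ineq4[of "D i" "D (sm j i)"] by linarith
    then have "norm (D i - D (sm j i)) / h \<le> (dt / 2 * W i + dt / 2 * W (sm j i)) / h"
      using h_pos by (intro divide_right_mono) auto
    moreover have "(dt / 2 * W i + dt / 2 * W (sm j i)) / h = \<kappa> / 2 * (W i + W (sm j i))"
      using h_pos by (simp add: dt field_simps)
    moreover have "norm (bdiff j D i) = norm (D i - D (sm j i)) / h"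
      unfolding bdiff_def norm_scaleR using h_pos by (simp add: divide_inverse mult.commute)
    ultimately show ?thesis
      by (simp only:)
  qed
  then have "grid_norm (bdiff j D) \<le> L2_set (\<lambda>i. \<kappa> / 2 * (W i + W (sm j i))) G"
    unfolding grid_norm_def by (intro L2_set_mono) auto
  also have "\<dots> = \<kappa> / 2 * L2_set (\<lambda>i. W i + W (sm j i)) G"
    using \<kappa> by (intro L2_set_scale) simp
  also have "\<dots> \<le> \<kappa> / 2 * (L2_set W G + 2 * L2_set W G)"
    using \<kappa> L2_set_triangle_ineq[of W "\<lambda>i. W (sm j i)" G] L2_set_shift_le(2)[of W j]
    by (intro mult_left_mono) auto
  finally show ?dir
    by (simp add: L D_def[abs_def] algebra_simps)
qed

text \<open>
  The factor \<open>1/4\<close> per iteration comes from \<open>5/2 * 3 * (1/6)\<^sup>2 < 1/4\<close>; the starting error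
  is controlled by the conserved energy.
\<close>

lemma iteration_error:
  fixes ds ws :: "nat \<Rightarrow> 'i \<Rightarrow> real^3"
  assumes dt: "dt = \<kappa> * h" and \<kappa>: "0 \<le> \<kappa>" "\<kappa> \<le> 1/6" and n: "CARD('n) \<le> 3"
    and d: "\<And>i. i \<in> G \<Longrightarrow> norm (d i) \<le> 1"
    and exact: "step dt d w w' d' w'"
    and iter: "\<And>s. step dt d w (ws s) (ds (Suc s)) (ws (Suc s))" and ws0: "ws 0 = w"
    and s: "1 \<le> s"
  shows "grid_norm (\<lambda>i. w' i - ws s i) + (\<Sum>j\<in>UNIV. grid_norm (bdiff j (\<lambda>i. d' i - ds s i)))
      \<le> 16 * (1/4) ^ s * sqrt (energy d w)" (is "?err s \<le> _")
    and "grid_norm (\<lambda>i. ws (Suc s) i - ws s i) + (\<Sum>j\<in>UNIV. grid_norm (bdiff j (\<lambda>i. ds (Suc s) i - ds s i)))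
      \<le> 32 * (1/4) ^ s * sqrt (energy d w)"
proof -
  let ?W = "\<lambda>s. grid_norm (\<lambda>i. w' i - ws s i)"
  have W0: "0 \<le> ?W s" for s by (simp add: grid_norm_def)
  have \<kappa>2: "\<kappa>\<^sup>2 \<le> (1/6)\<^sup>2" using \<kappa> by (intro power_mono) auto
  have q: "5/2 * real CARD('n) * \<kappa>\<^sup>2 \<le> 1/4"
  proof -
    have "real CARD('n) * \<kappa>\<^sup>2 \<le> 3 * (1/6)\<^sup>2" using n \<kappa>2 by (intro mult_mono) auto
    then have "5/2 * (real CARD('n) * \<kappa>\<^sup>2) \<le> 5/2 * (3 * (1/6)\<^sup>2)" by (rule mult_left_mono) simp
    also have "\<dots> \<le> 1/4" by (simp add: power2_eq_square)
    finally show ?thesis by (simp only: mult.assoc)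
  qed
  have W_step: "?W (Suc s) \<le> 1/4 * ?W s" for s
    by (rule order_trans[OF step_contraction(1)[OF exact iter d dt \<kappa>(1)] mult_right_mono[OF q W0]])
  have D_step: "(\<Sum>j\<in>UNIV. grid_norm (bdiff j (\<lambda>i. d' i - ds (Suc s) i))) \<le> ?W s" for s
  proof -
    have "(\<Sum>j\<in>UNIV. grid_norm (bdiff j (\<lambda>i. d' i - ds (Suc s) i))) \<le> (\<Sum>j\<in>(UNIV::'n set). 3/2 * \<kappa> * ?W s)"
      by (intro sum_mono step_contraction(2)[OF exact iter d dt \<kappa>(1)])
    also have "\<dots> = (3/2 * (real CARD('n) * \<kappa>)) * ?W s" by simp
    also have "\<dots> \<le> 1 * ?W s"
    proof (rule mult_right_mono[OF _ W0])
      have "real CARD('n) * \<kappa> \<le> 3 * (1/6)" using n \<kappa> by (intro mult_mono) auto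
      then show "3/2 * (real CARD('n) * \<kappa>) \<le> 1" by simp
    qed
    finally show ?thesis by simp
  qed
  have start: "?W 0 \<le> 2 * sqrt (energy d w)"
  proof -
    have "grid_norm (\<lambda>i. w' i - w i) \<le> grid_norm w' + grid_norm w"
      unfolding grid_norm_def using L2_set_norm_add_le[of w' "\<lambda>i. - w i" G] by simp
    then show ?thesis
      using grid_norm_momentum_le_energy[of w' d'] grid_norm_momentum_le_energy[of w d] energy_step[OF exact]
      by (simp add: ws0)
  qed
  have W: "?W s \<le> 2 * (1/4) ^ s * sqrt (energy d w)" for s
  proof (induction s)
    case (Suc s)
    then show ?case using W_step[of s] by simp
  qed (use start in simp)
  have err: "?err s \<le> 16 * (1/4) ^ s * sqrt (energy d w)" if s1: "1 \<le> s" for s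
  proof -
    obtain r where r: "s = Suc r" using s1 by (cases s) auto
    have "?err (Suc r) \<le> 2 * ?W r"
      using W_step[of r] D_step[of r] W0[of r] by simp
    then show ?thesis
      using W[of r] by (simp add: r)
  qed
  show "?err s \<le> 16 * (1/4) ^ s * sqrt (energy d w)" by (rule err[OF s])
  have tri: "grid_norm (\<lambda>i. f (Suc s) i - f s i) \<le> grid_norm (\<lambda>i. g i - f (Suc s) i) + grid_norm (\<lambda>i. g i - f s i)"
    for f :: "nat \<Rightarrow> 'i \<Rightarrow> real^3" and g
    using grid_norm_diff_triangle[of "f (Suc s)" "f s" g] grid_norm_diff_commute[of "f (Suc s)" g] by simp
  have "grid_norm (bdiff j (\<lambda>i. ds (Suc s) i - ds s i))
      \<le> grid_norm (bdiff j (\<lambda>i. d' i - ds (Suc s) i)) + grid_norm (bdiff j (\<lambda>i. d' i - ds s i))" for j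
    using tri[of "\<lambda>s. bdiff j (ds s)" "bdiff j d'"] by (simp add: bdiff_diff[abs_def])
  then have "(\<Sum>j\<in>UNIV. grid_norm (bdiff j (\<lambda>i. ds (Suc s) i - ds s i)))
      \<le> (\<Sum>j\<in>UNIV. grid_norm (bdiff j (\<lambda>i. d' i - ds (Suc s) i))) + (\<Sum>j\<in>UNIV. grid_norm (bdiff j (\<lambda>i. d' i - ds s i)))"
    unfolding sum.distrib[symmetric] by (intro sum_mono)
  then have "grid_norm (\<lambda>i. ws (Suc s) i - ws s i) + (\<Sum>j\<in>UNIV. grid_norm (bdiff j (\<lambda>i. ds (Suc s) i - ds s i)))
      \<le> ?err (Suc s) + ?err s"
    using tri[of ws w'] by linarith
  also have "\<dots> \<le> 16 * (1/4) ^ Suc s * sqrt (energy d w) + 16 * (1/4) ^ s * sqrt (energy d w)"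
    using err[OF s] err[of "Suc s"] by (intro add_mono) auto
  also have "\<dots> \<le> 32 * (1/4) ^ s * sqrt (energy d w)"
  proof -
    have "0 \<le> (1/4) ^ s * sqrt (energy d w)"
      by (auto simp: energy_def intro!: mult_nonneg_nonneg add_nonneg_nonneg sum_nonneg)
    then show ?thesis by (simp add: mult.commute)
  qed
  finally show "grid_norm (\<lambda>i. ws (Suc s) i - ws s i) + (\<Sum>j\<in>UNIV. grid_norm (bdiff j (\<lambda>i. ds (Suc s) i - ds s i)))
      \<le> 32 * (1/4) ^ s * sqrt (energy d w)" .
qed

end

section \<open>Smooth test functions\<close>

text \<open>
  For \<open>t > 0\<close>, the derivative of \<open>t\<^sup>-\<^sup>m exp (-1/t)\<close> is a combination of two members of the same
  family, and every member vanishes to infinite order at \<open>0\<close>.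
\<close>

definition flat :: "nat \<Rightarrow> real \<Rightarrow> real" where
  "flat m t = (if 0 < t then exp (- (1 / t)) / t ^ m else 0)"

lemma flat_tendsto_0: "(flat m \<longlongrightarrow> 0) (at 0)"
proof -
  have "((\<lambda>t. (inverse t) ^ m / exp (inverse t)) \<longlongrightarrow> (0::real)) (at_right 0)"
    by (rule filterlim_compose[OF tendsto_power_div_exp_0 filterlim_inverse_at_top_right])
  then have r: "(flat m \<longlongrightarrow> 0) (at_right 0)"
    by (rule Lim_transform_eventually)
       (auto simp: eventually_at_filter flat_def exp_minus field_simps)
  have l: "(flat m \<longlongrightarrow> 0) (at_left 0)"
    by (rule tendsto_eventually) (auto simp: eventually_at_filter flat_def)
  show ?thesis
    using l r by (rule filterlim_split_at)
qed

lemma flat_has_derivative: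
  "(flat m has_real_derivative (flat (m + 2) t - real m * flat (m + 1) t)) (at t)"
proof -
  consider "t < 0" | "t = 0" | "0 < t" by linarith
  then show ?thesis
  proof cases
    case 1
    have "(flat m has_real_derivative 0) (at t)"
      by (rule has_field_derivative_transform_within_open[where f="\<lambda>_. 0" and S="{..<0}"])
         (use 1 in \<open>auto simp: flat_def\<close>)
    then show ?thesis using 1 by (simp add: flat_def)
  next
    case 2
    have "((\<lambda>y. (flat m y - flat m 0) / (y - 0)) \<longlongrightarrow> 0) (at 0)"
      by (rule Lim_transform_eventually[OF flat_tendsto_0[of "m + 1"]])
         (auto simp: eventually_at_filter flat_def)
    then show ?thesis
      using 2 by (simp add: has_field_derivative_iff flat_def)
  next
    case 3
    have "((\<lambda>t. exp (- (1 / t)) / t ^ m) has_real_derivative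
        (flat (m + 2) t - real m * flat (m + 1) t)) (at t)"
    proof -
      have e: "((\<lambda>t. exp (- (1 / t))) has_real_derivative exp (- (1 / t)) / t\<^sup>2) (at t)"
        using 3 by (auto intro!: derivative_eq_intros simp: power2_eq_square)
      have p: "((\<lambda>t. t ^ m) has_real_derivative real m * t ^ m / t) (at t)"
        using 3 DERIV_pow[of m t UNIV] by (cases m) auto
      show ?thesis
        by (rule DERIV_cong[OF DERIV_divide[OF e p]])
           (use 3 in \<open>auto simp: flat_def field_simps power2_eq_square\<close>)
    qed
    then show ?thesis
      by (rule has_field_derivative_transform_within_open[where S="{0<..}"])
         (use 3 in \<open>auto simp: flat_def\<close>)
  qed
qed

lemma flat_nonneg: "0 \<le> flat m t"
  by (simp add: flat_def)

lemma flat_pos_iff: "0 < flat m t \<longleftrightarrow> 0 < t"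
  by (simp add: flat_def)

lemma isCont_flat: "isCont (flat m) t"
  using DERIV_isCont flat_has_derivative by blast

text \<open>
  A class of functions that contains the test functions needed below and is closed under partial
  derivatives, so that membership gives all the derivatives at once.
\<close>

inductive smooth :: "(real^'n \<Rightarrow> real) \<Rightarrow> bool" where
  smooth_const: "smooth (\<lambda>x. c)"
| smooth_flat: "smooth (\<lambda>x. flat m (c * x $ k + e))"
| smooth_primitive: "(\<And>t. (a has_real_derivative b t) (at t)) \<Longrightarrow> smooth (\<lambda>x. b (x $ k)) \<Longrightarrow>
    smooth (\<lambda>x. a (x $ k))"
| smooth_add: "smooth f \<Longrightarrow> smooth g \<Longrightarrow> smooth (\<lambda>x. f x + g x)"
| smooth_mult: "smooth f \<Longrightarrow> smooth g \<Longrightarrow> smooth (\<lambda>x. f x * g x)"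
| smooth_exp: "smooth f \<Longrightarrow> smooth (\<lambda>x. exp (f x))"

lemmas smooth_algebra = smooth_const smooth_flat smooth_add smooth_mult smooth_exp

lemma smooth_if: "smooth f \<Longrightarrow> smooth (\<lambda>x. if P then f x else 0)"
  by (cases P) (simp_all add: smooth_const)

lemma has_derivative_coord:
  fixes x :: "real^'n::finite"
  assumes "(a has_real_derivative D) (at (x $ k))"
  shows "((\<lambda>x. a (x $ k)) has_derivative (\<lambda>v. \<Sum>j\<in>UNIV. v $ j * (if j = k then D else 0))) (at x)"
proof -
  have "((\<lambda>x::real^'n. x $ k) has_derivative (\<lambda>v. v $ k)) (at x)"
    by (rule bounded_linear_imp_has_derivative) (rule bounded_linear_vec_nth)
  from has_derivative_compose[OF this] assms
  have "((\<lambda>x. a (x $ k)) has_derivative (\<lambda>v. D * v $ k)) (at x)"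
    by (simp add: has_field_derivative_def)
  moreover have "(\<Sum>j\<in>UNIV. v $ j * (if j = k then D else 0)) = D * v $ k" for v :: "real^'n"
    by (simp add: if_distrib mult.commute cong: if_cong)
  ultimately show ?thesis by simp
qed

lemma smooth_gradient:
  fixes f :: "real^'n::finite \<Rightarrow> real"
  assumes "smooth f"
  shows "\<exists>f'. (\<forall>j. smooth (f' j)) \<and>
    (\<forall>x. (f has_derivative (\<lambda>v. \<Sum>j\<in>UNIV. v $ j * f' j x)) (at x))"
  using assms
proof induction
  case (smooth_const c)
  show ?case
    by (rule exI[of _ "\<lambda>j x. 0"]) (auto intro: smooth.smooth_const)
next
  case (smooth_flat m c k e)
  let ?d = "\<lambda>x. c * (flat (m + 2) (c * x + e) + (- real m) * flat (m + 1) (c * x + e))"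
  show ?case
  proof (rule exI[of _ "\<lambda>j x. if j = k then ?d (x $ k) else 0"], intro conjI allI)
    have "smooth (\<lambda>x::real^'n. ?d (x $ k))"
      by (intro smooth_algebra)
    then show "smooth (\<lambda>x::real^'n. if j = k then ?d (x $ k) else 0)" for j
      by (rule smooth_if)
    have "((\<lambda>t. flat m (c * t + e)) has_real_derivative ?d t) (at t)" for t
      by (rule DERIV_cong[OF DERIV_chain2[OF flat_has_derivative]])
         (auto intro!: derivative_eq_intros)
    then show "((\<lambda>x. flat m (c * x $ k + e)) has_derivative
        (\<lambda>v. \<Sum>j\<in>UNIV. v $ j * (if j = k then ?d (x $ k) else 0))) (at x)" for x :: "real^'n"
      by (rule has_derivative_coord)
  qed
next
  case (smooth_primitive a b k)
  show ?case
  proof (rule exI[of _ "\<lambda>j x. if j = k then b (x $ k) else 0"], intro conjI allI)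
    show "smooth (\<lambda>x::real^'n. if j = k then b (x $ k) else 0)" for j
      using smooth_primitive.hyps(2) by (rule smooth_if)
    show "((\<lambda>x. a (x $ k)) has_derivative
        (\<lambda>v. \<Sum>j\<in>UNIV. v $ j * (if j = k then b (x $ k) else 0))) (at x)" for x :: "real^'n"
      by (rule has_derivative_coord) (rule smooth_primitive)
  qed
next
  case (smooth_add f g)
  then obtain f' g' where
    "\<And>j. smooth (f' j)" "\<And>x. (f has_derivative (\<lambda>v. \<Sum>j\<in>UNIV. v $ j * f' j x)) (at x)"
    "\<And>j. smooth (g' j)" "\<And>x. (g has_derivative (\<lambda>v. \<Sum>j\<in>UNIV. v $ j * g' j x)) (at x)"
    by blast
  note f'g' = this
  show ?case
  proof (rule exI[of _ "\<lambda>j x. f' j x + g' j x"], intro conjI allI)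
    show "smooth (\<lambda>x. f' j x + g' j x)" for j
      using f'g' by (intro smooth_algebra)
    have "(\<Sum>j\<in>UNIV. v $ j * (f' j x + g' j x)) =
        (\<Sum>j\<in>UNIV. v $ j * f' j x) + (\<Sum>j\<in>UNIV. v $ j * g' j x)" for v x :: "real^'n"
      by (simp add: sum.distrib distrib_left)
    then show "((\<lambda>x. f x + g x) has_derivative (\<lambda>v. \<Sum>j\<in>UNIV. v $ j * (f' j x + g' j x))) (at x)" for x
      using has_derivative_add[OF f'g'(2)[of x] f'g'(4)[of x]] by simp
  qed
next
  case (smooth_mult f g)
  then obtain f' g' where
    "\<And>j. smooth (f' j)" "\<And>x. (f has_derivative (\<lambda>v. \<Sum>j\<in>UNIV. v $ j * f' j x)) (at x)"
    "\<And>j. smooth (g' j)" "\<And>x. (g has_derivative (\<lambda>v. \<Sum>j\<in>UNIV. v $ j * g' j x)) (at x)"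
    by blast
  note f'g' = this
  show ?case
  proof (rule exI[of _ "\<lambda>j x. f x * g' j x + f' j x * g x"], intro conjI allI)
    show "smooth (\<lambda>x. f x * g' j x + f' j x * g x)" for j
      using f'g' smooth_mult.hyps by (intro smooth_algebra)
    have "(\<Sum>j\<in>UNIV. v $ j * (f x * g' j x + f' j x * g x)) =
        f x * (\<Sum>j\<in>UNIV. v $ j * g' j x) + (\<Sum>j\<in>UNIV. v $ j * f' j x) * g x" for v x :: "real^'n"
      unfolding sum_distrib_left sum_distrib_right sum.distrib[symmetric]
      by (intro sum.cong refl) (simp add: algebra_simps)
    then show "((\<lambda>x. f x * g x) has_derivative
        (\<lambda>v. \<Sum>j\<in>UNIV. v $ j * (f x * g' j x + f' j x * g x))) (at x)" for x
      using has_derivative_mult[OF f'g'(2)[of x] f'g'(4)[of x]] by simp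
  qed
next
  case (smooth_exp f)
  then obtain f' where
    "\<And>j. smooth (f' j)" "\<And>x. (f has_derivative (\<lambda>v. \<Sum>j\<in>UNIV. v $ j * f' j x)) (at x)"
    by blast
  note f' = this
  show ?case
  proof (rule exI[of _ "\<lambda>j x. exp (f x) * f' j x"], intro conjI allI)
    show "smooth (\<lambda>x. exp (f x) * f' j x)" for j
      using f' smooth_exp.hyps by (intro smooth_algebra)
    have "(\<Sum>j\<in>UNIV. v $ j * (exp (f x) * f' j x)) = exp (f x) * (\<Sum>j\<in>UNIV. v $ j * f' j x)" for v x :: "real^'n"
      unfolding sum_distrib_left by (intro sum.cong refl) simp
    moreover have "((\<lambda>x. exp (f x)) has_derivative (\<lambda>v. exp (f x) * (\<Sum>j\<in>UNIV. v $ j * f' j x))) (at x)" for x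
      using has_derivative_exp[OF f'(2)[of x]] by (simp add: mult.commute)
    ultimately show "((\<lambda>x. exp (f x)) has_derivative (\<lambda>v. \<Sum>j\<in>UNIV. v $ j * (exp (f x) * f' j x))) (at x)" for x
      by simp
  qed
qed

lemma smooth_differentiable: "smooth f \<Longrightarrow> f differentiable (at x)"
  using smooth_gradient[of f] by (auto simp: differentiable_def)

lemma smooth_dir_deriv:
  fixes f :: "real^'n::finite \<Rightarrow> real"
  assumes "smooth f"
  shows "smooth (dir_deriv j f)"
proof -
  obtain f' where s: "\<And>j. smooth (f' j)"
    and d: "\<And>x. (f has_derivative (\<lambda>v. \<Sum>j\<in>UNIV. v $ j * f' j x)) (at x)"
    using smooth_gradient[OF assms] by blast
  have "dir_deriv j f x = f' j x" for x
    by (simp add: dir_deriv_def frechet_derivative_at[OF d, symmetric] axis_def if_distrib[of "\<lambda>u. u * _"] cong: if_cong)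
  then show ?thesis
    using s by (metis ext)
qed

lemma smooth_Ck: "smooth f \<Longrightarrow> Ck k f"
proof (induction k arbitrary: f)
  case 0
  then show ?case
    by (auto intro!: continuous_at_imp_continuous_on differentiable_imp_continuous_within smooth_differentiable)
next
  case (Suc k)
  then show ?case
    by (auto simp: differentiable_on_def smooth_dir_deriv intro!: differentiable_at_withinI smooth_differentiable)
qed

lemma smooth_prod:
  assumes "finite I" "\<And>i. i \<in> I \<Longrightarrow> smooth (f i)"
  shows "smooth (\<lambda>x. \<Prod>i\<in>I. f i x)"
  using assms by (induction I rule: finite_induct) (auto intro: smooth_algebra)

subsection \<open>Bumps and ramps on an interval\<close>

text \<open>
  For \<open>m \<ge> 1\<close> the product of the two flat functions is positive exactly on \<open>(a + 1/m, b - 1/m)\<close>,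
  which keeps the support inside \<open>(a, b)\<close>; the factor \<open>m\<close> in the exponent makes the bump
  converge to the indicator of \<open>(a, b)\<close>.
\<close>

definition bump :: "real \<Rightarrow> real \<Rightarrow> nat \<Rightarrow> real \<Rightarrow> real" where
  "bump a b m t =
     1 - exp (- (real m * (flat 0 (t - (a + 1 / real m)) * flat 0 (b - 1 / real m - t))))"

lemma bump_bounds: "0 \<le> bump a b m t" "bump a b m t \<le> 1"
  by (auto simp: bump_def intro!: mult_nonneg_nonneg flat_nonneg)

lemma bump_support:
  assumes "bump a b m t \<noteq> 0"
  shows "a + 1 / real m < t" "t < b - 1 / real m"
  using assms flat_pos_iff[of 0 "t - (a + 1 / real m)"] flat_pos_iff[of 0 "b - 1 / real m - t"]
  by (auto simp: bump_def flat_def not_less split: if_splits)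

lemma bump_inside: "bump a b m t \<noteq> 0 \<Longrightarrow> a < t \<and> t < b"
  using bump_support[of a b m t]
  by (smt (verit) divide_nonneg_nonneg of_nat_0_le_iff)

lemma smooth_bump: "smooth (\<lambda>x::real^'n::finite. bump a b m (x $ k))"
proof -
  have "smooth (\<lambda>x::real^'n. 1 + (-1) * exp ((- real m) *
      (flat 0 (1 * x $ k + - (a + 1 / real m)) * flat 0 ((-1) * x $ k + (b - 1 / real m)))))"
    by (intro smooth_algebra)
  moreover have "1 * t + - (a + 1 / real m) = t - (a + 1 / real m)"
    "(-1) * t + (b - 1 / real m) = b - 1 / real m - t"
    "1 + (-1) * u = 1 - u" "(- real m) * u = - (real m * u)" for t u
    by simp_all
  ultimately show ?thesis
    by (simp only: bump_def)
qed

lemma isCont_bump: "isCont (bump a b m) t"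
proof -
  have "isCont (\<lambda>t. flat 0 (t - (a + 1 / real m))) t" "isCont (\<lambda>t. flat 0 (b - 1 / real m - t)) t"
    by (rule isCont_o2[OF _ isCont_flat]; simp)+
  then show ?thesis
    unfolding bump_def[abs_def] by (intro continuous_intros)
qed

lemma bump_tendsto:
  assumes "a < t" "t < b"
  shows "(\<lambda>m. bump a b m t) \<longlonglongrightarrow> 1"
proof -
  have inv: "(\<lambda>m. 1 / real m) \<longlonglongrightarrow> 0"
    by (rule lim_1_over_n)
  have "(\<lambda>m. flat 0 (t - (a + 1 / real m)) * flat 0 (b - 1 / real m - t))
      \<longlonglongrightarrow> flat 0 (t - (a + 0)) * flat 0 (b - 0 - t)"
    by (intro tendsto_mult isCont_tendsto_compose[OF isCont_flat] tendsto_intros inv)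
  moreover have "0 < flat 0 (t - (a + 0)) * flat 0 (b - 0 - t)"
    using assms by (simp add: flat_pos_iff)
  ultimately have "filterlim (\<lambda>m. (flat 0 (t - (a + 1 / real m)) * flat 0 (b - 1 / real m - t)) * real m)
      at_top sequentially"
    by (intro filterlim_tendsto_pos_mult_at_top filterlim_real_sequentially)
  then have "(\<lambda>m. exp (- (real m * (flat 0 (t - (a + 1 / real m)) * flat 0 (b - 1 / real m - t))))) \<longlonglongrightarrow> 0"
    by (intro filterlim_compose[OF exp_at_bot]) (simp add: filterlim_uminus_at_bot mult.commute)
  from tendsto_diff[OF tendsto_const[of 1] this] show ?thesis
    by (simp add: bump_def)
qed

definition bump_mass :: "real \<Rightarrow> real \<Rightarrow> nat \<Rightarrow> real" where
  "bump_mass a b m = integral {a..b} (bump a b m)"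

lemma bump_integrable: "bump a b m integrable_on {c..d}"
  by (intro integrable_continuous_real continuous_at_imp_continuous_on ballI isCont_bump)

lemma bump_mass_tendsto:
  assumes "a < b"
  shows "(\<lambda>m. bump_mass a b m) \<longlonglongrightarrow> b - a"
proof -
  have "(\<lambda>m. integral {a<..<b} (bump a b m)) \<longlonglongrightarrow> integral {a<..<b} (\<lambda>_. 1)"
  proof (rule dominated_convergence(2)[where h="\<lambda>_. 1"])
    show "bump a b m integrable_on {a<..<b}" for m
      using bump_integrable[of a b m a b] integrable_on_Icc_iff_Ioo by blast
    show "(\<lambda>x. 1::real) integrable_on {a<..<b}"
      using integrable_on_Icc_iff_Ioo by fastforce
  qed (use bump_bounds bump_tendsto in auto)
  also have "integral {a<..<b} (\<lambda>_. 1::real) = b - a"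
    using assms by (simp add: integral_open_interval_real[symmetric])
  finally show ?thesis
    by (simp add: bump_mass_def integral_open_interval_real)
qed

text \<open>
  Because of the normalisation, the difference of two ramps vanishes to the right of both
  intervals, which makes it the compactly supported factor of a test function.
\<close>

lemma ramp_exists:
  assumes "a < b" and mass: "0 < bump_mass a b m"
  shows "\<exists>P. (\<forall>t. (P has_real_derivative bump a b m t / bump_mass a b m) (at t)) \<and>
    (\<forall>t\<le>a + 1 / real m. P t = 0) \<and> (\<forall>t\<ge>b - 1 / real m. P t = 1) \<and> (\<forall>t. 0 \<le> P t \<and> P t \<le> 1)"
proof -
  obtain F where F: "\<And>t. (F has_vector_derivative bump a b m t) (at t)"
    using einterval_antiderivative[of "-\<infinity>" "\<infinity>" "bump a b m"] isCont_bump by auto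
  define P where "P t = (F t - F a) / bump_mass a b m" for t
  have D: "(P has_real_derivative bump a b m t / bump_mass a b m) (at t)" for t
    using F[of t] mass unfolding P_def
    by (auto intro!: derivative_eq_intros simp: has_real_derivative_iff_has_vector_derivative[symmetric])
  have mono: "P s \<le> P t" if "s \<le> t" for s t
    using that by (rule DERIV_nonneg_imp_nondecreasing)
       (use D bump_bounds(1) mass in \<open>fastforce\<close>)
  have "(bump a b m has_integral F b - F a) {a..b}"
    using \<open>a < b\<close> F by (intro fundamental_theorem_of_calculus) (auto intro: has_vector_derivative_at_within)
  then have "F b - F a = bump_mass a b m"
    by (simp add: bump_mass_def integral_unique)
  with mass have Pb: "P b = 1" and Pa: "P a = 0"
    by (auto simp: P_def)
  have const: "P s = P t" if "s \<le> t" "\<And>x. s \<le> x \<Longrightarrow> x \<le> t \<Longrightarrow> bump a b m x = 0" for s t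
  proof (cases "s = t")
    case False
    show ?thesis
    proof (rule DERIV_isconst_end[of s t P, symmetric])
      show "continuous_on {s..t} P"
        by (intro continuous_at_imp_continuous_on ballI DERIV_isCont[OF D])
      show "(P has_real_derivative 0) (at x)" if "s < x" "x < t" for x
        using D[of x] that \<open>\<And>x. s \<le> x \<Longrightarrow> x \<le> t \<Longrightarrow> bump a b m x = 0\<close>[of x] by simp
    qed (use False that in simp)
  qed simp
  have m0: "0 \<le> 1 / real m" by simp
  have left: "P t = 0" if "t \<le> a + 1 / real m" for t
  proof -
    have "P (min t a) = P (max t a)"
    proof (rule const)
      show "bump a b m x = 0" if "min t a \<le> x" "x \<le> max t a" for x
        using that \<open>t \<le> a + 1 / real m\<close> bump_support(1)[of a b m x] m0 by linarith
    qed simp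
    then show ?thesis
      using Pa by (cases "t \<le> a") (auto simp: min_def max_def split: if_splits)
  qed
  have right: "P t = 1" if "b - 1 / real m \<le> t" for t
  proof -
    have "P (min t b) = P (max t b)"
    proof (rule const)
      show "bump a b m x = 0" if "min t b \<le> x" "x \<le> max t b" for x
        using that \<open>b - 1 / real m \<le> t\<close> bump_support(2)[of a b m x] m0 by linarith
    qed simp
    then show ?thesis
      using Pb by (cases "t \<le> b") (auto simp: min_def max_def split: if_splits)
  qed
  have "0 \<le> P t \<and> P t \<le> 1" for t
    using mono[of "min t (a + 1 / real m)" t] mono[of t "max t (b - 1 / real m)"]
      left[of "min t (a + 1 / real m)"] right[of "max t (b - 1 / real m)"] by simp
  with D left right show ?thesis by blast
qed

section \<open>Averages of weakly differentiable functions\<close>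

lemma measure_box_vec:
  fixes l r :: "real^'n::finite"
  assumes "\<And>i. l $ i \<le> r $ i"
  shows "measure lebesgue (box l r) = (\<Prod>i\<in>UNIV. r $ i - l $ i)"
proof -
  have "cbox l r \<noteq> {}" using assms by (simp add: interval_ne_empty_cart)
  then have "measure lebesgue (cbox l r) = (\<Prod>i\<in>UNIV. r $ i - l $ i)"
    by (simp add: content_cbox_cart)
  then show ?thesis
    by (simp add: measure_lborel_box_eq measure_lborel_cbox_eq)
qed

lemma integral_lebesgue_on_supported:
  fixes f :: "real^'n::finite \<Rightarrow> 'b::euclidean_space"
  assumes "U \<in> sets lebesgue" "B \<subseteq> U" "\<And>x. x \<in> U \<Longrightarrow> x \<notin> B \<Longrightarrow> f x = 0"
  shows "(\<integral>x. f x \<partial>lebesgue_on U) = (LINT x:B|lebesgue. f x)"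
proof -
  have "(\<integral>x. f x \<partial>lebesgue_on U) = (LINT x:U|lebesgue. f x)"
    using assms(1) by (subst integral_restrict_space) (auto simp: set_lebesgue_integral_def)
  also have "\<dots> = (LINT x:B|lebesgue. f x)"
    unfolding set_lebesgue_integral_def
    by (intro Bochner_Integration.integral_cong refl) (use assms(2,3) in \<open>auto simp: indicator_def\<close>)
  finally show ?thesis .
qed

lemma dir_deriv_eqI:
  fixes f :: "real^'n::finite \<Rightarrow> real"
  assumes "f differentiable (at x)"
    and D: "((\<lambda>t. f (x + t *\<^sub>R axis j 1)) has_real_derivative D) (at 0)"
  shows "dir_deriv j f x = D"
proof -
  let ?F = "frechet_derivative f (at x)"
  have F: "(f has_derivative ?F) (at x)"
    using assms(1) by (simp add: frechet_derivative_works)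
  have "((\<lambda>t::real. x + t *\<^sub>R axis j 1) has_derivative (\<lambda>t. t *\<^sub>R axis j 1)) (at 0)"
    by (auto intro!: derivative_eq_intros)
  from has_derivative_compose[OF this, of f ?F] F
  have "((\<lambda>t. f (x + t *\<^sub>R axis j 1)) has_derivative (\<lambda>t. ?F (t *\<^sub>R axis j 1))) (at 0)"
    by simp
  moreover have "?F (t *\<^sub>R axis j 1) = ?F (axis j 1) * t" for t
    using linear_scale[OF has_derivative_linear[OF F]] by simp
  ultimately have "((\<lambda>t. f (x + t *\<^sub>R axis j 1)) has_real_derivative ?F (axis j 1)) (at 0)"
    by (simp add: has_field_derivative_def)
  from DERIV_unique[OF this D] show ?thesis
    by (simp add: dir_deriv_def)
qed

definition average :: "(real^'n \<Rightarrow> 'b::{banach, second_countable_topology}) \<Rightarrow> (real^'n) set \<Rightarrow> 'b" where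
  "average u B = (LINT x:B|lebesgue. u x) /\<^sub>R measure lebesgue B"

text \<open>
  The test function is \<open>P' - P\<close>, with ramps \<open>P'\<close> and \<open>P\<close> over the two intervals in direction \<open>j\<close>,
  times bumps in the other directions.  It is bounded by \<open>1\<close> and supported between the outer
  faces of the two boxes; its derivative in direction \<open>j\<close> is \<open>\<psi>\<close>.
\<close>

lemma test_function_between_boxes:
  fixes u g :: "real^'n::finite \<Rightarrow> real^3" and l r l' r' :: "real^'n"
  assumes wd: "weak_deriv U j u g" and U: "U \<in> sets lebesgue"
    and lr: "l $ j < r $ j" and lr': "l' $ j < r' $ j" and ord: "r' $ j \<le> l $ j"
    and off: "\<And>i. i \<noteq> j \<Longrightarrow> l' $ i = l $ i \<and> r' $ i = r $ i"
    and sub: "box l' r \<subseteq> U" and m: "1 \<le> m"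
    and ig: "set_integrable lebesgue (box l' r) g"
    and mass: "0 < bump_mass (l $ j) (r $ j) m" and mass': "0 < bump_mass (l' $ j) (r' $ j) m"
  defines "\<psi> \<equiv> \<lambda>x. (bump (l' $ j) (r' $ j) m (x $ j) / bump_mass (l' $ j) (r' $ j) m
      - bump (l $ j) (r $ j) m (x $ j) / bump_mass (l $ j) (r $ j) m) *
      (\<Prod>i\<in>UNIV - {j}. bump (l $ i) (r $ i) m (x $ i))"
  shows "norm (LINT x:box l' r|lebesgue. \<psi> x *\<^sub>R u x) \<le> (LINT x:box l' r|lebesgue. norm (g x))"
proof -
  let ?B = "box l' r"
  define b where "b x = (\<Prod>i\<in>UNIV - {j}. bump (l $ i) (r $ i) m (x $ i))" for x :: "real^'n"
  obtain P where P: "\<And>t. (P has_real_derivative bump (l $ j) (r $ j) m t / bump_mass (l $ j) (r $ j) m) (at t)"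
    "\<And>t. t \<le> l $ j + 1 / real m \<Longrightarrow> P t = 0" "\<And>t. r $ j - 1 / real m \<le> t \<Longrightarrow> P t = 1"
    "\<And>t. 0 \<le> P t" "\<And>t. P t \<le> 1"
    using ramp_exists[OF lr mass] by blast
  obtain P' where P': "\<And>t. (P' has_real_derivative bump (l' $ j) (r' $ j) m t / bump_mass (l' $ j) (r' $ j) m) (at t)"
    "\<And>t. t \<le> l' $ j + 1 / real m \<Longrightarrow> P' t = 0" "\<And>t. r' $ j - 1 / real m \<le> t \<Longrightarrow> P' t = 1"
    "\<And>t. 0 \<le> P' t" "\<And>t. P' t \<le> 1"
    using ramp_exists[OF lr' mass'] by blast
  define \<phi> where "\<phi> x = (P' (x $ j) + (-1) * P (x $ j)) * b x" for x :: "real^'n"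
  have smooth_bump_scaled: "smooth (\<lambda>x::real^'n. bump a c m (x $ k) / M)" for a c k and M :: real
    using smooth_mult[OF smooth_const[of "1 / M"] smooth_bump[of a c m k]] by simp
  have "smooth b"
    unfolding b_def[abs_def] by (intro smooth_prod smooth_bump) simp
  then have "smooth \<phi>"
    unfolding \<phi>_def[abs_def]
    by (intro smooth_mult smooth_add smooth_const smooth_primitive[OF P(1)]
        smooth_primitive[OF P'(1)] smooth_bump_scaled)
  have b01: "0 \<le> b x" "b x \<le> 1" for x
    unfolding b_def by (auto intro!: prod_nonneg prod_le_1 bump_bounds)
  have b0: "l $ i + 1 / real m < x $ i \<and> x $ i < r $ i - 1 / real m" if "b x \<noteq> 0" "i \<noteq> j" for x i
  proof -
    have "bump (l $ i) (r $ i) m (x $ i) \<noteq> 0"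
      using that by (auto simp: b_def)
    then show ?thesis using bump_support by blast
  qed
  have supp: "l' $ i + 1 / real m \<le> x $ i \<and> x $ i \<le> r $ i - 1 / real m" if "\<phi> x \<noteq> 0" for x i
  proof (cases "i = j")
    case True
    have "P' (x $ j) \<noteq> P (x $ j)" using that by (auto simp: \<phi>_def)
    moreover have "P' (x $ j) = 0 \<and> P (x $ j) = 0" if "x $ j < l' $ j + 1 / real m"
      using that lr' ord by (intro conjI P(2) P'(2)) linarith+
    moreover have "P' (x $ j) = 1 \<and> P (x $ j) = 1" if "r $ j - 1 / real m < x $ j"
      using that lr ord by (intro conjI P(3) P'(3)) linarith+
    ultimately show ?thesis
      using True by (metis not_less)
  next
    case False
    then show ?thesis
      using b0[of x i] off[of i] that by (auto simp: \<phi>_def)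
  qed
  define K where "K = cbox (\<chi> i. l' $ i + 1 / real m) (\<chi> i. r $ i - 1 / real m)"
  have KB: "K \<subseteq> ?B"
  proof
    fix x assume "x \<in> K"
    then have x: "l' $ i + 1 / real m \<le> x $ i \<and> x $ i \<le> r $ i - 1 / real m" for i
      by (simp add: K_def mem_box_cart)
    have "0 < 1 / real m" using m by simp
    then have "l' $ i < x $ i \<and> x $ i < r $ i" for i
      using x[of i] by linarith
    then show "x \<in> ?B" by (simp add: mem_box_cart)
  qed
  have clK: "closure {x. \<phi> x \<noteq> 0} \<subseteq> K"
    by (rule closure_minimal) (auto simp: K_def mem_box_cart supp)
  have test: "\<phi> \<in> test_functions U"
    unfolding test_functions_def
  proof (intro CollectI conjI allI)
    show "Ck k \<phi>" for k by (rule smooth_Ck) fact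
    show "compact (closure {x. \<phi> x \<noteq> 0})"
      using clK bounded_subset[of K] by (auto simp: K_def compact_eq_bounded_closed)
    show "closure {x. \<phi> x \<noteq> 0} \<subseteq> U" using clK KB sub by blast
  qed
  have out: "\<phi> x = 0" if "x \<notin> ?B" for x
    using that clK KB closure_subset[of "{x. \<phi> x \<noteq> 0}"] by auto
  have dd: "dir_deriv j \<phi> x = \<psi> x" for x
  proof (rule dir_deriv_eqI)
    show "\<phi> differentiable at x" by (rule smooth_differentiable) fact
    have bx: "b (x + t *\<^sub>R axis j 1) = b x" for t
      unfolding b_def by (intro prod.cong refl) (auto simp: axis_def)
    have cP: "((\<lambda>t. P (x $ j + t)) has_real_derivative bump (l $ j) (r $ j) m (x $ j) / bump_mass (l $ j) (r $ j) m) (at 0)"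
      using DERIV_shift[of P _ 0 "x $ j"] P(1)[of "x $ j"] by (simp add: add.commute)
    have cP': "((\<lambda>t. P' (x $ j + t)) has_real_derivative bump (l' $ j) (r' $ j) m (x $ j) / bump_mass (l' $ j) (r' $ j) m) (at 0)"
      using DERIV_shift[of P' _ 0 "x $ j"] P'(1)[of "x $ j"] by (simp add: add.commute)
    show "((\<lambda>t. \<phi> (x + t *\<^sub>R axis j 1)) has_real_derivative \<psi> x) (at 0)"
      using DERIV_cmult_right[OF DERIV_diff[OF cP' cP], of "b x"]
      by (simp add: \<phi>_def bx \<psi>_def) (simp add: axis_def b_def)
  qed
  have out': "\<psi> x = 0" if "x \<notin> ?B" for x
  proof (rule ccontr)
    assume nz: "\<psi> x \<noteq> 0"
    have off': "\<forall>i. i \<noteq> j \<longrightarrow> l $ i < x $ i \<and> x $ i < r $ i"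
      using nz by (auto simp: \<psi>_def dest!: bump_inside)
    have "l' $ j < x $ j \<and> x $ j < r $ j"
      using nz bump_inside[of "l $ j" "r $ j" m "x $ j"] bump_inside[of "l' $ j" "r' $ j" m "x $ j"] lr lr' ord
      by (fastforce simp: \<psi>_def)
    with off' have "l' $ i < x $ i \<and> x $ i < r $ i" for i
      using off by (cases "i = j") auto
    with that show False by (simp add: mem_box_cart)
  qed
  have "(LINT x:?B|lebesgue. \<psi> x *\<^sub>R u x) = (\<integral>x. dir_deriv j \<phi> x *\<^sub>R u x \<partial>lebesgue_on U)"
    using out' by (subst integral_lebesgue_on_supported[OF U sub]) (auto simp: dd)
  also have "\<dots> = - (\<integral>x. \<phi> x *\<^sub>R g x \<partial>lebesgue_on U)"
    using wd test by (simp add: weak_deriv_def)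
  also have "(\<integral>x. \<phi> x *\<^sub>R g x \<partial>lebesgue_on U) = (LINT x:?B|lebesgue. \<phi> x *\<^sub>R g x)"
    using out by (intro integral_lebesgue_on_supported[OF U sub]) auto
  finally have "norm (LINT x:?B|lebesgue. \<psi> x *\<^sub>R u x) = norm (LINT x:?B|lebesgue. \<phi> x *\<^sub>R g x)"
    by simp
  also have "\<dots> \<le> (\<integral>x. norm (indicator ?B x *\<^sub>R (\<phi> x *\<^sub>R g x)) \<partial>lebesgue)"
    unfolding set_lebesgue_integral_def by (rule integral_norm_bound)
  also have "\<dots> \<le> (\<integral>x. indicator ?B x *\<^sub>R norm (g x) \<partial>lebesgue)"
  proof (rule integral_mono')
    show "integrable lebesgue (\<lambda>x. indicator ?B x *\<^sub>R norm (g x))"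
      using set_integrable_norm[OF ig] by (simp add: set_integrable_def)
    have "\<bar>\<phi> x\<bar> \<le> 1" for x
    proof -
      have "\<bar>P' (x $ j) + (-1) * P (x $ j)\<bar> * \<bar>b x\<bar> \<le> 1 * 1"
        using P(4,5)[of "x $ j"] P'(4,5)[of "x $ j"] b01[of x] by (intro mult_mono) auto
      then show ?thesis by (simp add: \<phi>_def abs_mult)
    qed
    then show "norm (indicator ?B x *\<^sub>R (\<phi> x *\<^sub>R g x)) \<le> indicator ?B x *\<^sub>R norm (g x)" for x
      by (auto simp: indicator_def intro!: mult_left_le_one_le)
  qed auto
  finally show ?thesis
    by (simp add: set_lebesgue_integral_def)
qed

text \<open>
  Letting the smoothing parameter tend to infinity turns the normalised bumps into normalised
  indicators, and the pairing with \<open>u\<close> into the difference of the two averages.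
\<close>

lemma weak_deriv_average_diff:
  fixes u g :: "real^'n::finite \<Rightarrow> real^3" and l r l' r' :: "real^'n"
  assumes wd: "weak_deriv U j u g" and U: "U \<in> sets lebesgue"
    and lr: "\<And>i. l $ i < r $ i" and lr': "l' $ j < r' $ j" and ord: "r' $ j \<le> l $ j"
    and off: "\<And>i. i \<noteq> j \<Longrightarrow> l' $ i = l $ i \<and> r' $ i = r $ i"
    and sub: "box l' r \<subseteq> U"
    and iu: "set_integrable lebesgue (box l' r) u" and ig: "set_integrable lebesgue (box l' r) g"
  shows "measure lebesgue (box l r) * norm (average u (box l r) - average u (box l' r'))
    \<le> (r $ j - l $ j) * (LINT x:box l' r|lebesgue. norm (g x))"
proof -
  let ?B = "box l' r" and ?b = "box l r" and ?b' = "box l' r'"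
  let ?mass = "bump_mass (l $ j) (r $ j)" and ?mass' = "bump_mass (l' $ j) (r' $ j)"
  let ?I = "r $ j - l $ j" and ?I' = "r' $ j - l' $ j"
  have I: "0 < ?I" "0 < ?I'" using lr lr' by auto
  have inv: "(\<lambda>m. 1 / ?mass m) \<longlonglongrightarrow> 1 / ?I" "(\<lambda>m. 1 / ?mass' m) \<longlonglongrightarrow> 1 / ?I'"
    using I by (auto intro!: tendsto_intros bump_mass_tendsto)
  define \<psi> where "\<psi> m x = (bump (l' $ j) (r' $ j) m (x $ j) / ?mass' m
      - bump (l $ j) (r $ j) m (x $ j) / ?mass m) *
      (\<Prod>i\<in>UNIV - {j}. bump (l $ i) (r $ i) m (x $ i))" for m and x :: "real^'n"
  have lim: "(\<lambda>m. indicator ?B x * \<psi> m x) \<longlonglongrightarrow> indicator ?b' x / ?I' - indicator ?b x / ?I" for x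
  proof -
    have bl: "(\<lambda>m. bump a c m t) \<longlonglongrightarrow> indicator {a<..<c} t" for a c t
    proof (cases "a < t \<and> t < c")
      case False
      then have "bump a c m t = 0" for m using bump_inside by blast
      with False show ?thesis by (auto simp: indicator_def)
    qed (simp add: bump_tendsto)
    have "(\<lambda>m. indicator ?B x * ((bump (l' $ j) (r' $ j) m (x $ j) * (1 / ?mass' m)
      - bump (l $ j) (r $ j) m (x $ j) * (1 / ?mass m)) *
      (\<Prod>i\<in>UNIV - {j}. bump (l $ i) (r $ i) m (x $ i)))) \<longlonglongrightarrow>
      indicator ?B x * ((indicator {l' $ j<..<r' $ j} (x $ j) * (1 / ?I')
      - indicator {l $ j<..<r $ j} (x $ j) * (1 / ?I)) *
      (\<Prod>i\<in>UNIV - {j}. indicator {l $ i<..<r $ i} (x $ i)))"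
      by (intro tendsto_mult tendsto_diff tendsto_const tendsto_prod bl inv)
    also have "indicator ?B x * ((indicator {l' $ j<..<r' $ j} (x $ j) * (1 / ?I')
      - indicator {l $ j<..<r $ j} (x $ j) * (1 / ?I)) *
      (\<Prod>i\<in>UNIV - {j}. indicator {l $ i<..<r $ i} (x $ i)))
      = (indicator ?b' x / ?I' - indicator ?b x / ?I :: real)"
    proof (cases "\<forall>i. i \<noteq> j \<longrightarrow> l $ i < x $ i \<and> x $ i < r $ i")
      case True
      have p: "(\<Prod>i\<in>UNIV - {j}. indicator {l $ i<..<r $ i} (x $ i)) = (1::real)"
        using True by (intro prod.neutral) (auto simp: indicator_def)
      have mem: "x \<in> ?B \<longleftrightarrow> l' $ j < x $ j \<and> x $ j < r $ j"
        "x \<in> ?b \<longleftrightarrow> l $ j < x $ j \<and> x $ j < r $ j" "x \<in> ?b' \<longleftrightarrow> l' $ j < x $ j \<and> x $ j < r' $ j"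
        using True off unfolding mem_box_cart by metis+
      show ?thesis
        unfolding p using lr[of j] lr' ord by (auto simp: mem indicator_def)
    next
      case False
      then obtain i where i: "i \<noteq> j" "\<not> (l $ i < x $ i \<and> x $ i < r $ i)" by blast
      then have p: "(\<Prod>i\<in>UNIV - {j}. indicator {l $ i<..<r $ i} (x $ i)) = (0::real)"
        by (intro prod_zero) (auto intro!: bexI[of _ i] simp: indicator_def)
      have "x \<notin> ?b" "x \<notin> ?b'"
        using i off[OF i(1)] unfolding mem_box_cart by metis+
      then show ?thesis by (simp add: p)
    qed
    finally show ?thesis by (simp add: \<psi>_def)
  qed
  \<comment> \<open>Convergent sequences are bounded, which gives a majorant for the dominated convergence theorem.\<close>
  obtain K where K: "\<And>m. \<bar>1 / ?mass m\<bar> \<le> K"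
    using convergent_imp_Bseq[OF convergentI[OF inv(1)]] unfolding Bseq_def real_norm_def by blast
  obtain K' where K': "\<And>m. \<bar>1 / ?mass' m\<bar> \<le> K'"
    using convergent_imp_Bseq[OF convergentI[OF inv(2)]] unfolding Bseq_def real_norm_def by blast
  have \<psi>_bound: "\<bar>\<psi> m x\<bar> \<le> K' + K" for m x
  proof -
    have "\<bar>bump a c m t / M\<bar> \<le> \<bar>1 / M\<bar>" for a c t M
      using bump_bounds[of a c m t] by (simp add: abs_mult divide_right_mono)
    then have A: "\<bar>bump (l' $ j) (r' $ j) m (x $ j) / ?mass' m - bump (l $ j) (r $ j) m (x $ j) / ?mass m\<bar> \<le> K' + K"
      by (intro order_trans[OF abs_triangle_ineq4] add_mono order_trans[OF _ K] order_trans[OF _ K'])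
    have B: "\<bar>\<Prod>i\<in>UNIV - {j}. bump (l $ i) (r $ i) m (x $ i)\<bar> \<le> 1"
      unfolding abs_prod by (rule prod_le_1) (simp add: bump_bounds abs_of_nonneg)
    show ?thesis
      using mult_mono[OF A B order_trans[OF abs_ge_zero A] abs_ge_zero] by (simp only: \<psi>_def abs_mult mult_1_right)
  qed
  have \<psi>_meas: "\<psi> m \<in> borel_measurable lebesgue" for m
  proof -
    have "continuous_on UNIV (\<lambda>x::real^'n. bump a c m (x $ i))" for a c i
      by (intro continuous_at_imp_continuous_on ballI, rule isCont_o2[OF _ isCont_bump]) simp
    then have "continuous_on UNIV (\<psi> m)"
      unfolding \<psi>_def[abs_def] divide_inverse
      by (intro continuous_on_mult continuous_on_diff continuous_on_prod continuous_on_const)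
    then have "\<psi> m \<in> borel_measurable borel"
      by (rule borel_measurable_continuous_onI)
    then show ?thesis
      by (intro measurable_completion) simp
  qed
  have nested: "l' $ i \<le> l $ i" "r' $ i \<le> r $ i" for i
    using off[of i] lr' lr[of j] ord by (cases "i = j"; simp)+
  have sub2: "?b \<subseteq> ?B" "?b' \<subseteq> ?B"
    using nested unfolding subset_iff mem_box_cart by (meson le_less_trans less_le_trans)+
  have iu': "integrable lebesgue (\<lambda>x. indicator ?B x *\<^sub>R u x)"
    using iu by (simp add: set_integrable_def)
  have "(\<lambda>m. LINT x:?B|lebesgue. \<psi> m x *\<^sub>R u x) \<longlonglongrightarrow>
    (\<integral>x. (indicator ?b' x / ?I' - indicator ?b x / ?I) *\<^sub>R u x \<partial>lebesgue)"
    unfolding set_lebesgue_integral_def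
  proof (rule integral_dominated_convergence[where w="\<lambda>x. (K' + K) * norm (indicator ?B x *\<^sub>R u x)"])
    have b: "?b \<in> sets lebesgue" "?b' \<in> sets lebesgue" by auto
    have "(\<lambda>x. (indicator ?b' x / ?I' - indicator ?b x / ?I) *\<^sub>R (indicator ?B x *\<^sub>R u x)) \<in> borel_measurable lebesgue"
      by (rule borel_measurable_scaleR[OF _ borel_measurable_integrable[OF iu']])
         (intro borel_measurable_diff borel_measurable_divide borel_measurable_indicator
           borel_measurable_const b)
    also have "(\<lambda>x. (indicator ?b' x / ?I' - indicator ?b x / ?I) *\<^sub>R (indicator ?B x *\<^sub>R u x))
      = (\<lambda>x. (indicator ?b' x / ?I' - indicator ?b x / ?I) *\<^sub>R u x)"
      using sub2 by (auto simp: fun_eq_iff indicator_def)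
    finally show "(\<lambda>x. (indicator ?b' x / ?I' - indicator ?b x / ?I) *\<^sub>R u x) \<in> borel_measurable lebesgue" .
    have "(\<lambda>x. \<psi> m x *\<^sub>R (indicator ?B x *\<^sub>R u x)) \<in> borel_measurable lebesgue" for m
      by (rule borel_measurable_scaleR[OF \<psi>_meas borel_measurable_integrable[OF iu']])
    then show "(\<lambda>x. indicator ?B x *\<^sub>R \<psi> m x *\<^sub>R u x) \<in> borel_measurable lebesgue" for m
      by (simp add: mult.commute)
    show "integrable lebesgue (\<lambda>x. (K' + K) * norm (indicator ?B x *\<^sub>R u x))"
      by (intro integrable_mult_right integrable_norm iu')
    show "AE x in lebesgue. (\<lambda>m. indicator ?B x *\<^sub>R \<psi> m x *\<^sub>R u x)
        \<longlonglongrightarrow> (indicator ?b' x / ?I' - indicator ?b x / ?I) *\<^sub>R u x"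
    proof (rule AE_I2)
      show "(\<lambda>m. indicator ?B x *\<^sub>R \<psi> m x *\<^sub>R u x)
        \<longlonglongrightarrow> (indicator ?b' x / ?I' - indicator ?b x / ?I) *\<^sub>R u x" for x
        using tendsto_scaleR[OF lim[of x] tendsto_const[of "u x"]] by simp
    qed
    show "AE x in lebesgue. norm (indicator ?B x *\<^sub>R \<psi> m x *\<^sub>R u x) \<le> (K' + K) * norm (indicator ?B x *\<^sub>R u x)" for m
      using mult_right_mono[OF \<psi>_bound norm_ge_zero] by (auto simp: indicator_def)
  qed
  then have lim_int: "(\<lambda>m. norm (LINT x:?B|lebesgue. \<psi> m x *\<^sub>R u x)) \<longlonglongrightarrow>
    norm (\<integral>x. (indicator ?b' x / ?I' - indicator ?b x / ?I) *\<^sub>R u x \<partial>lebesgue)"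
    by (rule tendsto_norm)
  have "eventually (\<lambda>m. 0 < ?mass m) sequentially" "eventually (\<lambda>m. 0 < ?mass' m) sequentially"
    using order_tendstoD(1)[OF bump_mass_tendsto] I by auto
  then have "eventually (\<lambda>m. norm (LINT x:?B|lebesgue. \<psi> m x *\<^sub>R u x) \<le> (LINT x:?B|lebesgue. norm (g x))) sequentially"
    using eventually_ge_at_top[of 1]
  proof eventually_elim
    case (elim m)
    then show ?case
      unfolding \<psi>_def
      by (intro test_function_between_boxes[OF wd U lr lr' ord off sub _ ig]) auto
  qed
  with lim_int have le: "norm (\<integral>x. (indicator ?b' x / ?I' - indicator ?b x / ?I) *\<^sub>R u x \<partial>lebesgue)
      \<le> (LINT x:?B|lebesgue. norm (g x))"
    by (rule tendsto_upperbound) simp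
  have ib: "integrable lebesgue (\<lambda>x. indicator ?b x *\<^sub>R u x)" "integrable lebesgue (\<lambda>x. indicator ?b' x *\<^sub>R u x)"
    using set_integrable_subset[OF iu _ sub2(1)] set_integrable_subset[OF iu _ sub2(2)]
    by (auto simp: set_integrable_def)
  have "(\<integral>x. (indicator ?b' x / ?I' - indicator ?b x / ?I) *\<^sub>R u x \<partial>lebesgue)
     = (\<integral>x. (1 / ?I') *\<^sub>R (indicator ?b' x *\<^sub>R u x) - (1 / ?I) *\<^sub>R (indicator ?b x *\<^sub>R u x) \<partial>lebesgue)"
    by (intro Bochner_Integration.integral_cong refl) (simp add: scaleR_left_diff_distrib)
  also have "\<dots> = (1 / ?I') *\<^sub>R (LINT x:?b'|lebesgue. u x) - (1 / ?I) *\<^sub>R (LINT x:?b|lebesgue. u x)"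
    by (subst Bochner_Integration.integral_diff)
       (intro integrable_scaleR_right ib | simp only: integral_scaleR_right set_lebesgue_integral_def)+
  finally have eq: "(\<integral>x. (indicator ?b' x / ?I' - indicator ?b x / ?I) *\<^sub>R u x \<partial>lebesgue)
     = (1 / ?I') *\<^sub>R (LINT x:?b'|lebesgue. u x) - (1 / ?I) *\<^sub>R (LINT x:?b|lebesgue. u x)" .
  define F where "F = (\<Prod>i\<in>UNIV - {j}. r $ i - l $ i)"
  have F: "0 < F" unfolding F_def by (intro prod_pos) (simp add: lr)
  have lr_all: "l' $ i < r' $ i" for i
    using off lr lr' by (cases "i = j") auto
  have mb: "measure lebesgue ?b = ?I * F"
    using lr unfolding F_def by (subst measure_box_vec) (auto simp: less_imp_le prod.remove[of UNIV j])
  have "(\<Prod>i\<in>UNIV - {j}. r' $ i - l' $ i) = F"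
    unfolding F_def by (intro prod.cong refl) (simp add: off)
  then have mb': "measure lebesgue ?b' = ?I' * F"
    using lr_all by (subst measure_box_vec) (auto simp: less_imp_le prod.remove[of UNIV j])
  have "average u ?b' - average u ?b =
     (1 / F) *\<^sub>R ((1 / ?I') *\<^sub>R (LINT x:?b'|lebesgue. u x) - (1 / ?I) *\<^sub>R (LINT x:?b|lebesgue. u x))"
    by (simp only: average_def mb mb' real_vector.scale_right_diff_distrib scaleR_scaleR
        divide_inverse mult_1_left inverse_mult_distrib mult.commute)
  then have "norm (average u ?b - average u ?b') * F =
     norm (\<integral>x. (indicator ?b' x / ?I' - indicator ?b x / ?I) *\<^sub>R u x \<partial>lebesgue)"
    using F by (simp add: eq norm_minus_commute[of "average u ?b"])
  with le I show ?thesis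
    by (simp add: mb mult.commute mult.left_commute mult_left_mono)
qed

section \<open>Square integrable functions on the domain\<close>

lemma finite_vec_set:
  fixes A :: "'n::finite \<Rightarrow> 'a set"
  assumes "\<And>k. finite (A k)"
  shows "finite {z::'a^'n. \<forall>k. z $ k \<in> A k}"
proof (rule finite_subset)
  show "{z::'a^'n. \<forall>k. z $ k \<in> A k} \<subseteq> (\<lambda>f. \<chi> k. f k) ` (PiE UNIV A)"
  proof
    fix z :: "'a^'n" assume "z \<in> {z. \<forall>k. z $ k \<in> A k}"
    then show "z \<in> (\<lambda>f. \<chi> k. f k) ` (PiE UNIV A)"
      by (intro image_eqI[of _ _ "\<lambda>k. z $ k"]) auto
  qed
  show "finite ((\<lambda>f. (\<chi> k. f k)::'a^'n) ` (PiE UNIV A))"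
    using assms by (intro finite_imageI finite_PiE) auto
qed

text \<open>
  On the torus the cells of the grid points with a vanishing or maximal index stick out of the
  unit cell, so periodic functions are considered on a larger box.
\<close>

definition region :: "domain \<Rightarrow> (real^'n) set" where
  "region \<Omega> = (case \<Omega> of Neumann_Box \<Rightarrow> Omega | Torus \<Rightarrow> cbox (\<chi> k. -1) (\<chi> k. 2))"

definition unit_shifts :: "(real^'n) set" where
  "unit_shifts = {z. \<forall>k. z $ k \<in> {-1, 0, 1}}"

lemma finite_unit_shifts: "finite (unit_shifts :: (real^'n::finite) set)"
  unfolding unit_shifts_def by (rule finite_vec_set) simp

lemma unit_shifts_cover:
  "cbox (\<chi> k. -1) (\<chi> k. 2) \<subseteq> (\<Union>z\<in>unit_shifts. cbox (0 + z) (1 + z) :: (real^'n::finite) set)"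
proof
  fix x :: "real^'n" assume "x \<in> cbox (\<chi> k. -1) (\<chi> k. 2)"
  then have x: "-1 \<le> x $ k" "x $ k \<le> 2" for k by (auto simp: mem_box_cart)
  let ?z = "(\<chi> k. if x $ k < 0 then -1 else if x $ k \<le> 1 then 0 else 1) :: real^'n"
  have "?z \<in> unit_shifts" by (simp add: unit_shifts_def)
  moreover have "x \<in> cbox (0 + ?z) (1 + ?z)"
    using x by (auto simp: mem_box_cart)
  ultimately show "x \<in> (\<Union>z\<in>unit_shifts. cbox (0 + z) (1 + z))" by blast
qed

lemma periodic_unit_shift:
  fixes f :: "real^'n::finite \<Rightarrow> 'b"
  assumes per: "\<And>x j. f (x + axis j 1) = f x" and z: "z \<in> unit_shifts"
  shows "f (x + z) = f x"
proof -
  have per': "f (x + (z $ j) *\<^sub>R axis j 1) = f x" for x j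
  proof -
    have "f x = f (x - axis j 1)" using per[of "x - axis j 1" j] by simp
    moreover have "z $ j = -1 \<or> z $ j = 0 \<or> z $ j = 1" using z by (auto simp: unit_shifts_def)
    ultimately show ?thesis using per[of x j] by auto
  qed
  have "f (x + (\<Sum>j\<in>S. (z $ j) *\<^sub>R axis j 1)) = f x" if "finite S" for S
    using that
  proof (induction S rule: finite_induct)
    case (insert j S)
    then show ?case
      using per'[of "x + (\<Sum>j\<in>S. (z $ j) *\<^sub>R axis j 1)" j] by (simp add: add_ac)
  qed simp
  from this[of UNIV] show ?thesis
    using basis_expansion[of z] by (simp add: scalar_mult_eq_scaleR)
qed

lemma periodic_integrable:
  fixes f :: "real^'n::finite \<Rightarrow> 'b::euclidean_space"
  assumes per: "\<And>x j. f (x + axis j 1) = f x" and f: "set_integrable lebesgue (cbox 0 1) f"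
  shows "set_integrable lebesgue (cbox (\<chi> k. -1) (\<chi> k. 2)) f"
proof -
  have "set_integrable lebesgue (cbox (0 + z) (1 + z)) f" if "z \<in> unit_shifts" for z
  proof -
    have "f \<circ> (+) z = f"
      using periodic_unit_shift[of f, OF per that] by (simp add: fun_eq_iff add.commute)
    moreover from this have "(\<lambda>x. norm (f x)) \<circ> (+) z = (\<lambda>x. norm (f x))"
      by (auto simp: fun_eq_iff)
    ultimately show ?thesis
      using f integrable_on_shift_cbox[of f z 0 1] integrable_on_shift_cbox[of "\<lambda>x. norm (f x)" z 0 1]
      unfolding absolutely_integrable_on_def by simp
  qed
  then have "set_integrable lebesgue (\<Union>z\<in>unit_shifts. cbox (0 + z) (1 + z)) f"
    by (intro set_integrable_UN finite_unit_shifts) auto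
  then show ?thesis
    by (rule set_integrable_subset[OF _ _ unit_shifts_cover]) simp
qed

lemma periodic_negligible:
  fixes P :: "real^'n::finite \<Rightarrow> bool"
  assumes per: "\<And>x j. P (x + axis j 1) = P x" and N: "negligible {x \<in> cbox 0 1. P x}"
  shows "negligible {x \<in> cbox (\<chi> k. -1) (\<chi> k. 2). P x}"
proof -
  have "negligible {x \<in> cbox (0 + z) (1 + z). P x}" if "z \<in> unit_shifts" for z
  proof -
    have "{x \<in> cbox (0 + z) (1 + z). P x} \<subseteq> (+) z ` {x \<in> cbox 0 1. P x}"
    proof
      fix x assume x: "x \<in> {x \<in> cbox (0 + z) (1 + z). P x}"
      moreover have "P (x - z)"
        using periodic_unit_shift[of P, OF per that, of "x - z"] x by simp
      ultimately show "x \<in> (+) z ` {x \<in> cbox 0 1. P x}"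
        by (intro image_eqI[of _ _ "x - z"]) (auto simp: mem_box_cart algebra_simps)
    qed
    then show ?thesis
      using negligible_subset negligible_translation[OF N] by blast
  qed
  then have "negligible (\<Union>z\<in>unit_shifts. {x \<in> cbox (0 + z) (1 + z). P x})"
    using finite_unit_shifts by (intro negligible_Union) auto
  then show ?thesis
    by (rule negligible_subset) (use unit_shifts_cover in blast)
qed

lemma L2_space_region:
  fixes u :: "real^'n::finite \<Rightarrow> real^3"
  assumes u: "u \<in> L2_space \<Omega>"
  shows "set_integrable lebesgue (region \<Omega>) u"
    and "set_integrable lebesgue (region \<Omega>) (\<lambda>x. (norm (u x))\<^sup>2)"
proof -
  have sq: "integrable (lebesgue_on Omega) (\<lambda>x. (norm (u x))\<^sup>2)"
    and m: "u \<in> borel_measurable (lebesgue_on Omega)"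
    using u by (auto simp: L2_space_def)
  have Om: "Omega \<in> sets (lebesgue :: (real^'n) measure)" by (simp add: Omega_def)
  have fin: "integrable (lebesgue_on (Omega :: (real^'n) set)) (\<lambda>x. 1::real)"
    by (intro finite_measure.integrable_const finite_measure_lebesgue_on) (simp add: Omega_def)
  have "integrable (lebesgue_on Omega) u"
  proof (rule Bochner_Integration.integrable_bound[OF Bochner_Integration.integrable_add[OF fin sq] m])
    have "norm a \<le> 1 + (norm a)\<^sup>2" for a :: "real^3"
    proof -
      have "0 \<le> (norm a - 1/2)\<^sup>2" by simp
      then show ?thesis by (simp add: power2_eq_square algebra_simps)
    qed
    then show "AE x in lebesgue_on Omega. norm (u x) \<le> norm (1 + (norm (u x))\<^sup>2)"
      by (simp add: abs_of_nonneg)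
  qed
  then have 1: "set_integrable lebesgue (cbox 0 1) u"
    using Om by (simp add: integrable_restrict_space set_integrable_def Omega_def)
  have 2: "set_integrable lebesgue (cbox 0 1) (\<lambda>x. (norm (u x))\<^sup>2)"
    using Om sq by (simp add: integrable_restrict_space set_integrable_def Omega_def)
  show "set_integrable lebesgue (region \<Omega>) u"
  proof (cases \<Omega>)
    case Torus
    then show ?thesis
      using periodic_integrable[of u] 1 u by (simp add: region_def L2_space_def on_domain_def)
  qed (use 1 in \<open>simp add: region_def Omega_def\<close>)
  show "set_integrable lebesgue (region \<Omega>) (\<lambda>x. (norm (u x))\<^sup>2)"
  proof (cases \<Omega>)
    case Torus
    then show ?thesis
      using periodic_integrable[of "\<lambda>x. (norm (u x))\<^sup>2"] 2 u
      by (simp add: region_def L2_space_def on_domain_def)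
  qed (use 2 in \<open>simp add: region_def Omega_def\<close>)
qed

lemma AE_region:
  fixes u :: "real^'n::finite \<Rightarrow> real^3"
  assumes u: "on_domain \<Omega> u" and AE: "AE x in lebesgue_on Omega. norm (u x) = 1"
  shows "AE x in lebesgue. x \<in> region \<Omega> \<longrightarrow> norm (u x) = 1"
proof -
  have Om: "Omega \<in> sets (lebesgue :: (real^'n) measure)" by (simp add: Omega_def)
  have "AE x in lebesgue. x \<in> Omega \<longrightarrow> norm (u x) = 1"
    using AE Om by (simp add: AE_restrict_space_iff)
  then obtain N where "N \<in> null_sets lebesgue"
    "{x \<in> space lebesgue. \<not> (x \<in> Omega \<longrightarrow> norm (u x) = 1)} \<subseteq> N"
    unfolding eventually_ae_filter by blast
  then have "negligible N" "{x \<in> cbox 0 1. norm (u x) \<noteq> 1} \<subseteq> N"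
    by (auto simp: negligible_iff_null_sets Omega_def)
  then have N: "negligible {x \<in> cbox 0 1. norm (u x) \<noteq> 1}"
    using negligible_subset by blast
  have "negligible {x \<in> region \<Omega>. norm (u x) \<noteq> 1}"
  proof (cases \<Omega>)
    case Torus
    then show ?thesis
      using periodic_negligible[of "\<lambda>x. norm (u x) \<noteq> 1"] N u by (simp add: region_def on_domain_def)
  qed (use N in \<open>simp add: region_def Omega_def\<close>)
  then have "{x \<in> region \<Omega>. norm (u x) \<noteq> 1} \<in> null_sets lebesgue"
    by (simp add: negligible_iff_null_sets)
  from AE_not_in[OF this] show ?thesis
    by eventually_elim blast
qed

text \<open>
  Expand the integral of \<open>(m f - S)\<^sup>2 \<ge> 0\<close>, where \<open>m\<close> is the measure of \<open>B\<close> and \<open>S\<close> the integral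
  of \<open>f\<close>.
\<close>

lemma Cauchy_Schwarz_set_integral:
  fixes f :: "'a::euclidean_space \<Rightarrow> real"
  assumes B: "B \<in> lmeasurable" and f: "set_integrable lebesgue B f"
    and f2: "set_integrable lebesgue B (\<lambda>x. (f x)\<^sup>2)"
  shows "(LINT x:B|lebesgue. f x)\<^sup>2 \<le> measure lebesgue B * (LINT x:B|lebesgue. (f x)\<^sup>2)"
proof -
  let ?S = "LINT x:B|lebesgue. f x" and ?A = "LINT x:B|lebesgue. (f x)\<^sup>2" and ?m = "measure lebesgue B"
  have one: "set_integrable lebesgue B (\<lambda>x. 1::real)"
    using B by (simp add: set_integrable_def lmeasurable_iff_integrable)
  have "0 \<le> (LINT x:B|lebesgue. (?m * f x - ?S)\<^sup>2)"
    unfolding set_lebesgue_integral_def by (intro Bochner_Integration.integral_nonneg) auto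
  also have "(\<lambda>x. (?m * f x - ?S)\<^sup>2) = (\<lambda>x. ?m\<^sup>2 * (f x)\<^sup>2 - 2 * ?m * ?S * f x + ?S\<^sup>2 * 1)"
    by (simp add: fun_eq_iff power2_diff power_mult_distrib)
  also have "(LINT x:B|lebesgue. ?m\<^sup>2 * (f x)\<^sup>2 - 2 * ?m * ?S * f x + ?S\<^sup>2 * 1)
     = ?m\<^sup>2 * ?A - 2 * ?m * ?S * ?S + ?S\<^sup>2 * (LINT x:B|lebesgue. 1)"
  proof -
    have i: "set_integrable lebesgue B (\<lambda>x. ?m\<^sup>2 * (f x)\<^sup>2)" "set_integrable lebesgue B (\<lambda>x. 2 * ?m * ?S * f x)"
      "set_integrable lebesgue B (\<lambda>x. ?S\<^sup>2 * 1)"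
      using f f2 one by (intro set_integrable_mult_right; simp)+
    show ?thesis
      unfolding set_integral_add(2)[OF set_integral_diff(1)[OF i(1,2)] i(3)] set_integral_diff(2)[OF i(1,2)]
        set_integral_mult_right ..
  qed
  also have "(LINT x:B|lebesgue. 1) = ?m"
    using B by (simp add: set_lebesgue_integral_def)
  finally have le: "0 \<le> ?m * (?m * ?A - ?S\<^sup>2)"
    by (simp add: power2_eq_square algebra_simps)
  show ?thesis
  proof (cases "?m = 0")
    case True
    then have "B \<in> null_sets lebesgue"
      using B by (simp add: negligible_iff_measure flip: negligible_iff_null_sets)
    then have "?S = 0"
      unfolding set_lebesgue_integral_def
    proof (intro integral_eq_zero_AE)
      show "AE x in lebesgue. indicator B x *\<^sub>R f x = 0"
        using AE_not_in[OF \<open>B \<in> null_sets lebesgue\<close>] by eventually_elim simp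
    qed
    then show ?thesis using True by simp
  next
    case False
    then have "0 < ?m" by (simp add: zero_less_measure_iff less_le)
    with le show ?thesis by (simp add: zero_le_mult_iff)
  qed
qed

lemma sum_set_integral_overlap:
  fixes f :: "'a::euclidean_space \<Rightarrow> real"
  assumes "finite I" and A: "\<And>i. i \<in> I \<Longrightarrow> A i \<subseteq> R" "\<And>i. i \<in> I \<Longrightarrow> A i \<in> sets lebesgue"
    and f: "set_integrable lebesgue R f" "\<And>x. 0 \<le> f x"
    and k: "\<And>x. card {i \<in> I. x \<in> A i} \<le> k"
  shows "(\<Sum>i\<in>I. LINT x:A i|lebesgue. f x) \<le> real k * (LINT x:R|lebesgue. f x)"
proof -
  have iA: "integrable lebesgue (\<lambda>x. indicator (A i) x *\<^sub>R f x)" if "i \<in> I" for i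
    using set_integrable_subset[OF f(1) A(2)[OF that] A(1)[OF that]] by (simp add: set_integrable_def)
  have iR: "integrable lebesgue (\<lambda>x. indicator R x *\<^sub>R f x)"
    using f(1) by (simp add: set_integrable_def)
  have "(\<Sum>i\<in>I. LINT x:A i|lebesgue. f x) = (\<integral>x. (\<Sum>i\<in>I. indicator (A i) x *\<^sub>R f x) \<partial>lebesgue)"
    unfolding set_lebesgue_integral_def by (rule Bochner_Integration.integral_sum[symmetric]) (rule iA)
  also have "\<dots> \<le> (\<integral>x. real k * (indicator R x *\<^sub>R f x) \<partial>lebesgue)"
  proof (rule integral_mono)
    fix x
    have "(\<Sum>i\<in>I. indicator (A i) x *\<^sub>R f x) = real (card {i \<in> I. x \<in> A i}) * f x"
    proof -
      have "(\<Sum>i\<in>I. indicator (A i) x :: real) = (\<Sum>i\<in>{i \<in> I. x \<in> A i}. 1)"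
        using \<open>finite I\<close> by (intro sum.mono_neutral_cong_right) (auto simp: indicator_def)
      then show ?thesis
        by (simp only: scaleR_sum_left[symmetric]) simp
    qed
    also have "\<dots> \<le> real k * (indicator R x *\<^sub>R f x)"
    proof (cases "x \<in> R")
      case False
      then have "{i \<in> I. x \<in> A i} = {}" using A(1) by auto
      then show ?thesis using False by (simp only: card.empty) simp
    next
      case True
      have "real (card {i \<in> I. x \<in> A i}) * f x \<le> real k * f x"
        using k[of x] f(2)[of x] by (intro mult_right_mono) simp_all
      then show ?thesis using True by (simp only: indicator_simps scaleR_one)
    qed
    finally show "(\<Sum>i\<in>I. indicator (A i) x *\<^sub>R f x) \<le> real k * (indicator R x *\<^sub>R f x)" .
  next
    show "integrable lebesgue (\<lambda>x. \<Sum>i\<in>I. indicator (A i) x *\<^sub>R f x)"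
      by (rule Bochner_Integration.integrable_sum) (rule iA)
    show "integrable lebesgue (\<lambda>x. real k * (indicator R x *\<^sub>R f x))"
      by (rule integrable_mult_right) (rule iR)
  qed
  finally show ?thesis
    by (simp add: set_lebesgue_integral_def)
qed

section \<open>The cells and their averages\<close>

definition cell_lo :: "domain \<Rightarrow> real \<Rightarrow> int^'n \<Rightarrow> real^'n" where
  "cell_lo \<Omega> h i = (\<chi> k. case \<Omega> of
     Neumann_Box \<Rightarrow> max 0 ((real_of_int (i $ k) - 1/2) * h) | Torus \<Rightarrow> (real_of_int (i $ k) - 1/2) * h)"

definition cell_hi :: "domain \<Rightarrow> real \<Rightarrow> int^'n \<Rightarrow> real^'n" where
  "cell_hi \<Omega> h i = (\<chi> k. case \<Omega> of
     Neumann_Box \<Rightarrow> min 1 ((real_of_int (i $ k) + 1/2) * h) | Torus \<Rightarrow> (real_of_int (i $ k) + 1/2) * h)"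

definition cell_box :: "domain \<Rightarrow> real \<Rightarrow> int^'n \<Rightarrow> (real^'n) set" where
  "cell_box \<Omega> h i = box (cell_lo \<Omega> h i) (cell_hi \<Omega> h i)"

lemma mesh_bounds:
  assumes "1 \<le> M" "h = 1 / real M"
  shows "0 < h" "h \<le> 1"
  using assms by auto

lemma grid_scaled:
  assumes "1 \<le> M" "h = 1 / real M" "i \<in> grid M"
  shows "0 \<le> real_of_int (i $ k) * h" "real_of_int (i $ k) * h \<le> 1"
proof -
  have "0 \<le> i $ k" "i $ k \<le> int M" using assms(3) by (auto simp: grid_def)
  then show "0 \<le> real_of_int (i $ k) * h" "real_of_int (i $ k) * h \<le> 1"
    using assms(1,2) by (auto simp: divide_le_eq)
qed

lemma cell_extent:
  assumes M: "1 \<le> M" "h = 1 / real M" "i \<in> grid M"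
  shows "h / 2 \<le> cell_hi \<Omega> h i $ k - cell_lo \<Omega> h i $ k"
    and "cell_hi \<Omega> h i $ k - cell_lo \<Omega> h i $ k \<le> h"
proof -
  define t where "t = real_of_int (i $ k) * h"
  have t: "0 \<le> t" "t \<le> 1" and h: "0 < h" "h \<le> 1"
    using grid_scaled[OF M, of k] mesh_bounds[OF M(1,2)] by (simp_all only: t_def)
  have lo: "cell_lo \<Omega> h i $ k = (case \<Omega> of Neumann_Box \<Rightarrow> max 0 (t - h / 2) | Torus \<Rightarrow> t - h / 2)"
    by (cases \<Omega>) (simp_all add: cell_lo_def t_def left_diff_distrib)
  have hi: "cell_hi \<Omega> h i $ k = (case \<Omega> of Neumann_Box \<Rightarrow> min 1 (t + h / 2) | Torus \<Rightarrow> t + h / 2)"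
    by (cases \<Omega>) (simp_all add: cell_hi_def t_def distrib_right)
  show "h / 2 \<le> cell_hi \<Omega> h i $ k - cell_lo \<Omega> h i $ k"
    unfolding lo hi using t h by (cases \<Omega>) (simp_all add: max_def min_def)
  show "cell_hi \<Omega> h i $ k - cell_lo \<Omega> h i $ k \<le> h"
    unfolding lo hi using t h by (cases \<Omega>) (simp_all add: max_def min_def)
qed

lemma cell_box_index:
  assumes "0 < h" "x \<in> cell_box \<Omega> h i"
  shows "pc h (\<lambda>i. i) x = i"
proof (rule pc_cell[OF assms(1)])
  have "cell_lo \<Omega> h i $ k < x $ k \<and> x $ k < cell_hi \<Omega> h i $ k" for k
    using assms(2) by (simp add: cell_box_def mem_box_cart)
  then show "x \<in> cell h i"
    unfolding cell_def cell_lo_def cell_hi_def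
    by (cases \<Omega>) (auto simp: less_imp_le)
qed

lemma cell_box_subset_region:
  assumes M: "1 \<le> M" "h = 1 / real M" "i \<in> grid M" "i' \<in> grid M"
  shows "cbox (cell_lo \<Omega> h i') (cell_hi \<Omega> h i) \<subseteq> region \<Omega>"
    and "box (cell_lo \<Omega> h i') (cell_hi \<Omega> h i) \<subseteq> region \<Omega>"
    and "box (cell_lo \<Omega> h i') (cell_hi \<Omega> h i) \<subseteq> (case \<Omega> of Neumann_Box \<Rightarrow> box 0 1 | Torus \<Rightarrow> UNIV)"
proof -
  have lo: "(case \<Omega> of Neumann_Box \<Rightarrow> 0 | Torus \<Rightarrow> -1) \<le> cell_lo \<Omega> h i' $ k" for k
    using grid_scaled[OF M(1,2,4), of k] mesh_bounds[OF M(1,2)]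
    by (cases \<Omega>) (auto simp: cell_lo_def left_diff_distrib)
  have hi: "cell_hi \<Omega> h i $ k \<le> (case \<Omega> of Neumann_Box \<Rightarrow> 1 | Torus \<Rightarrow> 2)" for k
    using grid_scaled[OF M(1,2,3), of k] mesh_bounds[OF M(1,2)]
    by (cases \<Omega>) (auto simp: cell_hi_def distrib_right)
  have x: "(case \<Omega> of Neumann_Box \<Rightarrow> 0 | Torus \<Rightarrow> -1) < x $ k \<and> x $ k < (case \<Omega> of Neumann_Box \<Rightarrow> 1 | Torus \<Rightarrow> 2)"
    if "x \<in> box (cell_lo \<Omega> h i') (cell_hi \<Omega> h i)" for x k
  proof -
    have "cell_lo \<Omega> h i' $ k < x $ k" "x $ k < cell_hi \<Omega> h i $ k"
      using that by (simp_all add: mem_box_cart)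
    then show ?thesis
      using le_less_trans[OF lo] less_le_trans[OF _ hi] by blast
  qed
  show cb: "cbox (cell_lo \<Omega> h i') (cell_hi \<Omega> h i) \<subseteq> region \<Omega>"
  proof
    fix x assume "x \<in> cbox (cell_lo \<Omega> h i') (cell_hi \<Omega> h i)"
    then have "(case \<Omega> of Neumann_Box \<Rightarrow> 0 | Torus \<Rightarrow> -1) \<le> x $ k \<and> x $ k \<le> (case \<Omega> of Neumann_Box \<Rightarrow> 1 | Torus \<Rightarrow> 2)" for k
    proof -
      have "cell_lo \<Omega> h i' $ k \<le> x $ k" "x $ k \<le> cell_hi \<Omega> h i $ k"
        using \<open>x \<in> cbox (cell_lo \<Omega> h i') (cell_hi \<Omega> h i)\<close> by (simp_all add: mem_box_cart)
      then show ?thesis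
        using order_trans[OF lo] order_trans[OF _ hi] by blast
    qed
    then show "x \<in> region \<Omega>"
      by (cases \<Omega>) (simp_all add: region_def Omega_def mem_box_cart)
  qed
  then show "box (cell_lo \<Omega> h i') (cell_hi \<Omega> h i) \<subseteq> region \<Omega>"
    using box_subset_cbox by blast
  show "box (cell_lo \<Omega> h i') (cell_hi \<Omega> h i) \<subseteq> (case \<Omega> of Neumann_Box \<Rightarrow> box 0 1 | Torus \<Rightarrow> UNIV)"
    using x by (cases \<Omega>) (force simp: mem_box_cart)+
qed

lemma measure_cell_box:
  fixes i :: "int^'n::finite"
  assumes M: "1 \<le> M" "h = 1 / real M" "i \<in> grid M"
  shows "(h / 2) ^ CARD('n) \<le> measure lebesgue (cell_box \<Omega> h i)" "0 < measure lebesgue (cell_box \<Omega> h i)"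
proof -
  have h: "0 < h" by (rule mesh_bounds[OF M(1,2)])
  have ex: "h / 2 \<le> cell_hi \<Omega> h i $ k - cell_lo \<Omega> h i $ k" for k
    by (rule cell_extent[OF M])
  have "measure lebesgue (cell_box \<Omega> h i) = (\<Prod>k\<in>UNIV. cell_hi \<Omega> h i $ k - cell_lo \<Omega> h i $ k)"
    unfolding cell_box_def
  proof (rule measure_box_vec)
    show "cell_lo \<Omega> h i $ k \<le> cell_hi \<Omega> h i $ k" for k
      using ex[of k] h by linarith
  qed
  moreover have "(\<Prod>k\<in>(UNIV::'n set). h / 2) \<le> (\<Prod>k\<in>UNIV. cell_hi \<Omega> h i $ k - cell_lo \<Omega> h i $ k)"
    by (rule prod_mono) (use h ex in auto)
  ultimately show 1: "(h / 2) ^ CARD('n) \<le> measure lebesgue (cell_box \<Omega> h i)"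
    by (simp only: prod_constant)
  have "0 < (h / 2) ^ CARD('n)" using h by simp
  with 1 show "0 < measure lebesgue (cell_box \<Omega> h i)" by (rule less_le_trans[rotated])
qed

text \<open>The half-open, possibly truncated cells differ from open boxes by null sets.\<close>

lemma box_negligible_boundary:
  fixes f :: "real^'n::finite \<Rightarrow> 'b::{banach, second_countable_topology}"
  assumes "box l r \<subseteq> E" "E \<subseteq> cbox l r"
  shows "E \<in> sets lebesgue" "measure lebesgue E = measure lebesgue (box l r)"
    and "AE x in lebesgue. x \<in> E \<longrightarrow> x \<in> box l r"
proof -
  have N: "negligible (E - box l r)"
    using assms(2) by (intro negligible_subset[OF negligible_frontier_interval]) auto
  have "box l r \<union> (E - box l r) = E" using assms(1) by auto
  moreover have "box l r \<union> (E - box l r) \<in> sets lebesgue"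
    by (intro sets.Un negligible_imp_sets[OF N]) simp
  ultimately show "E \<in> sets lebesgue"
    by (simp only:)
  show "measure lebesgue E = measure lebesgue (box l r)"
  proof (rule measure_negligible_symdiff)
    show "negligible (sym_diff (box l r) E)"
      using assms(1) N by (simp add: Diff_eq_empty_iff[THEN iffD2])
  qed simp
  have "E - box l r \<in> null_sets lebesgue" using N by (simp add: negligible_iff_null_sets)
  from AE_not_in[OF this] show "AE x in lebesgue. x \<in> E \<longrightarrow> x \<in> box l r"
    by eventually_elim blast
qed

lemma cell_average_set:
  fixes u :: "real^'n::finite \<Rightarrow> real^3"
  assumes M: "1 \<le> M" "h = 1 / real M" "i \<in> grid M"
  obtains E where "cell_average \<Omega> h u i = average u E" "cell_box \<Omega> h i \<subseteq> E"
    "E \<subseteq> cbox (cell_lo \<Omega> h i) (cell_hi \<Omega> h i)"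
proof -
  let ?E = "case \<Omega> of Neumann_Box \<Rightarrow> cell h i \<inter> Omega | Torus \<Rightarrow> cell h i"
  have sub: "cell_box \<Omega> h i \<subseteq> ?E"
  proof (cases \<Omega>)
    case Neumann_Box
    then show ?thesis
      by (auto simp: cell_box_def cell_def cell_lo_def cell_hi_def Omega_def mem_box_cart less_imp_le)
  next
    case Torus
    then show ?thesis
      by (auto simp: cell_box_def cell_def cell_lo_def cell_hi_def mem_box_cart less_imp_le)
  qed
  have sup: "?E \<subseteq> cbox (cell_lo \<Omega> h i) (cell_hi \<Omega> h i)"
    by (cases \<Omega>) (auto simp: cell_def cell_lo_def cell_hi_def Omega_def mem_box_cart less_imp_le)
  have "?E \<in> sets lebesgue"
    using box_negligible_boundary(1)[OF sub[unfolded cell_box_def] sup] .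
  then have eq: "cell_average \<Omega> h u i = average u ?E"
    unfolding cell_average_def Let_def average_def set_lebesgue_integral_def
    by (subst integral_restrict_space) auto
  show thesis
    by (rule that[OF eq sub sup])
qed

lemma cell_average_eq:
  fixes u :: "real^'n::finite \<Rightarrow> real^3"
  assumes M: "1 \<le> M" "h = 1 / real M" "i \<in> grid M"
    and u: "set_integrable lebesgue (region \<Omega>) u"
  shows "cell_average \<Omega> h u i = average u (cell_box \<Omega> h i)"
proof -
  obtain E where E: "cell_average \<Omega> h u i = average u E" "cell_box \<Omega> h i \<subseteq> E"
    "E \<subseteq> cbox (cell_lo \<Omega> h i) (cell_hi \<Omega> h i)"
    by (rule cell_average_set[OF M])
  note bd = box_negligible_boundary[OF E(2,3)[unfolded cell_box_def]]
  have sub: "cell_box \<Omega> h i \<subseteq> region \<Omega>"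
    unfolding cell_box_def by (rule cell_box_subset_region(2)[OF M M(3)])
  have ib: "set_integrable lebesgue (cell_box \<Omega> h i) u"
    by (rule set_integrable_subset[OF u _ sub]) (simp add: cell_box_def)
  have "E \<subseteq> region \<Omega>"
    using E(3) cell_box_subset_region(1)[OF M M(3)] by blast
  then have iE: "set_integrable lebesgue E u"
    by (rule set_integrable_subset[OF u bd(1)])
  have ae: "AE x in lebesgue. indicator (cell_box \<Omega> h i) x *\<^sub>R u x = indicator E x *\<^sub>R u x"
    using bd(3) by eventually_elim (use E(2) in \<open>auto simp: indicator_def cell_box_def\<close>)
  have "(LINT x:cell_box \<Omega> h i|lebesgue. u x) = (LINT x:E|lebesgue. u x)"
    unfolding set_lebesgue_integral_def
    using ib iE ae by (intro integral_cong_AE) (auto simp: set_integrable_def)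
  then show ?thesis
    using E(1) bd(2) by (simp add: average_def cell_box_def)
qed

text \<open>
  Integrability is asked of the majorant \<open>F\<close>, so that the pointwise bounds on \<open>d\<^sup>0\<close> and on \<open>d\<^sup>0\<^sub>t \<times> d\<^sup>0\<close>, which
  hold almost everywhere, can be inserted directly.
\<close>

lemma norm_cell_average_le:
  fixes f :: "real^'n::finite \<Rightarrow> real^3"
  assumes M: "1 \<le> M" "h = 1 / real M" "i \<in> grid M"
    and F: "set_integrable lebesgue (cell_box \<Omega> h i) F" "\<And>x. 0 \<le> F x"
    and f: "AE x in lebesgue. x \<in> region \<Omega> \<longrightarrow> norm (f x) \<le> F x"
  shows "norm (cell_average \<Omega> h f i) \<le> average F (cell_box \<Omega> h i)"
proof -
  obtain E where E: "cell_average \<Omega> h f i = average f E" "cell_box \<Omega> h i \<subseteq> E"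
    "E \<subseteq> cbox (cell_lo \<Omega> h i) (cell_hi \<Omega> h i)"
    by (rule cell_average_set[OF M])
  note bd = box_negligible_boundary[OF E(2,3)[unfolded cell_box_def]]
  have sub: "cell_box \<Omega> h i \<subseteq> region \<Omega>"
    unfolding cell_box_def by (rule cell_box_subset_region(2)[OF M M(3)])
  have "norm (LINT x:E|lebesgue. f x) \<le> (\<integral>x. norm (indicator E x *\<^sub>R f x) \<partial>lebesgue)"
    unfolding set_lebesgue_integral_def by (rule integral_norm_bound)
  also have "\<dots> \<le> (LINT x:cell_box \<Omega> h i|lebesgue. F x)"
    unfolding set_lebesgue_integral_def
  proof (rule integral_mono_AE')
    show "integrable lebesgue (\<lambda>x. indicator (cell_box \<Omega> h i) x *\<^sub>R F x)"
      using F(1) by (simp add: set_integrable_def)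
    show "AE x in lebesgue. norm (indicator E x *\<^sub>R f x) \<le> indicator (cell_box \<Omega> h i) x *\<^sub>R F x"
      using bd(3) f
    proof eventually_elim
      case (elim x)
      show ?case
      proof (cases "x \<in> E")
        case True
        then have "x \<in> cell_box \<Omega> h i" using elim(1) by (simp add: cell_box_def)
        then show ?thesis using True elim(2) sub by auto
      qed (use F(2)[of x] in \<open>simp add: indicator_def\<close>)
    qed
    show "AE x in lebesgue. 0 \<le> indicator (cell_box \<Omega> h i) x *\<^sub>R F x"
      using F(2) by simp
  qed
  finally show ?thesis
    using bd(2) measure_cell_box(2)[OF M, of \<Omega>]
    by (simp add: E(1) average_def cell_box_def divide_right_mono mult_left_mono)
qed

lemma cell_corner_bounds:
  "(real_of_int (i $ k) - 1/2) * h \<le> cell_lo \<Omega> h i $ k"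
  "cell_hi \<Omega> h i $ k \<le> (real_of_int (i $ k) + 1/2) * h"
  by (cases \<Omega>; simp add: cell_lo_def cell_hi_def)+

lemma cell_corners_off:
  fixes i :: "int^'n::finite"
  assumes "k \<noteq> j"
  shows "cell_lo \<Omega> h (i - axis j 1) $ k = cell_lo \<Omega> h i $ k"
    "cell_hi \<Omega> h (i - axis j 1) $ k = cell_hi \<Omega> h i $ k"
proof -
  have "(i - axis j 1) $ k = i $ k"
    using assms by (simp add: axis_def)
  then show "cell_lo \<Omega> h (i - axis j 1) $ k = cell_lo \<Omega> h i $ k"
    "cell_hi \<Omega> h (i - axis j 1) $ k = cell_hi \<Omega> h i $ k"
    by (cases \<Omega>; simp only: cell_lo_def cell_hi_def vec_lambda_beta domain.case)+
qed

text \<open>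
  This limits the overlap of the boxes on which neighbouring averages are compared: for a fixed
  direction, every point lies in at most two of them.
\<close>

lemma adjacent_cells_index:
  assumes h: "0 < h" and x: "x \<in> box (cell_lo \<Omega> h (i - axis j 1)) (cell_hi \<Omega> h i)"
  shows "i \<in> {pc h (\<lambda>i. i) x, pc h (\<lambda>i. i) x + axis j 1}"
proof -
  let ?p = "pc h (\<lambda>i. i) x"
  have p: "?p $ k = \<lfloor>x $ k / h + 1/2\<rfloor>" for k by (simp add: pc_def)
  have lo: "(real_of_int ((i - axis j 1) $ k) - 1/2) * h < x $ k"
    and hi: "x $ k < (real_of_int (i $ k) + 1/2) * h" for k
    using x cell_corner_bounds(1)[of "i - axis j 1" k h \<Omega>] cell_corner_bounds(2)[of \<Omega> h i k]
    unfolding mem_box_cart by (force intro: le_less_trans less_le_trans)+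
  have up: "?p $ k \<le> i $ k" for k
    using hi[of k] h by (simp add: p floor_le_iff field_simps)
  have down: "(i - axis j 1) $ k \<le> ?p $ k" for k
    using lo[of k] h by (simp add: p le_floor_iff field_simps)
  have off: "?p $ k = i $ k" if "k \<noteq> j" for k
    using up[of k] down[of k] that by (simp add: axis_def)
  have "?p $ j = i $ j \<or> ?p $ j = i $ j - 1"
    using up[of j] down[of j] by (auto simp: axis_def)
  then show ?thesis
  proof
    assume "?p $ j = i $ j"
    then have "?p = i" using off by (metis vec_eq_iff)
    then show ?thesis by simp
  next
    assume "?p $ j = i $ j - 1"
    then have "?p + axis j 1 = i" using off by (auto simp: vec_eq_iff axis_def)
    then show ?thesis by simp
  qed
qed

text \<open>
  The weight \<open>h ^ n\<close> of a grid point in the energy matches the Cauchy-Schwarz inequality on the two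
  cells.  The factor \<open>8 ^ n\<close> arises because a cell cut off by the boundary may have only the edge
  lengths \<open>h / 2\<close>, while the pair of cells is enclosed in a box with edges at most \<open>2 h\<close>.
\<close>

lemma average_jump:
  fixes u g :: "real^'n::finite \<Rightarrow> real^3"
  assumes M: "1 \<le> M" "h = 1 / real M" and i: "i \<in> grid M" "i - axis j 1 \<in> grid M"
    and u: "u \<in> L2_space \<Omega>" and g: "g \<in> L2_space \<Omega>"
    and wd: "weak_deriv (case \<Omega> of Neumann_Box \<Rightarrow> box 0 1 | Torus \<Rightarrow> UNIV) j u g"
  shows "h ^ CARD('n) * (norm ((cell_average \<Omega> h u i - cell_average \<Omega> h u (i - axis j 1)) /\<^sub>R h))\<^sup>2
    \<le> 8 ^ CARD('n) * (LINT x:box (cell_lo \<Omega> h (i - axis j 1)) (cell_hi \<Omega> h i)|lebesgue. (norm (g x))\<^sup>2)"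
proof -
  let ?n = "CARD('n)" and ?i' = "i - axis j 1"
  let ?l = "cell_lo \<Omega> h i" and ?r = "cell_hi \<Omega> h i"
  let ?l' = "cell_lo \<Omega> h ?i'" and ?r' = "cell_hi \<Omega> h ?i'"
  let ?B = "box ?l' ?r" and ?D = "norm (cell_average \<Omega> h u i - cell_average \<Omega> h u ?i')"
  let ?S = "LINT x:?B|lebesgue. norm (g x)" and ?A = "LINT x:?B|lebesgue. (norm (g x))\<^sup>2"
  have h: "0 < h" by (rule mesh_bounds[OF M])
  have lr: "?l $ k < ?r $ k" for k using cell_extent(1)[OF M i(1), of \<Omega> k] h by linarith
  have lr': "?l' $ k < ?r' $ k" for k using cell_extent(1)[OF M i(2), of \<Omega> k] h by linarith
  have ord: "?r' $ j \<le> ?l $ j"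
    using cell_corner_bounds(2)[of \<Omega> h ?i' j] cell_corner_bounds(1)[of i j h \<Omega>]
    by (simp add: axis_def)
  note off = cell_corners_off[of _ j \<Omega> h i]
  note sub = cell_box_subset_region[OF M i, of \<Omega>]
  have uB: "set_integrable lebesgue ?B u" and gB: "set_integrable lebesgue ?B g"
    and g2B: "set_integrable lebesgue ?B (\<lambda>x. (norm (g x))\<^sup>2)"
    by (rule set_integrable_subset[OF _ _ sub(2)]; simp add: L2_space_region[OF u] L2_space_region[OF g])+
  have "measure lebesgue (box ?l ?r) * norm (average u (box ?l ?r) - average u (box ?l' ?r'))
      \<le> (?r $ j - ?l $ j) * ?S"
    by (rule weak_deriv_average_diff[OF wd _ lr lr' ord _ sub(3) uB gB])
       (auto simp: off split: domain.split)
  moreover have "cell_average \<Omega> h u i = average u (box ?l ?r)" "cell_average \<Omega> h u ?i' = average u (box ?l' ?r')"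
    using cell_average_eq[OF M i(1) L2_space_region(1)[OF u]] cell_average_eq[OF M i(2) L2_space_region(1)[OF u]]
    by (simp_all add: cell_box_def)
  ultimately have "measure lebesgue (box ?l ?r) * ?D \<le> (?r $ j - ?l $ j) * ?S"
    by simp
  moreover have S0: "0 \<le> ?S"
    unfolding set_lebesgue_integral_def by (intro Bochner_Integration.integral_nonneg) simp
  moreover have "(?r $ j - ?l $ j) * ?S \<le> h * ?S"
    by (rule mult_right_mono[OF cell_extent(2)[OF M i(1)] S0])
  moreover have "(h / 2) ^ ?n * ?D \<le> measure lebesgue (box ?l ?r) * ?D"
    using measure_cell_box(1)[OF M i(1), of \<Omega>] by (intro mult_right_mono) (simp_all add: cell_box_def)
  ultimately have "(h / 2) ^ ?n * ?D \<le> h * ?S" by linarith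
  then have "((h / 2) ^ ?n * ?D)\<^sup>2 \<le> (h * ?S)\<^sup>2"
    using h by (intro power_mono) auto
  also have "\<dots> = h\<^sup>2 * ?S\<^sup>2" by (simp add: power_mult_distrib)
  also have "?S\<^sup>2 \<le> measure lebesgue ?B * ?A"
    using Cauchy_Schwarz_set_integral[OF lmeasurable_box set_integrable_norm[OF gB] g2B] .
  also have "measure lebesgue ?B \<le> (2 * h) ^ ?n"
  proof -
    have le: "?l' $ k \<le> ?r $ k" and len: "?r $ k - ?l' $ k \<le> 2 * h" for k
    proof -
      have "?l' $ k \<le> ?r $ k \<and> ?r $ k - ?l' $ k \<le> 2 * h"
      proof (cases "k = j")
        case True
        then show ?thesis
          using lr'[of j] ord lr[of j] cell_corner_bounds(1)[of ?i' j h \<Omega>] cell_corner_bounds(2)[of \<Omega> h i j]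
          by (simp add: axis_def algebra_simps)
      next
        case False
        then show ?thesis
          using lr[of k] cell_extent(2)[OF M i(1), of \<Omega> k] h by (simp add: off)
      qed
      then show "?l' $ k \<le> ?r $ k" "?r $ k - ?l' $ k \<le> 2 * h" by auto
    qed
    have "measure lebesgue ?B = (\<Prod>k\<in>UNIV. ?r $ k - ?l' $ k)"
      by (rule measure_box_vec) (rule le)
    also have "\<dots> \<le> (\<Prod>k\<in>(UNIV::'n set). 2 * h)"
      using le len by (intro prod_mono) simp
    finally show ?thesis by simp
  qed
  finally have "((h / 2) ^ ?n * ?D)\<^sup>2 \<le> h\<^sup>2 * ((2 * h) ^ ?n * ?A)"
    by (simp add: mult_left_mono mult_right_mono set_lebesgue_integral_def)
  then have "h ^ ?n * (h ^ ?n * ?D\<^sup>2) \<le> h ^ ?n * (8 ^ ?n * h\<^sup>2 * ?A)"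
  proof -
    assume le: "((h / 2) ^ ?n * ?D)\<^sup>2 \<le> h\<^sup>2 * ((2 * h) ^ ?n * ?A)"
    have "h ^ ?n * (h ^ ?n * ?D\<^sup>2) = 4 ^ ?n * ((h / 2) ^ ?n * ?D)\<^sup>2"
    proof -
      have "(4::real) ^ ?n = 2 ^ ?n * 2 ^ ?n"
        by (simp flip: power_mult_distrib)
      then show ?thesis
        by (simp add: power_divide power2_eq_square)
    qed
    also have "\<dots> \<le> 4 ^ ?n * (h\<^sup>2 * ((2 * h) ^ ?n * ?A))"
      using le by simp
    also have "\<dots> = h ^ ?n * ((4 ^ ?n * 2 ^ ?n) * h\<^sup>2 * ?A)"
      by (simp add: power_mult_distrib)
    also have "(4 ^ ?n * 2 ^ ?n :: real) = 8 ^ ?n"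
      by (simp flip: power_mult_distrib)
    finally show ?thesis .
  qed
  then have "h ^ ?n * ?D\<^sup>2 \<le> 8 ^ ?n * h\<^sup>2 * ?A"
    using h by (simp add: mult_le_cancel_left_pos)
  then have "h ^ ?n * ?D\<^sup>2 / h\<^sup>2 \<le> 8 ^ ?n * ?A"
    using h by (simp add: divide_le_eq mult_ac)
  moreover have "norm ((cell_average \<Omega> h u i - cell_average \<Omega> h u ?i') /\<^sub>R h) = ?D / h"
    unfolding norm_scaleR using h by (simp add: divide_inverse mult.commute)
  ultimately show ?thesis
    by (simp only: power_divide times_divide_eq_right)
qed

section \<open>Boundary conditions as neighbour maps\<close>

text \<open>
  On the torus the indices \<open>0\<close> and \<open>M\<close> name the same point, so \<open>0\<close> is left out; then all
  neighbours \<open>i - e\<^sub>j\<close> still lie in the grid.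
\<close>

definition first_node :: "domain \<Rightarrow> int" where
  "first_node \<Omega> = (case \<Omega> of Neumann_Box \<Rightarrow> 0 | Torus \<Rightarrow> 1)"

definition nodes :: "domain \<Rightarrow> nat \<Rightarrow> (int^'n) set" where
  "nodes \<Omega> M = {i. \<forall>k. i $ k \<in> {first_node \<Omega>..int M}}"

definition next_node :: "domain \<Rightarrow> nat \<Rightarrow> 'n \<Rightarrow> int^'n \<Rightarrow> int^'n" where
  "next_node \<Omega> M j i = (if i $ j = int M
     then (case \<Omega> of Neumann_Box \<Rightarrow> i | Torus \<Rightarrow> i - axis j (int M - 1)) else i + axis j 1)"

definition prev_node :: "domain \<Rightarrow> nat \<Rightarrow> 'n \<Rightarrow> int^'n \<Rightarrow> int^'n" where
  "prev_node \<Omega> M j i = (if i $ j = first_node \<Omega>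
     then (case \<Omega> of Neumann_Box \<Rightarrow> i | Torus \<Rightarrow> i + axis j (int M - 1)) else i - axis j 1)"

lemma finite_nodes: "finite (nodes \<Omega> M :: (int^'n::finite) set)"
  unfolding nodes_def by (rule finite_vec_set) simp

lemma finite_grid: "finite (grid M :: (int^'n::finite) set)"
proof -
  have "grid M = (nodes Neumann_Box M :: (int^'n) set)"
    by (auto simp: grid_def nodes_def first_node_def)
  then show ?thesis by (simp add: finite_nodes)
qed

lemma nodes_subset_grid: "nodes \<Omega> M \<subseteq> (grid M :: (int^'n) set)"
proof
  fix i :: "int^'n" assume "i \<in> nodes \<Omega> M"
  then have "first_node \<Omega> \<le> i $ k" "i $ k \<le> int M" for k by (auto simp: nodes_def)
  moreover have "0 \<le> first_node \<Omega>" by (cases \<Omega>) (auto simp: first_node_def)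
  ultimately show "i \<in> grid M"
    by (simp add: grid_def) (meson order_trans)
qed

lemma shift_grid_nodes:
  assumes M: "1 \<le> M" and h: "0 < h"
  shows "shift_grid (nodes \<Omega> M) (next_node \<Omega> M) (prev_node \<Omega> M :: 'n \<Rightarrow> int^'n::finite \<Rightarrow> int^'n) h"
proof
  fix i :: "int^'n" and j :: 'n
  assume i: "i \<in> nodes \<Omega> M"
  then have b: "first_node \<Omega> \<le> i $ k" "i $ k \<le> int M" for k by (auto simp: nodes_def)
  have b': "i $ j = int M \<or> i $ j < int M" "i $ j = first_node \<Omega> \<or> first_node \<Omega> < i $ j"
    using b[of j] by auto
  show "next_node \<Omega> M j i \<in> nodes \<Omega> M"
    using b M b[of j] b' by (cases \<Omega>) (auto simp: next_node_def nodes_def first_node_def axis_def)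
  show "prev_node \<Omega> M j i \<in> nodes \<Omega> M"
    using b M b[of j] b' by (cases \<Omega>) (auto simp: prev_node_def nodes_def first_node_def axis_def)
  show "prev_node \<Omega> M j (next_node \<Omega> M j i) = i" if "next_node \<Omega> M j i \<noteq> i"
    using that b(1)[of j] by (cases \<Omega>) (auto simp: prev_node_def next_node_def first_node_def axis_def split: if_splits)
  show "next_node \<Omega> M j (prev_node \<Omega> M j i) = i" if "prev_node \<Omega> M j i \<noteq> i"
    using that b(2)[of j] by (cases \<Omega>) (auto simp: prev_node_def next_node_def first_node_def axis_def split: if_splits)
qed (simp_all add: finite_nodes h)

lemma bc_next:
  assumes "bc \<Omega> M f" "i \<in> nodes \<Omega> M"
  shows "f (i + axis j 1) = f (next_node \<Omega> M j i)"
proof (cases \<Omega>)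
  case Torus
  have "i - axis j (int M - 1) + axis j (int M) = i + axis j 1"
    by (simp add: vec_eq_iff axis_def)
  moreover have "\<forall>i j. f (i + axis j (int M)) = f i"
    using assms(1) Torus by (simp add: bc_def)
  ultimately have "f (i + axis j 1) = f (i - axis j (int M - 1))"
    by metis
  then show ?thesis
    using Torus by (simp add: next_node_def)
next
  case Neumann_Box
  then show ?thesis
    using assms nodes_subset_grid[of \<Omega> M] by (auto simp: bc_def next_node_def)
qed

lemma bc_prev:
  assumes "bc \<Omega> M f" "i \<in> nodes \<Omega> M"
  shows "f (i - axis j 1) = f (prev_node \<Omega> M j i)"
proof (cases \<Omega>)
  case Torus
  have "i - axis j 1 + axis j (int M) = i + axis j (int M - 1)"
    by (simp add: vec_eq_iff axis_def)
  moreover have "\<forall>i j. f (i + axis j (int M)) = f i"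
    using assms(1) Torus by (simp add: bc_def)
  ultimately have "f (i - axis j 1) = f (i + axis j (int M - 1))"
    by metis
  then show ?thesis
    using Torus by (simp add: prev_node_def)
next
  case Neumann_Box
  then show ?thesis
    using assms nodes_subset_grid[of \<Omega> M] by (auto simp: bc_def prev_node_def first_node_def)
qed



section \<open>The difference operators under the boundary conditions\<close>

lemma bc_mid: "bc \<Omega> M f \<Longrightarrow> bc \<Omega> M g \<Longrightarrow> bc \<Omega> M (mid f g)"
  by (cases \<Omega>) (auto simp: bc_def mid_def)

lemma Dminus_eq_bdiff:
  fixes f :: "int^'n::finite \<Rightarrow> real^3"
  assumes "1 \<le> M" "0 < h" "bc \<Omega> M f" "i \<in> nodes \<Omega> M"
  shows "Dminus h j f i = shift_grid.bdiff (prev_node \<Omega> M) h j f i"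
proof -
  interpret shift_grid "nodes \<Omega> M" "next_node \<Omega> M" "prev_node \<Omega> M :: 'n \<Rightarrow> int^'n \<Rightarrow> int^'n" h
    by (rule shift_grid_nodes[OF assms(1,2)])
  show ?thesis
    using bc_prev[OF assms(3,4)] by (simp add: Dminus_def Dplus_def bdiff_def)
qed

lemma laplace_h_eq_lap:
  fixes f :: "int^'n::finite \<Rightarrow> real^3"
  assumes "1 \<le> M" "0 < h" "bc \<Omega> M f" "i \<in> nodes \<Omega> M"
  shows "laplace_h h f i = shift_grid.lap (next_node \<Omega> M) (prev_node \<Omega> M) h f i"
proof -
  interpret shift_grid "nodes \<Omega> M" "next_node \<Omega> M" "prev_node \<Omega> M :: 'n \<Rightarrow> int^'n \<Rightarrow> int^'n" h
    by (rule shift_grid_nodes[OF assms(1,2)])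
  show ?thesis
    unfolding laplace_h_def lap_def scaleR_sum_right
  proof (rule sum.cong[OF refl])
    fix j
    have "Dplus h j (Dminus h j f) i = ((f (i + axis j 1) - f i) - (f i - f (i - axis j 1))) /\<^sub>R h\<^sup>2"
      using assms(2) by (simp add: Dplus_def Dminus_def power2_eq_square algebra_simps)
    then show "Dplus h j (Dminus h j f) i =
        (f (next_node \<Omega> M j i) - 2 *\<^sub>R f i + f (prev_node \<Omega> M j i)) /\<^sub>R h\<^sup>2"
      using bc_prev[OF assms(3,4), of j] bc_next[OF assms(3,4), of j] by (simp add: scaleR_2)
  qed
qed

section \<open>The energy of the initial values\<close>

text \<open>
  This is the only place where the regularity of the initial data enters: the discrete energy
  at time \<open>0\<close> is bounded by integrals of the data that do not depend on the mesh.
\<close>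

lemma initial_energy_bound:
  fixes d0 dt0 :: "real^'n::finite \<Rightarrow> real^3" and g :: "'n \<Rightarrow> real^'n \<Rightarrow> real^3"
  assumes M: "1 \<le> M" "h = 1 / real M"
    and d0: "d0 \<in> L2_space \<Omega>" "AE x in lebesgue_on Omega. norm (d0 x) = 1"
    and dt0: "dt0 \<in> L2_space \<Omega>" and g: "\<And>j. g j \<in> L2_space \<Omega>"
    and wd: "\<And>j. weak_deriv (case \<Omega> of Neumann_Box \<Rightarrow> box 0 1 | Torus \<Rightarrow> UNIV) j d0 (g j)"
    and bc: "bc \<Omega> M d"
    and d: "\<And>i. i \<in> grid M \<Longrightarrow> d i = cell_average \<Omega> h d0 i"
    and w: "\<And>i. i \<in> grid M \<Longrightarrow> w i = cell_average \<Omega> h (\<lambda>x. cross3 (dt0 x) (d0 x)) i"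
  shows "h ^ CARD('n) * shift_grid.energy (nodes \<Omega> M) (prev_node \<Omega> M) h d w
    \<le> 2 ^ CARD('n) * (LINT x:region \<Omega>|lebesgue. (norm (dt0 x))\<^sup>2)
      + (\<Sum>j\<in>UNIV. 8 ^ CARD('n) * (2 * (LINT x:region \<Omega>|lebesgue. (norm (g j x))\<^sup>2)))"
proof -
  let ?n = "CARD('n)" and ?G = "nodes \<Omega> M :: (int^'n) set"
  have h: "0 < h" by (rule mesh_bounds[OF M])
  interpret shift_grid ?G "next_node \<Omega> M" "prev_node \<Omega> M :: 'n \<Rightarrow> int^'n \<Rightarrow> int^'n" h
    by (rule shift_grid_nodes[OF M(1) h])
  note G = subsetD[OF nodes_subset_grid, of _ \<Omega> M]
  have sq0: "0 \<le> (LINT x:B|lebesgue. (norm (f x))\<^sup>2)" for B and f :: "real^'n \<Rightarrow> real^3"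
    unfolding set_lebesgue_integral_def by (intro Bochner_Integration.integral_nonneg) simp
  have wi: "h ^ ?n * (norm (w i))\<^sup>2 \<le> 2 ^ ?n * (LINT x:cell_box \<Omega> h i|lebesgue. (norm (dt0 x))\<^sup>2)"
    if i: "i \<in> ?G" for i
  proof -
    let ?B = "cell_box \<Omega> h i" and ?m = "measure lebesgue (cell_box \<Omega> h i)"
    let ?A = "LINT x:?B|lebesgue. (norm (dt0 x))\<^sup>2"
    have sub: "?B \<subseteq> region \<Omega>"
      unfolding cell_box_def by (rule cell_box_subset_region(2)[OF M G[OF i] G[OF i]])
    have iB: "set_integrable lebesgue ?B dt0" "set_integrable lebesgue ?B (\<lambda>x. (norm (dt0 x))\<^sup>2)"
      by (rule set_integrable_subset[OF _ _ sub]; simp add: L2_space_region[OF dt0] cell_box_def)+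
    have "AE x in lebesgue. x \<in> region \<Omega> \<longrightarrow> norm (cross3 (dt0 x) (d0 x)) \<le> norm (dt0 x)"
      using AE_region[OF _ d0(2), of \<Omega>] d0(1)
      by (auto simp: L2_space_def elim!: eventually_mono intro: order_trans[OF norm_cross3_le])
    then have "norm (w i) \<le> average (\<lambda>x. norm (dt0 x)) ?B"
      unfolding w[OF G[OF i]] by (intro norm_cell_average_le[OF M G[OF i] set_integrable_norm[OF iB(1)]]) auto
    then have "(norm (w i))\<^sup>2 \<le> (average (\<lambda>x. norm (dt0 x)) ?B)\<^sup>2"
      by (intro power_mono) auto
    also have "\<dots> = (LINT x:?B|lebesgue. norm (dt0 x))\<^sup>2 / ?m\<^sup>2"
      by (simp add: average_def power_mult_distrib power_inverse divide_inverse mult.commute)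
    also have "\<dots> \<le> ?m * ?A / ?m\<^sup>2"
      using Cauchy_Schwarz_set_integral[OF _ set_integrable_norm[OF iB(1)] iB(2)]
      by (intro divide_right_mono) (auto simp: cell_box_def)
    also have "\<dots> = ?A / ?m"
      using measure_cell_box(2)[OF M G[OF i], of \<Omega>] by (simp add: power2_eq_square)
    also have "\<dots> \<le> ?A / (h / 2) ^ ?n"
      using measure_cell_box[OF M G[OF i], of \<Omega>] sq0[of ?B dt0] h
      by (intro divide_left_mono mult_pos_pos) auto
    finally have "h ^ ?n * (norm (w i))\<^sup>2 \<le> h ^ ?n * (?A / (h / 2) ^ ?n)"
      using h by (intro mult_left_mono) auto
    also have "\<dots> = 2 ^ ?n * ?A"
      using h by (simp add: power_divide)
    finally show ?thesis .
  qed
  have overlap_w: "card {i \<in> ?G. x \<in> cell_box \<Omega> h i} \<le> 1" for x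
  proof -
    have "{i \<in> ?G. x \<in> cell_box \<Omega> h i} \<subseteq> {pc h (\<lambda>i. i) x}"
      using cell_box_index[OF h] by blast
    from card_mono[OF _ this] show ?thesis by simp
  qed
  have "h ^ ?n * (\<Sum>i\<in>?G. (norm (w i))\<^sup>2)
      \<le> (\<Sum>i\<in>?G. 2 ^ ?n * (LINT x:cell_box \<Omega> h i|lebesgue. (norm (dt0 x))\<^sup>2))"
    unfolding sum_distrib_left by (intro sum_mono wi)
  also have "\<dots> \<le> 2 ^ ?n * (1 * (LINT x:region \<Omega>|lebesgue. (norm (dt0 x))\<^sup>2))"
    unfolding sum_distrib_left[symmetric]
  proof (rule mult_left_mono)
    have "(\<Sum>i\<in>?G. LINT x:cell_box \<Omega> h i|lebesgue. (norm (dt0 x))\<^sup>2)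
        \<le> real 1 * (LINT x:region \<Omega>|lebesgue. (norm (dt0 x))\<^sup>2)"
    proof (rule sum_set_integral_overlap[OF finite_G _ _ _ _ overlap_w])
      show "cell_box \<Omega> h i \<subseteq> region \<Omega>" if "i \<in> ?G" for i
        unfolding cell_box_def using that G by (intro cell_box_subset_region(2)[OF M]) auto
    qed (use L2_space_region(2)[OF dt0] in \<open>auto simp: cell_box_def\<close>)
    then show "(\<Sum>i\<in>?G. LINT x:cell_box \<Omega> h i|lebesgue. (norm (dt0 x))\<^sup>2)
        \<le> 1 * (LINT x:region \<Omega>|lebesgue. (norm (dt0 x))\<^sup>2)"
      by simp
  qed simp
  finally have W: "h ^ ?n * (\<Sum>i\<in>?G. (norm (w i))\<^sup>2) \<le> 2 ^ ?n * (LINT x:region \<Omega>|lebesgue. (norm (dt0 x))\<^sup>2)"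
    by simp
  have D: "h ^ ?n * (\<Sum>i\<in>?G. (norm (bdiff j d i))\<^sup>2)
      \<le> 8 ^ ?n * (2 * (LINT x:region \<Omega>|lebesgue. (norm (g j x))\<^sup>2))" for j
  proof -
    \<comment> \<open>The nodes outside \<open>?G'\<close> lie on the lower Neumann boundary, where the difference vanishes.\<close>
    let ?G' = "{i \<in> ?G. i - axis j 1 \<in> grid M}"
    let ?B = "\<lambda>i. box (cell_lo \<Omega> h (i - axis j 1)) (cell_hi \<Omega> h i)"
    have zero: "bdiff j d i = 0" if "i \<in> ?G - ?G'" for i
    proof -
      have i: "i \<in> ?G" "i - axis j 1 \<notin> grid M" using that by auto
      have "prev_node \<Omega> M j i = i"
      proof (rule ccontr)
        assume ne: "prev_node \<Omega> M j i \<noteq> i"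
        have b: "first_node \<Omega> \<le> i $ k" "i $ k \<le> int M" for k using i(1) by (auto simp: nodes_def)
        have "1 \<le> i $ j"
          using ne b(1)[of j] by (cases \<Omega>) (auto simp: prev_node_def first_node_def split: if_splits)
        moreover have "0 \<le> first_node \<Omega>" by (cases \<Omega>) (auto simp: first_node_def)
        ultimately have "0 \<le> (i - axis j 1) $ k \<and> (i - axis j 1) $ k \<le> int M" for k
          using b[of k] by (auto simp: axis_def)
        with i(2) show False by (simp add: grid_def)
      qed
      then show ?thesis by (simp add: bdiff_def)
    qed
    have jump: "h ^ ?n * (norm (bdiff j d i))\<^sup>2 \<le> 8 ^ ?n * (LINT x:?B i|lebesgue. (norm (g j x))\<^sup>2)"
      if i: "i \<in> ?G'" for i
    proof -
      have ig: "i \<in> ?G" "i \<in> grid M" "i - axis j 1 \<in> grid M" using i G by auto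
      have "bdiff j d i = (cell_average \<Omega> h d0 i - cell_average \<Omega> h d0 (i - axis j 1)) /\<^sub>R h"
        using bc_prev[OF bc ig(1), of j] d[OF ig(2)] d[OF ig(3)] by (simp add: bdiff_def)
      then show ?thesis
        using average_jump[OF M ig(2,3) d0(1) g wd] by simp
    qed
    have overlap: "card {i \<in> ?G'. x \<in> ?B i} \<le> 2" for x
    proof -
      have "{i \<in> ?G'. x \<in> ?B i} \<subseteq> {pc h (\<lambda>i. i) x, pc h (\<lambda>i. i) x + axis j 1}"
        using adjacent_cells_index[OF h] by blast
      from card_mono[OF _ this] show ?thesis
        by (rule order_trans) (simp_all add: card_insert_if)
    qed
    have "h ^ ?n * (\<Sum>i\<in>?G. (norm (bdiff j d i))\<^sup>2) = h ^ ?n * (\<Sum>i\<in>?G'. (norm (bdiff j d i))\<^sup>2)"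
      using zero by (intro arg_cong[where f="(*) (h ^ ?n)"] sum.mono_neutral_right) auto
    also have "\<dots> \<le> (\<Sum>i\<in>?G'. 8 ^ ?n * (LINT x:?B i|lebesgue. (norm (g j x))\<^sup>2))"
      unfolding sum_distrib_left by (intro sum_mono jump)
    also have "\<dots> \<le> 8 ^ ?n * (2 * (LINT x:region \<Omega>|lebesgue. (norm (g j x))\<^sup>2))"
      unfolding sum_distrib_left[symmetric]
    proof (rule mult_left_mono)
      have "(\<Sum>i\<in>?G'. LINT x:?B i|lebesgue. (norm (g j x))\<^sup>2) \<le> real 2 * (LINT x:region \<Omega>|lebesgue. (norm (g j x))\<^sup>2)"
      proof (rule sum_set_integral_overlap[OF _ _ _ _ _ overlap])
        show "?B i \<subseteq> region \<Omega>" if "i \<in> ?G'" for i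
          using that G by (intro cell_box_subset_region(2)[OF M]) auto
      qed (use L2_space_region(2)[OF g] in auto)
      then show "(\<Sum>i\<in>?G'. LINT x:?B i|lebesgue. (norm (g j x))\<^sup>2) \<le> 2 * (LINT x:region \<Omega>|lebesgue. (norm (g j x))\<^sup>2)"
        by simp
    qed simp
    finally show ?thesis .
  qed
  have "h ^ ?n * energy d w = h ^ ?n * (\<Sum>i\<in>?G. (norm (w i))\<^sup>2) + (\<Sum>j\<in>UNIV. h ^ ?n * (\<Sum>i\<in>?G. (norm (bdiff j d i))\<^sup>2))"
    by (simp add: energy_def distrib_left sum_distrib_left)
  also have "\<dots> \<le> 2 ^ ?n * (LINT x:region \<Omega>|lebesgue. (norm (dt0 x))\<^sup>2)
      + (\<Sum>j\<in>UNIV. 8 ^ ?n * (2 * (LINT x:region \<Omega>|lebesgue. (norm (g j x))\<^sup>2)))"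
    by (intro add_mono W sum_mono D)
  finally show ?thesis .
qed

lemma norm_initial_director_le:
  fixes d0 :: "real^'n::finite \<Rightarrow> real^3"
  assumes M: "1 \<le> M" "h = 1 / real M" and i: "i \<in> grid M"
    and d0: "d0 \<in> L2_space \<Omega>" "AE x in lebesgue_on Omega. norm (d0 x) = 1"
  shows "norm (cell_average \<Omega> h d0 i) \<le> 1"
proof -
  have one: "set_integrable lebesgue (cell_box \<Omega> h i) (\<lambda>x. 1::real)"
    by (simp add: set_integrable_def cell_box_def flip: lmeasurable_iff_integrable)
  have "AE x in lebesgue. x \<in> region \<Omega> \<longrightarrow> norm (d0 x) \<le> 1"
    using AE_region[OF _ d0(2), of \<Omega>] d0(1) by (auto simp: L2_space_def elim!: eventually_mono)
  then have "norm (cell_average \<Omega> h d0 i) \<le> average (\<lambda>x. 1) (cell_box \<Omega> h i)"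
    by (intro norm_cell_average_le[OF M i one]) auto
  also have "average (\<lambda>x. 1::real) (cell_box \<Omega> h i) = 1"
    using measure_cell_box(2)[OF M i, of \<Omega>] by (simp add: average_def set_lebesgue_integral_def)
  finally show ?thesis .
qed

section \<open>Norms of piecewise constant functions\<close>

lemma L2norm_pc_le:
  fixes f :: "int^'n::finite \<Rightarrow> 'b::real_normed_vector"
  assumes M: "1 \<le> M" "h = 1 / real M"
  shows "L2norm (pc h f) \<le> sqrt (h ^ CARD('n) * (\<Sum>i\<in>grid M. (norm (f i))\<^sup>2))"
proof -
  have h: "0 < h" by (rule mesh_bounds[OF M])
  \<comment> \<open>The closures of the cells have the same measure and are boxes.\<close>
  define C where "C i = cbox (\<chi> k. (real_of_int (i $ k) - 1/2) * h) (\<chi> k. (real_of_int (i $ k) + 1/2) * h)"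
    for i :: "int^'n"
  have mC: "measure lebesgue (C i) = h ^ CARD('n)" for i
  proof -
    have "C i \<noteq> {}" using h by (simp add: C_def interval_ne_empty_cart)
    then show ?thesis by (simp add: C_def content_cbox_cart left_diff_distrib distrib_right)
  qed
  have iC: "integrable lebesgue (indicator (C i) :: _ \<Rightarrow> real)" for i
    by (simp add: C_def flip: lmeasurable_iff_integrable)
  have ind: "indicator Omega x * (norm (pc h f x))\<^sup>2 \<le> (\<Sum>i\<in>grid M. (norm (f i))\<^sup>2 * indicator (C i) x)" for x
  proof (cases "x \<in> Omega")
    case True
    define p where "p = (\<chi> k. \<lfloor>x $ k / h + 1/2\<rfloor>)"
    have x: "0 \<le> x $ k" "x $ k \<le> 1" for k using True by (auto simp: Omega_def mem_box_cart)
    have "0 \<le> p $ k \<and> p $ k \<le> int M" for k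
    proof
      have "0 \<le> x $ k / h" using x[of k] h by simp
      then show "0 \<le> p $ k" by (simp add: p_def)
      have "x $ k / h \<le> real M" using x[of k] M by (simp add: mult_left_le_one_le)
      then show "p $ k \<le> int M" by (simp add: p_def floor_le_iff)
    qed
    then have "p \<in> grid M" by (simp add: grid_def)
    have "x \<in> C p"
    proof -
      have "(real_of_int (p $ k) - 1/2) * h \<le> x $ k \<and> x $ k \<le> (real_of_int (p $ k) + 1/2) * h" for k
      proof -
        have "real_of_int (p $ k) \<le> x $ k / h + 1/2" "x $ k / h + 1/2 < real_of_int (p $ k) + 1"
          unfolding p_def by simp_all
        then have "real_of_int (p $ k) - 1/2 \<le> x $ k / h" "x $ k / h \<le> real_of_int (p $ k) + 1/2"
          by linarith+
        then show ?thesis using h by (simp add: le_divide_eq divide_le_eq)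
      qed
      then show ?thesis by (simp add: C_def mem_box_cart)
    qed
    have "indicator Omega x * (norm (pc h f x))\<^sup>2 = (norm (f p))\<^sup>2 * indicator (C p) x"
      using True \<open>x \<in> C p\<close> by (simp add: pc_def p_def)
    also have "\<dots> \<le> (\<Sum>i\<in>grid M. (norm (f i))\<^sup>2 * indicator (C i) x)"
      by (rule member_le_sum[OF \<open>p \<in> grid M\<close>]) (auto simp: finite_grid)
    finally show ?thesis .
  qed (auto intro!: sum_nonneg)
  have "(\<integral>x. (norm (pc h f x))\<^sup>2 \<partial>lebesgue_on Omega) = (\<integral>x. indicator Omega x * (norm (pc h f x))\<^sup>2 \<partial>lebesgue)"
    by (subst integral_restrict_space) (auto simp: Omega_def)
  also have "\<dots> \<le> (\<integral>x. (\<Sum>i\<in>grid M. (norm (f i))\<^sup>2 * indicator (C i) x) \<partial>lebesgue)"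
    by (rule integral_mono')
       (auto intro!: Bochner_Integration.integrable_sum integrable_mult_right iC ind sum_nonneg)
  also have "\<dots> = (\<Sum>i\<in>grid M. (norm (f i))\<^sup>2 * h ^ CARD('n))"
  proof (subst Bochner_Integration.integral_sum)
    show "integrable lebesgue (\<lambda>x. (norm (f i))\<^sup>2 * indicator (C i) x)" for i
      by (rule integrable_mult_right) (rule iC)
    show "(\<Sum>i\<in>grid M. \<integral>x. (norm (f i))\<^sup>2 * indicator (C i) x \<partial>lebesgue) = (\<Sum>i\<in>grid M. (norm (f i))\<^sup>2 * h ^ CARD('n))"
      by (simp add: mC)
  qed
  finally show ?thesis
    unfolding L2norm_def by (intro real_sqrt_le_mono) (simp add: sum_distrib_left mult.commute)
qed

definition corner_shifts :: "(int^'n) set" where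
  "corner_shifts = {z. \<forall>k. z $ k \<in> {0, 1}}"

lemma finite_corner_shifts: "finite (corner_shifts :: (int^'n::finite) set)"
  unfolding corner_shifts_def by (rule finite_vec_set) simp

text \<open>
  The cells of the torus grid that lie across the boundary of the unit cell are represented
  several times in the grid, at most once for every way of shifting the zero indices by a period.
\<close>

lemma sum_grid_le_sum_nodes:
  fixes F :: "int^'n::finite \<Rightarrow> real"
  assumes F: "\<And>i. 0 \<le> F i" and per: "\<Omega> = Torus \<Longrightarrow> \<forall>i j. F (i + axis j (int M)) = F i"
    and M: "1 \<le> M"
  shows "sum F (grid M) \<le> real (card (corner_shifts :: (int^'n) set)) * sum F (nodes \<Omega> M)"
proof (cases \<Omega>)
  case Neumann_Box
  have "(0 :: int^'n) \<in> corner_shifts" by (simp add: corner_shifts_def)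
  then have "0 < card (corner_shifts :: (int^'n) set)"
    using finite_corner_shifts card_gt_0_iff by blast
  then have "1 * sum F (nodes \<Omega> M) \<le> real (card (corner_shifts :: (int^'n) set)) * sum F (nodes \<Omega> M)"
    by (intro mult_right_mono sum_nonneg F) simp
  moreover have "grid M = (nodes \<Omega> M :: (int^'n) set)"
    using Neumann_Box by (auto simp: grid_def nodes_def first_node_def)
  ultimately show ?thesis by simp
next
  case Torus
  let ?sh = "\<lambda>z::int^'n. (\<chi> k. int M * z $ k)"
  have shift: "F (y - ?sh z) = F y" if z: "z \<in> corner_shifts" for y z
  proof -
    have "F (x + (\<chi> k. if k \<in> S then int M * z $ k else 0)) = F x" if "finite S" for S x
      using that
    proof (induction S arbitrary: x rule: finite_induct)
      case (insert j S)
      have z01: "z $ j = 0 \<or> z $ j = 1" using z by (auto simp: corner_shifts_def)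
      have "(\<chi> k. if k \<in> insert j S then int M * z $ k else 0)
          = (\<chi> k. if k \<in> S then int M * z $ k else 0) + (if z $ j = 1 then axis j (int M) else 0)"
        using insert(2) z01 by (auto simp: vec_eq_iff axis_def)
      then show ?case
        using per Torus insert.IH[of x] by (auto simp: add.assoc[symmetric])
    qed (simp add: zero_vec_def[symmetric])
    from this[of UNIV "y - ?sh z"] show ?thesis by simp
  qed
  have cover: "grid M \<subseteq> (\<lambda>(z, y). y - ?sh z) ` (corner_shifts \<times> nodes \<Omega> M)"
  proof
    fix i :: "int^'n" assume i: "i \<in> grid M"
    let ?z = "(\<chi> k. if i $ k = 0 then 1 else 0) :: int^'n"
    have "?z \<in> corner_shifts" by (simp add: corner_shifts_def)
    moreover have "i + ?sh ?z \<in> nodes \<Omega> M"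
    proof -
      have "1 \<le> (i + ?sh ?z) $ k \<and> (i + ?sh ?z) $ k \<le> int M" for k
      proof -
        have "0 \<le> i $ k" "i $ k \<le> int M" using i by (auto simp: grid_def)
        then show ?thesis using M by (cases "i $ k = 0") auto
      qed
      then show ?thesis using Torus by (simp add: nodes_def first_node_def)
    qed
    ultimately show "i \<in> (\<lambda>(z, y). y - ?sh z) ` (corner_shifts \<times> nodes \<Omega> M)"
      by (intro image_eqI[of _ _ "(?z, i + ?sh ?z)"]) simp_all
  qed
  have fin: "finite (corner_shifts \<times> nodes \<Omega> M :: ((int^'n) \<times> (int^'n)) set)"
    by (simp add: finite_corner_shifts finite_nodes)
  have "sum F (grid M) \<le> sum F ((\<lambda>(z, y). y - ?sh z) ` (corner_shifts \<times> nodes \<Omega> M))"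
    by (rule sum_mono2[OF finite_imageI[OF fin] cover]) (rule F)
  also have "\<dots> \<le> (\<Sum>p\<in>(corner_shifts :: (int^'n) set) \<times> nodes \<Omega> M. F ((\<lambda>(z, y). y - ?sh z) p))"
    using sum_image_le[OF fin, of F "\<lambda>(z, y). y - ?sh z"] F by (simp add: o_def)
  also have "\<dots> = (\<Sum>p\<in>(corner_shifts :: (int^'n) set) \<times> nodes \<Omega> M. F (snd p))"
    by (intro sum.cong refl) (auto simp: shift)
  also have "\<dots> = real (card (corner_shifts :: (int^'n) set)) * sum F (nodes \<Omega> M)"
    using sum.cartesian_product[of "\<lambda>z y. F y" "nodes \<Omega> M" "corner_shifts :: (int^'n) set"]
    by (simp add: case_prod_beta')
  finally show ?thesis .
qed

lemma pair_dist_le: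
  fixes d w d' w' :: "int^'n::finite \<Rightarrow> real^3"
  assumes M: "1 \<le> M" "h = 1 / real M"
    and bc: "bc \<Omega> M d" "bc \<Omega> M d'" "bc \<Omega> M w" "bc \<Omega> M w'"
  shows "pair_dist h d w d' w' \<le> sqrt (h ^ CARD('n) * real (card (corner_shifts :: (int^'n) set))) *
    (shift_grid.grid_norm (nodes \<Omega> M) (\<lambda>i. w i - w' i) +
      (\<Sum>j\<in>UNIV. shift_grid.grid_norm (nodes \<Omega> M) (shift_grid.bdiff (prev_node \<Omega> M) h j (\<lambda>i. d i - d' i))))"
proof -
  have h: "0 < h" by (rule mesh_bounds[OF M])
  let ?G = "nodes \<Omega> M :: (int^'n) set" and ?c = "real (card (corner_shifts :: (int^'n) set))"
  interpret shift_grid ?G "next_node \<Omega> M" "prev_node \<Omega> M :: 'n \<Rightarrow> int^'n \<Rightarrow> int^'n" h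
    by (rule shift_grid_nodes[OF M(1) h])
  have est: "L2norm (pc h f) \<le> sqrt (h ^ CARD('n) * ?c) * sqrt (\<Sum>i\<in>?G. (norm (f i))\<^sup>2)"
    if "\<Omega> = Torus \<Longrightarrow> \<forall>i j. f (i + axis j (int M)) = f i" for f :: "int^'n \<Rightarrow> 'c::real_normed_vector"
  proof -
    have "(\<Sum>i\<in>grid M. (norm (f i))\<^sup>2) \<le> ?c * (\<Sum>i\<in>?G. (norm (f i))\<^sup>2)"
      using that by (intro sum_grid_le_sum_nodes M) auto
    then have "sqrt (h ^ CARD('n) * (\<Sum>i\<in>grid M. (norm (f i))\<^sup>2)) \<le> sqrt (h ^ CARD('n) * (?c * (\<Sum>i\<in>?G. (norm (f i))\<^sup>2)))"
      using h by (intro real_sqrt_le_mono mult_left_mono) auto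
    then show ?thesis
      using order_trans[OF L2norm_pc_le[OF M]] by (simp add: real_sqrt_mult mult.assoc)
  qed
  have "L2norm (\<lambda>x. pc h w x - pc h w' x) = L2norm (pc h (\<lambda>i. w i - w' i))"
    by (simp add: pc_def[abs_def])
  also have "\<dots> \<le> sqrt (h ^ CARD('n) * ?c) * sqrt (\<Sum>i\<in>?G. (norm (w i - w' i))\<^sup>2)"
    using bc(3,4) by (intro est) (simp add: bc_def)
  finally have w: "L2norm (\<lambda>x. pc h w x - pc h w' x) \<le> sqrt (h ^ CARD('n) * ?c) * grid_norm (\<lambda>i. w i - w' i)"
    by (simp add: grid_norm_def L2_set_def)
  let ?D = "\<lambda>j i. bdiff j (\<lambda>i. d i - d' i) i"
  have nab: "nabla_h h d i - nabla_h h d' i = (\<chi> j. ?D j i)" if "i \<in> ?G" for i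
    using Dminus_eq_bdiff[OF M(1) h bc(1) that] Dminus_eq_bdiff[OF M(1) h bc(2) that]
    by (simp add: nabla_h_def vec_eq_iff bdiff_diff)
  have "(\<Sum>i\<in>?G. (norm (nabla_h h d i - nabla_h h d' i))\<^sup>2) = (\<Sum>j\<in>UNIV. (grid_norm (?D j))\<^sup>2)"
  proof -
    have "(\<Sum>i\<in>?G. (norm (nabla_h h d i - nabla_h h d' i))\<^sup>2) = (\<Sum>i\<in>?G. \<Sum>j\<in>UNIV. (norm (?D j i))\<^sup>2)"
      by (intro sum.cong refl) (simp add: nab norm_vec_def L2_set_def sum_nonneg)
    also have "\<dots> = (\<Sum>j\<in>UNIV. \<Sum>i\<in>?G. (norm (?D j i))\<^sup>2)" by (rule sum.swap)
    finally show ?thesis by (simp add: grid_norm_def L2_set_def sum_nonneg)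
  qed
  then have nab_sqrt: "sqrt (\<Sum>i\<in>?G. (norm (nabla_h h d i - nabla_h h d' i))\<^sup>2) \<le> (\<Sum>j\<in>UNIV. grid_norm (?D j))"
    using L2_set_le_sum[of UNIV "\<lambda>j. grid_norm (?D j)"]
    by (simp only: L2_set_def[of "\<lambda>j. grid_norm (?D j)"]) (simp add: grid_norm_def)
  have per: "\<forall>i j. nabla_h h f (i + axis j (int M)) = nabla_h h f i" if "\<Omega> = Torus" "bc \<Omega> M f" for f :: "int^'n \<Rightarrow> real^3"
  proof (intro allI)
    fix i :: "int^'n" and j :: 'n
    have p: "\<And>i j. f (i + axis j (int M)) = f i" using that by (simp add: bc_def)
    have "f (i + axis j (int M) - axis k 1) = f (i - axis k 1)"
      "f (i + axis j (int M) - axis k 1 + axis k 1) = f (i - axis k 1 + axis k 1)" for k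
      using p[of "i - axis k 1" j] p[of i j] by (simp_all add: algebra_simps)
    then show "nabla_h h f (i + axis j (int M)) = nabla_h h f i"
      by (simp add: nabla_h_def Dminus_def Dplus_def)
  qed
  have "L2norm (\<lambda>x. pc h (nabla_h h d) x - pc h (nabla_h h d') x) = L2norm (pc h (\<lambda>i. nabla_h h d i - nabla_h h d' i))"
    by (simp add: pc_def[abs_def])
  also have "\<dots> \<le> sqrt (h ^ CARD('n) * ?c) * sqrt (\<Sum>i\<in>?G. (norm (nabla_h h d i - nabla_h h d' i))\<^sup>2)"
    using per[OF _ bc(1)] per[OF _ bc(2)] by (intro est) simp
  also have "\<dots> \<le> sqrt (h ^ CARD('n) * ?c) * (\<Sum>j\<in>UNIV. grid_norm (?D j))"
    by (rule mult_left_mono[OF nab_sqrt]) (use h in simp)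
  finally show ?thesis
    using w by (simp add: pair_dist_def distrib_left)
qed

section \<open>Convergence of the iteration\<close>

lemma scaleR_inverse_eqD:
  fixes a b :: "'a::real_vector"
  assumes "a /\<^sub>R t = b" "t \<noteq> 0"
  shows "a = t *\<^sub>R b"
  using assms by auto

lemma scheme_step:
  fixes d w :: "nat \<Rightarrow> int^'n::finite \<Rightarrow> real^3"
  assumes M: "1 \<le> M" "0 < h" and dt: "dt \<noteq> 0" and sch: "scheme_solution \<Omega> M h dt d0 dt0 d w"
  shows "shift_grid.step (nodes \<Omega> M) (next_node \<Omega> M) (prev_node \<Omega> M) h dt
    (d m) (w m) (w (Suc m)) (d (Suc m)) (w (Suc m))"
proof -
  interpret shift_grid "nodes \<Omega> M" "next_node \<Omega> M" "prev_node \<Omega> M :: 'n \<Rightarrow> int^'n \<Rightarrow> int^'n" h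
    by (rule shift_grid_nodes[OF M])
  show ?thesis
    unfolding step_def
  proof (intro ballI)
    fix i :: "int^'n" assume i: "i \<in> nodes \<Omega> M"
    then have "i \<in> grid M" using nodes_subset_grid by blast
    then have eqs: "(d (Suc m) i - d m i) /\<^sub>R dt = cross3 (mid (d m) (d (Suc m)) i) (mid (w m) (w (Suc m)) i)"
      "(w (Suc m) i - w m i) /\<^sub>R dt = cross3 (laplace_h h (mid (d m) (d (Suc m))) i) (mid (d m) (d (Suc m)) i)"
      and "bc \<Omega> M (d m)" "bc \<Omega> M (d (Suc m))"
      using sch by (auto simp: scheme_solution_def)
    then have "laplace_h h (mid (d m) (d (Suc m))) i = lap (mid (d m) (d (Suc m))) i"
      using M i by (intro laplace_h_eq_lap bc_mid)
    then show "d (Suc m) i - d m i = dt *\<^sub>R cross3 (mid (d m) (d (Suc m)) i) (mid (w m) (w (Suc m)) i) \<and>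
      w (Suc m) i - w m i = dt *\<^sub>R cross3 (lap (mid (d m) (d (Suc m))) i) (mid (d m) (d (Suc m)) i)"
      using scaleR_inverse_eqD[OF eqs(1) dt] scaleR_inverse_eqD[OF eqs(2) dt] by simp
  qed
qed

lemma iteration_step:
  fixes ds ws :: "nat \<Rightarrow> int^'n::finite \<Rightarrow> real^3"
  assumes M: "1 \<le> M" "0 < h" and dt: "dt \<noteq> 0" and bcd: "bc \<Omega> M dm"
    and it: "fixed_point_iterates \<Omega> M h dt dm wm ds ws"
  shows "shift_grid.step (nodes \<Omega> M) (next_node \<Omega> M) (prev_node \<Omega> M) h dt
    dm wm (ws s) (ds (Suc s)) (ws (Suc s))"
proof -
  interpret shift_grid "nodes \<Omega> M" "next_node \<Omega> M" "prev_node \<Omega> M :: 'n \<Rightarrow> int^'n \<Rightarrow> int^'n" h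
    by (rule shift_grid_nodes[OF M])
  show ?thesis
    unfolding step_def
  proof (intro ballI)
    fix i :: "int^'n" assume i: "i \<in> nodes \<Omega> M"
    then have "i \<in> grid M" using nodes_subset_grid by blast
    then have eqs: "(ds (Suc s) i - dm i) /\<^sub>R dt = cross3 (mid dm (ds (Suc s)) i) (mid wm (ws s) i)"
      "(ws (Suc s) i - wm i) /\<^sub>R dt =
          cross3 (mid (laplace_h h dm) (laplace_h h (ds (Suc s))) i) (mid dm (ds (Suc s)) i)"
      and bcs: "bc \<Omega> M (ds (Suc s))"
      using it by (auto simp: fixed_point_iterates_def)
    have "mid (laplace_h h dm) (laplace_h h (ds (Suc s))) i = lap (mid dm (ds (Suc s))) i"
    proof -
      have "lap (mid dm (ds (Suc s))) i = (1/2) *\<^sub>R (lap dm i + lap (ds (Suc s)) i)"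
        using lap_scale[of "1/2" "\<lambda>i. dm i - (- ds (Suc s) i)" i] lap_diff[of dm "\<lambda>i. - ds (Suc s) i" i]
          lap_scale[of "-1" "ds (Suc s)" i] by (simp add: mid_def[abs_def])
      then show ?thesis
        using laplace_h_eq_lap[OF M bcd i] laplace_h_eq_lap[OF M bcs i] by (simp add: mid_def)
    qed
    then show "ds (Suc s) i - dm i = dt *\<^sub>R cross3 (mid dm (ds (Suc s)) i) (mid wm (ws s) i) \<and>
      ws (Suc s) i - wm i = dt *\<^sub>R cross3 (lap (mid dm (ds (Suc s))) i) (mid dm (ds (Suc s)) i)"
      using scaleR_inverse_eqD[OF eqs(1) dt] scaleR_inverse_eqD[OF eqs(2) dt] by simp
  qed
qed

text \<open>
  Energy conservation transports the bound on the initial energy to every time step, so the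
  constant in front of the geometric decay is the same for all meshes and all time steps.
\<close>

lemma iteration_converges:
  fixes d0 dt0 :: "real^'n::finite \<Rightarrow> real^3"
  assumes n: "CARD('n) \<le> 3" and \<kappa>: "0 < \<kappa>" "\<kappa> \<le> 1/6"
    and d0: "d0 \<in> H1_space \<Omega>" "AE x in lebesgue_on Omega. norm (d0 x) = 1" and dt0: "dt0 \<in> L2_space \<Omega>"
  obtains Q where "0 \<le> Q"
    "\<And>M h dt d w m ds ws s. 1 \<le> M \<Longrightarrow> h = 1 / real M \<Longrightarrow> dt = \<kappa> * h \<Longrightarrow>
      scheme_solution \<Omega> M h dt d0 dt0 d w \<Longrightarrow> fixed_point_iterates \<Omega> M h dt (d m) (w m) ds ws \<Longrightarrow> 1 \<le> s \<Longrightarrow>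
      pair_dist h (d (Suc m)) (w (Suc m)) (ds s) (ws s) \<le> 32 * Q * (1/4) ^ s \<and>
      pair_dist h (ds (Suc s)) (ws (Suc s)) (ds s) (ws s) \<le> 32 * Q * (1/4) ^ s"
proof -
  let ?n = "CARD('n)" and ?c = "real (card (corner_shifts :: (int^'n) set))"
  have d0L: "d0 \<in> L2_space \<Omega>" using d0(1) by (simp add: H1_space_def)
  have "\<forall>j. \<exists>g \<in> L2_space \<Omega>. weak_deriv (case \<Omega> of Neumann_Box \<Rightarrow> box 0 1 | Torus \<Rightarrow> UNIV) j d0 g"
    using d0(1) by (simp add: H1_space_def)
  then obtain g where g: "\<And>j. g j \<in> L2_space \<Omega>"
    "\<And>j. weak_deriv (case \<Omega> of Neumann_Box \<Rightarrow> box 0 1 | Torus \<Rightarrow> UNIV) j d0 (g j)"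
    by metis
  define R where "R = 2 ^ ?n * (LINT x:region \<Omega>|lebesgue. (norm (dt0 x))\<^sup>2)
      + (\<Sum>j\<in>UNIV. 8 ^ ?n * (2 * (LINT x:region \<Omega>|lebesgue. (norm (g j x))\<^sup>2)))"
  have R0: "0 \<le> R"
    unfolding R_def set_lebesgue_integral_def
    by (intro add_nonneg_nonneg mult_nonneg_nonneg sum_nonneg Bochner_Integration.integral_nonneg) auto
  show thesis
  proof (rule that[of "sqrt (?c * R)"])
    show "0 \<le> sqrt (?c * R)" using R0 by simp
    fix M :: nat and h dt :: real and d w :: "nat \<Rightarrow> int^'n \<Rightarrow> real^3" and m :: nat
      and ds ws :: "nat \<Rightarrow> int^'n \<Rightarrow> real^3" and s :: nat
    assume M: "1 \<le> M" "h = 1 / real M" and dt: "dt = \<kappa> * h"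
      and sch: "scheme_solution \<Omega> M h dt d0 dt0 d w"
      and it: "fixed_point_iterates \<Omega> M h dt (d m) (w m) ds ws" and s: "1 \<le> s"
    have h: "0 < h" by (rule mesh_bounds[OF M])
    have dtn: "dt \<noteq> 0" using dt h \<kappa> by simp
    interpret shift_grid "nodes \<Omega> M" "next_node \<Omega> M" "prev_node \<Omega> M :: 'n \<Rightarrow> int^'n \<Rightarrow> int^'n" h
      by (rule shift_grid_nodes[OF M(1) h])
    have bcd: "bc \<Omega> M (d k)" "bc \<Omega> M (w k)" for k using sch by (auto simp: scheme_solution_def)
    have bcs: "bc \<Omega> M (ds k)" "bc \<Omega> M (ws k)" for k using it by (auto simp: fixed_point_iterates_def)
    have ini: "d 0 i = cell_average \<Omega> h d0 i" "w 0 i = cell_average \<Omega> h (\<lambda>x. cross3 (dt0 x) (d0 x)) i"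
      if "i \<in> grid M" for i
      using sch that by (auto simp: scheme_solution_def)
    note step = scheme_step[OF M(1) h dtn sch]
    have E: "energy (d k) (w k) = energy (d 0) (w 0)" for k
      by (induction k) (simp_all add: energy_step[OF step])
    have unit: "norm (d k i) \<le> 1" if i: "i \<in> nodes \<Omega> M" for k i
    proof (induction k)
      case 0
      have "i \<in> grid M" using i nodes_subset_grid by blast
      then show ?case
        using norm_initial_director_le[OF M _ d0L d0(2)] ini(1) by simp
    qed (use step_norm[OF step i] in simp)
    have "h ^ ?n * energy (d 0) (w 0) \<le> R"
      unfolding R_def
      by (rule initial_energy_bound[OF M d0L d0(2) dt0 g bcd(1)]) (simp_all add: ini)
    then have "sqrt (h ^ ?n * ?c) * sqrt (energy (d m) (w m)) \<le> sqrt (?c * R)"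
      unfolding real_sqrt_mult[symmetric] E[of m]
      by (intro real_sqrt_le_mono) (simp add: mult.assoc mult.left_commute mult_left_mono)
    then have Q: "32 * (1/4) ^ s * (sqrt (h ^ ?n * ?c) * sqrt (energy (d m) (w m))) \<le> 32 * (1/4) ^ s * sqrt (?c * R)"
      by (rule mult_left_mono) simp
    have A: "0 \<le> sqrt (h ^ ?n * ?c)" using h by simp
    have ws0: "ws 0 = w m" using it by (simp add: fixed_point_iterates_def)
    note err = iteration_error[OF dt less_imp_le[OF \<kappa>(1)] \<kappa>(2) n unit step
        iteration_step[OF M(1) h dtn bcd(1) it] ws0 s]
    have "pair_dist h (ds (Suc s)) (ws (Suc s)) (ds s) (ws s)
        \<le> sqrt (h ^ ?n * ?c) * (32 * (1/4) ^ s * sqrt (energy (d m) (w m)))"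
      by (rule order_trans[OF pair_dist_le[OF M bcs(1) bcs(1) bcs(2) bcs(2)] mult_left_mono[OF err(2) A]])
    moreover have "pair_dist h (d (Suc m)) (w (Suc m)) (ds s) (ws s)
        \<le> sqrt (h ^ ?n * ?c) * (16 * (1/4) ^ s * sqrt (energy (d m) (w m)))"
      by (rule order_trans[OF pair_dist_le[OF M bcd(1) bcs(1) bcd(2) bcs(2)] mult_left_mono[OF err(1) A]])
    moreover have "sqrt (h ^ ?n * ?c) * (16 * (1/4) ^ s * sqrt (energy (d m) (w m)))
        \<le> sqrt (h ^ ?n * ?c) * (32 * (1/4) ^ s * sqrt (energy (d m) (w m)))"
    proof (intro mult_left_mono[OF _ A] mult_right_mono)
      show "0 \<le> sqrt (energy (d m) (w m))"
        by (auto simp: energy_def intro!: add_nonneg_nonneg sum_nonneg)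
    qed simp_all
    ultimately show "pair_dist h (d (Suc m)) (w (Suc m)) (ds s) (ws s) \<le> 32 * sqrt (?c * R) * (1/4) ^ s \<and>
      pair_dist h (ds (Suc s)) (ws (Suc s)) (ds s) (ws s) \<le> 32 * sqrt (?c * R) * (1/4) ^ s"
      using Q by (simp only: mult_ac) linarith
  qed
qed

text \<open>
  The number of iterations is affine in \<open>\<bar>ln \<epsilon>\<bar>\<close>; the tolerance \<open>exp (-1)\<close> is small enough for
  the constant part to be absorbed.
\<close>

theorem theorem4p2:
  fixes \<Omega> :: domain
  assumes dim: "CARD('n::finite) = 2 \<or> CARD('n) = 3"
  shows "\<exists>\<kappa>0 \<epsilon>0 :: real. 0 < \<kappa>0 \<and> 0 < \<epsilon>0 \<and> \<epsilon>0 < 1 \<and>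
    (\<forall>\<kappa>. 0 < \<kappa> \<and> \<kappa> \<le> \<kappa>0 \<longrightarrow>
      (\<forall>(d0 :: real^'n \<Rightarrow> real^3) \<in> H1_space \<Omega>. \<forall>dt0 \<in> L2_space \<Omega>.
        (AE x in lebesgue_on Omega. norm (d0 x) = 1) \<longrightarrow>
        (\<exists>C>0. \<forall>(M::nat) (h::real) (dt::real) d w.
          M \<ge> 1 \<and> h = 1 / real M \<and> dt = \<kappa> * h \<and> scheme_solution \<Omega> M h dt d0 dt0 d w \<longrightarrow>
          (\<forall>m ds ws. fixed_point_iterates \<Omega> M h dt (d m) (w m) ds ws \<longrightarrow>
            (\<forall>\<epsilon>. 0 < \<epsilon> \<and> \<epsilon> < \<epsilon>0 \<longrightarrow>
              (\<exists>sbar::nat. 1 \<le> sbar \<and> real sbar \<le> C * \<bar>ln \<epsilon>\<bar> \<and>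
                pair_dist h (ds (Suc sbar)) (ws (Suc sbar)) (ds sbar) (ws sbar) < \<epsilon> \<and>
                (\<forall>s\<ge>sbar. pair_dist h (d (Suc m)) (w (Suc m)) (ds s) (ws s) < \<epsilon>)))))))"
proof (rule exI[of _ "1/6"], rule exI[of _ "exp (-1)"], intro conjI allI ballI impI; (elim conjE)?)
  fix \<kappa> :: real and d0 dt0 :: "real^'n \<Rightarrow> real^3"
  assume \<kappa>: "0 < \<kappa>" "\<kappa> \<le> 1/6" and d0: "d0 \<in> H1_space \<Omega>" "AE x in lebesgue_on Omega. norm (d0 x) = 1"
    and dt0: "dt0 \<in> L2_space \<Omega>"
  have "CARD('n) \<le> 3" using dim by auto
  then obtain Q where Q: "0 \<le> Q" and conv:
    "\<And>M h dt d w m ds ws s. 1 \<le> M \<Longrightarrow> h = 1 / real M \<Longrightarrow> dt = \<kappa> * h \<Longrightarrow>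
      scheme_solution \<Omega> M h dt d0 dt0 d w \<Longrightarrow> fixed_point_iterates \<Omega> M h dt (d m) (w m) ds ws \<Longrightarrow> 1 \<le> s \<Longrightarrow>
      pair_dist h (d (Suc m)) (w (Suc m)) (ds s) (ws s) \<le> 32 * Q * (1/4) ^ s \<and>
      pair_dist h (ds (Suc s)) (ws (Suc s)) (ds s) (ws s) \<le> 32 * Q * (1/4) ^ s"
    using iteration_converges[OF _ \<kappa> d0 dt0] by metis
  \<comment> \<open>The summand \<open>1\<close> makes \<open>K\<close> nonnegative and covers the case \<open>Q = 0\<close>.\<close>
  define K where "K = ln (32 * Q + 1)"
  have K: "0 \<le> K" using Q by (simp add: K_def)
  show "\<exists>C>0. \<forall>(M::nat) (h::real) (dt::real) d w.
          M \<ge> 1 \<and> h = 1 / real M \<and> dt = \<kappa> * h \<and> scheme_solution \<Omega> M h dt d0 dt0 d w \<longrightarrow>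
          (\<forall>m ds ws. fixed_point_iterates \<Omega> M h dt (d m) (w m) ds ws \<longrightarrow>
            (\<forall>\<epsilon>. 0 < \<epsilon> \<and> \<epsilon> < exp (-1) \<longrightarrow>
              (\<exists>sbar::nat. 1 \<le> sbar \<and> real sbar \<le> C * \<bar>ln \<epsilon>\<bar> \<and>
                pair_dist h (ds (Suc sbar)) (ws (Suc sbar)) (ds sbar) (ws sbar) < \<epsilon> \<and>
                (\<forall>s\<ge>sbar. pair_dist h (d (Suc m)) (w (Suc m)) (ds s) (ws s) < \<epsilon>))))"
  proof (rule exI[of _ "K + 3"], intro conjI allI impI; (elim conjE)?)
    show "0 < K + 3" using K by simp
    fix M :: nat and h dt :: real and d w :: "nat \<Rightarrow> int^'n \<Rightarrow> real^3" and m :: nat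
      and ds ws :: "nat \<Rightarrow> int^'n \<Rightarrow> real^3" and \<epsilon> :: real
    assume M: "1 \<le> M" "h = 1 / real M" and dt: "dt = \<kappa> * h"
      and sch: "scheme_solution \<Omega> M h dt d0 dt0 d w"
      and it: "fixed_point_iterates \<Omega> M h dt (d m) (w m) ds ws" and \<epsilon>: "0 < \<epsilon>" "\<epsilon> < exp (-1)"
    define L where "L = \<bar>ln \<epsilon>\<bar>"
    have "ln \<epsilon> < -1" using \<epsilon> by (metis ln_exp ln_less_cancel_iff exp_gt_zero)
    then have L: "1 \<le> L" "ln \<epsilon> = - L" by (auto simp: L_def)
    define sbar where "sbar = nat \<lceil>K + L\<rceil> + 1"
    have sbar: "K + L < real sbar" "real sbar \<le> K + L + 2"
      using K L(1) unfolding sbar_def by linarith+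
    have small: "32 * Q * (1/4) ^ s < \<epsilon>" if s: "sbar \<le> s" for s
    proof -
      have "(1/4 :: real) ^ s \<le> exp (-1) ^ s"
        using exp_le by (intro power_mono) (auto simp: exp_minus field_simps)
      also have "\<dots> = exp (- real s)" by (simp flip: exp_of_nat_mult)
      also have "\<dots> < exp (- K - L)" using sbar(1) s by simp
      also have "\<dots> = \<epsilon> / (32 * Q + 1)"
      proof -
        have "exp (- K - L) = exp (ln \<epsilon>) / exp K" by (simp add: L(2) exp_diff exp_minus field_simps)
        then show ?thesis using \<epsilon>(1) Q by (simp add: K_def)
      qed
      finally have "(32 * Q + 1) * (1/4) ^ s < \<epsilon>"
        using Q by (simp add: less_divide_eq mult.commute)
      moreover have "32 * Q * (1/4) ^ s \<le> (32 * Q + 1) * (1/4) ^ s"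
        by (intro mult_right_mono) auto
      ultimately show ?thesis by linarith
    qed
    show "\<exists>sbar::nat. 1 \<le> sbar \<and> real sbar \<le> (K + 3) * \<bar>ln \<epsilon>\<bar> \<and>
                pair_dist h (ds (Suc sbar)) (ws (Suc sbar)) (ds sbar) (ws sbar) < \<epsilon> \<and>
                (\<forall>s\<ge>sbar. pair_dist h (d (Suc m)) (w (Suc m)) (ds s) (ws s) < \<epsilon>)"
    proof (intro exI[of _ sbar] conjI allI impI)
      show s1: "1 \<le> sbar" by (simp add: sbar_def)
      have "K + L + 2 \<le> K * L + L + 2 * L"
        using K L(1) mult_left_mono[OF L(1) K] by (intro add_mono) auto
      then show "real sbar \<le> (K + 3) * \<bar>ln \<epsilon>\<bar>"
        using sbar(2) by (simp add: L_def[symmetric] distrib_right)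
      show "pair_dist h (ds (Suc sbar)) (ws (Suc sbar)) (ds sbar) (ws sbar) < \<epsilon>"
        using conv[OF M dt sch it s1] small[of sbar] by simp
      show "pair_dist h (d (Suc m)) (w (Suc m)) (ds s) (ws s) < \<epsilon>" if "sbar \<le> s" for s
        using conv[OF M dt sch it order_trans[OF s1 that]] small[OF that] by simp
    qed
  qed
qed simp_all

end
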